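(* Let $\mathcal{P}$ be the algebra of on-shell polynomials in the fields $v_\mu,u,\tilde u,\Phi$ of mass $m>0$ and their derivatives, with the differential $d_Q$, and let $Z_Q$ be its space of cocycles. Let $p \in Z_{Q}$. Then $p$ is cohomologous to a polynomial in $F^{(0)}_{\mu\nu;\rho_{1},\dots,\rho_{n}}$ ($n\ge 0$) and $\phi^{(0)}_{\mu_{1},\dots,\mu_{n}}$ ($n\ge1$). If one factorizes the space $\mathcal{P}_{0} \subset \mathcal{P}$ of such polynomials by the Bianchi identities, one obtains a space isomorphic to the cohomology space $H_{Q}$ of $d_{Q}$.
   Context: Four-dimensional Minkowski space, $\eta=\mathrm{diag}(1,-1,-1,-1)$. $\mathcal{P}$ is the graded-commutative algebra of polynomials in the classical fields $v_\mu,\Phi$ (even), $u,\tilde u$ (odd) and their derivatives, on the mass shell of mass $m>0$: each field $y$ satisfies $(d_\mu d^\mu+m^2)y=0$ together with all derivatives of this equation; $d_\mu$ are the formal (total) derivatives, and indices after a semicolon denote such derivatives. $d_Q$ is the graded derivation of $\mathcal{P}$ with $$d_{Q}v_{\mu} = i\, d_{\mu}u, \quad d_{Q}u = 0, \quad d_{Q}\tilde{u} = - i\,C, \quad d_{Q}\Phi = i\,m\,u,\quad [d_{Q}, d_{\mu} ] = 0,\qquad C \equiv d_{\mu}v^{\mu} + m \Phi;$$ $d_Q^2=0$. $Z_Q=\ker d_Q$, $B_Q=d_Q\mathcal{P}$, $H_Q=Z_Q/B_Q$; two cocycles are cohomologous if they differ by an element of $B_Q$. Put $F_{\mu\nu}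 = d_{\mu}v_{\nu} - d_{\nu}v_{\mu}$, $F_{\mu\nu;\rho_1,\dots,\rho_n}=d_{\rho_1}\cdots d_{\rho_n}F_{\mu\nu}$, $$g_{\mu_{1},\dots,\mu_{n}} \equiv \frac1n\sum_{l=1}^{n} v_{\mu_{l};\mu_{1},\dots,\hat{\mu}_{l},\dots,\mu_{n}},\qquad \phi_{\mu} \equiv d_{\mu}\Phi - m\,v_{\mu},\qquad \phi_{\mu_{1},\dots,\mu_{n}} \equiv d_{\mu_{1}}\cdots d_{\mu_{n}}\Phi - m\,g_{\mu_{1},\dots,\mu_{n}}\ (n \geq 2).$$ For a tensor $t_{\mu_1,\dots,\mu_n}$, its traceless part is the traceless tensor $t^{(0)}_{\mu_1,\dots,\mu_n}$ such that $t-t^{(0)}$ is a sum of terms each containing at least one factor $\eta_{\mu_i\mu_j}$ (it exists and is a linear combination of $t$ and products of $\eta$'s with traces of $t$). $F^{(0)}_{\mu\nu;\rho_1,\dots,\rho_n}$ and $\phi^{(0)}_{\mu_1,\dots,\mu_n}$ are the traceless parts (in all indices) of $F_{\mu\nu;\rho_1,\dots,\rho_n}$ and $\phi_{\mu_1,\dots,\mu_n}$. The Bianchi identities are the relations among the $F^{(0)}$ coming from $F_{\mu\nu;\rho} + F_{\nu\rho;\mu} + F_{\rho\mu;\nu} = 0$ and its derivatives. *)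

theory Defs
  imports
    Complex_Main
    "HOL-Library.Multiset"
    "HOL-Library.Numeral_Type"
    "HOL-Library.Poly_Mapping"
    "HOL-Algebra.Algebraic_Closure_Type"
    "HOL-Algebra.Generated_Rings"
    "HOL-Algebra.QuotRing"
begin

section \<open>Free associative algebras over the complex numbers\<close>

datatype 'a fmon = FMon (letters: "'a list")

instantiation fmon :: (type) monoid_add
begin
definition zero_fmon :: "'a fmon" where "0 = FMon []"
definition plus_fmon :: "'a fmon \<Rightarrow> 'a fmon \<Rightarrow> 'a fmon"
  where "x + y = FMon (letters x @ letters y)"
instance by standard (auto simp: zero_fmon_def plus_fmon_def)
end

text \<open>Noncommutative polynomials; multiplication is the convolution product of
  \<^theory>\<open>HOL-Library.Poly_Mapping\<close> over the monoid of words.\<close>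

type_synonym 'a free_alg = "'a fmon \<Rightarrow>\<^sub>0 complex"

definition word :: "'a list \<Rightarrow> 'a free_alg" where
  "word xs = Poly_Mapping.single (FMon xs) 1"

definition gen :: "'a \<Rightarrow> 'a free_alg" where
  "gen x = word [x]"

definition cnst :: "complex \<Rightarrow> 'a free_alg" where
  "cnst c = Poly_Mapping.single 0 c"

abbreviation FA :: "'a free_alg ring" where
  "FA \<equiv> ring_of_type_algebra"

definition linear_ext :: "('a list \<Rightarrow> 'b free_alg) \<Rightarrow> 'a free_alg \<Rightarrow> 'b free_alg" where
  "linear_ext f p =
     (\<Sum>w\<in>Poly_Mapping.keys p. cnst (Poly_Mapping.lookup p w) * f (letters w))"

text \<open>The derivation with \<open>d (x * y) = d x * y + s x * x * d y\<close> for generators \<open>x\<close>, where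
  \<open>s\<close> is \<open>1\<close> for even derivations and the parity sign for odd ones.\<close>

primrec derivation_word ::
  "('a \<Rightarrow> complex) \<Rightarrow> ('a \<Rightarrow> 'a free_alg) \<Rightarrow> 'a list \<Rightarrow> 'a free_alg" where
  "derivation_word s d [] = 0"
| "derivation_word s d (x # xs) =
     d x * word xs + cnst (s x) * gen x * derivation_word s d xs"

definition derivation ::
  "('a \<Rightarrow> complex) \<Rightarrow> ('a \<Rightarrow> 'a free_alg) \<Rightarrow> 'a free_alg \<Rightarrow> 'a free_alg" where
  "derivation s d = linear_ext (derivation_word s d)"


section \<open>Fields and their formal derivatives\<close>

text \<open>Lorentz indices are the elements \<open>0, 1, 2, 3\<close> of type \<^typ>\<open>4\<close>. The matrix below is its own
  inverse, so it serves for both positions of the indices.\<close>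

definition eta :: "4 \<Rightarrow> 4 \<Rightarrow> complex" where
  "eta \<mu> \<nu> = (if \<mu> \<noteq> \<nu> then 0 else if \<mu> = 0 then 1 else - 1)"

datatype field = V 4 | Phi | U | Ut

text \<open>\<open>(y, {#\<mu>\<^sub>1, \<dots>, \<mu>\<^sub>n#})\<close> stands for \<open>y\<close> differentiated in the directions
  \<open>\<mu>\<^sub>1, \<dots>, \<mu>\<^sub>n\<close>; formal derivatives commute, hence the multiset.\<close>

type_synonym jet = "field \<times> 4 multiset"

definition jet_sign :: "jet \<Rightarrow> complex" where
  "jet_sign x = (if fst x \<in> {U, Ut} then - 1 else 1)"

text \<open>The values of \<open>d\<^sub>Q\<close> on derivatives of the fields are forced by \<open>[d\<^sub>Q, d\<^sub>\<mu>] = 0\<close>.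
  The case \<open>Ut\<close> is \<open>- i\<close> times the derivative of \<open>C = d\<^sub>\<mu> v\<^sup>\<mu> + m \<Phi>\<close>.\<close>

fun dQ_jet :: "real \<Rightarrow> jet \<Rightarrow> jet free_alg" where
  "dQ_jet m (V \<mu>, \<alpha>) = cnst \<i> * gen (U, add_mset \<mu> \<alpha>)"
| "dQ_jet m (U, \<alpha>) = 0"
| "dQ_jet m (Ut, \<alpha>) = cnst (- \<i>) *
     ((\<Sum>\<mu>\<in>UNIV. \<Sum>\<nu>\<in>UNIV. cnst (eta \<mu> \<nu>) * gen (V \<nu>, add_mset \<mu> \<alpha>))
      + cnst (of_real m) * gen (Phi, \<alpha>))"
| "dQ_jet m (Phi, \<alpha>) = cnst (\<i> * of_real m) * gen (U, \<alpha>)"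

definition dQ_free :: "real \<Rightarrow> jet free_alg \<Rightarrow> jet free_alg" where
  "dQ_free m = derivation jet_sign (dQ_jet m)"


section \<open>The algebra of on-shell polynomials\<close>

text \<open>\<open>x y = y x\<close>, with a minus sign if both are odd (so odd generators square to \<open>0\<close>).\<close>

definition graded_commutators :: "jet free_alg set" where
  "graded_commutators =
     {gen x * gen y - cnst (if jet_sign x = - 1 \<and> jet_sign y = - 1 then - 1 else 1) * gen y * gen x
      | x y. True}"

definition mass_shell :: "real \<Rightarrow> jet free_alg set" where
  "mass_shell m =
     {(\<Sum>\<mu>\<in>UNIV. \<Sum>\<nu>\<in>UNIV. cnst (eta \<mu> \<nu>) * gen (y, add_mset \<mu> (add_mset \<nu> \<alpha>)))
        + cnst ((of_real m)\<^sup>2) * gen (y, \<alpha>) | y \<alpha>. True}"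

definition shell_ideal :: "real \<Rightarrow> jet free_alg set" where
  "shell_ideal m = Idl\<^bsub>FA\<^esub> (graded_commutators \<union> mass_shell m)"

definition P :: "real \<Rightarrow> jet free_alg set ring" where
  "P m = FA Quot shell_ideal m"

definition cls :: "real \<Rightarrow> jet free_alg \<Rightarrow> jet free_alg set" where
  "cls m p = shell_ideal m +>\<^bsub>FA\<^esub> p"

text \<open>The scalar \<open>c\<close> as an element of \<open>P\<close>.\<close>

definition scal :: "real \<Rightarrow> complex \<Rightarrow> jet free_alg set" where
  "scal m c = cls m (cnst c)"

text \<open>The operator induced by \<^const>\<open>dQ_free\<close> on classes (it preserves the ideal, so all
  members of the union coincide).\<close>

definition d_Q :: "real \<Rightarrow> jet free_alg set \<Rightarrow> jet free_alg set" where
  "d_Q m A = (\<Union>p\<in>A. cls m (dQ_free m p))"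

definition Z_Q :: "real \<Rightarrow> jet free_alg set set" where
  "Z_Q m = {A \<in> carrier (P m). d_Q m A = \<zero>\<^bsub>P m\<^esub>}"

definition B_Q :: "real \<Rightarrow> jet free_alg set set" where
  "B_Q m = d_Q m ` carrier (P m)"

text \<open>\<open>B\<^sub>Q\<close> is an ideal of the algebra \<open>Z\<^sub>Q\<close>; as an additive group the quotient below is the
  group of cosets \<open>Z\<^sub>Q / B\<^sub>Q\<close>.\<close>

definition H_Q :: "real \<Rightarrow> jet free_alg set set ring" where
  "H_Q m = (P m)\<lparr>carrier := Z_Q m\<rparr> Quot B_Q m"


section \<open>Traceless parts\<close>

text \<open>A tensor of rank \<open>n\<close> is a function on index lists of length \<open>n\<close>.\<close>

definition traceless :: "real \<Rightarrow> nat \<Rightarrow> (4 list \<Rightarrow> jet free_alg set) \<Rightarrow> bool" where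
  "traceless m n t \<longleftrightarrow>
     (\<forall>xs i j. length xs = n \<and> i < j \<and> j < n \<longrightarrow>
        (\<Oplus>\<^bsub>P m\<^esub>\<mu>\<in>UNIV. \<Oplus>\<^bsub>P m\<^esub>\<nu>\<in>UNIV. scal m (eta \<mu> \<nu>) \<otimes>\<^bsub>P m\<^esub> t (xs[i := \<mu>, j := \<nu>])) = \<zero>\<^bsub>P m\<^esub>)"

text \<open>Here \<open>s i j\<close> is the tensor of rank \<open>n - 2\<close> multiplying \<open>\<eta>\<close> in the \<open>i\<close>-th and \<open>j\<close>-th
  index; its arguments are the remaining indices.\<close>

definition is_eta_sum :: "real \<Rightarrow> nat \<Rightarrow> (4 list \<Rightarrow> jet free_alg set) \<Rightarrow> bool" where
  "is_eta_sum m n t \<longleftrightarrow>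
     (\<exists>s. (\<forall>i j ys. s i j ys \<in> carrier (P m)) \<and>
        (\<forall>xs. length xs = n \<longrightarrow>
           t xs = (\<Oplus>\<^bsub>P m\<^esub>j\<in>{..<n}. \<Oplus>\<^bsub>P m\<^esub>i\<in>{..<j}.
                     scal m (eta (xs ! i) (xs ! j)) \<otimes>\<^bsub>P m\<^esub> s i j (nths xs (- {i, j})))))"

definition is_traceless_part ::
  "real \<Rightarrow> nat \<Rightarrow> (4 list \<Rightarrow> jet free_alg set) \<Rightarrow> (4 list \<Rightarrow> jet free_alg set) \<Rightarrow> bool" where
  "is_traceless_part m n t t0 \<longleftrightarrow>
     (\<forall>xs. length xs = n \<longrightarrow> t0 xs \<in> carrier (P m)) \<and> traceless m n t0 \<and>
     is_eta_sum m n (\<lambda>xs. t xs \<ominus>\<^bsub>P m\<^esub> t0 xs)"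

text \<open>The component with indices \<open>xs\<close> of the traceless part, the rank being the length of
  \<open>xs\<close>. (The description is applied to the component because \<open>t0\<close> is only determined on
  lists of the right length.)\<close>

definition traceless_part ::
  "real \<Rightarrow> (4 list \<Rightarrow> jet free_alg set) \<Rightarrow> 4 list \<Rightarrow> jet free_alg set" where
  "traceless_part m t xs = (THE x. \<exists>t0. is_traceless_part m (length xs) t t0 \<and> x = t0 xs)"


section \<open>The tensors \<open>F\<close> and \<open>\<phi>\<close>\<close>

definition F_free :: "4 \<Rightarrow> 4 \<Rightarrow> 4 list \<Rightarrow> jet free_alg" where
  "F_free \<mu> \<nu> \<rho>s = gen (V \<nu>, mset (\<mu> # \<rho>s)) - gen (V \<mu>, mset (\<nu> # \<rho>s))"

definition g_free :: "4 list \<Rightarrow> jet free_alg" where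
  "g_free xs = cnst (1 / of_nat (length xs)) *
     (\<Sum>l<length xs. gen (V (xs ! l), mset xs - {#xs ! l#}))"

text \<open>For a single index this is \<open>d\<^sub>\<mu> \<Phi> - m v\<^sub>\<mu>\<close>, since then \<open>g\<^sub>\<mu> = v\<^sub>\<mu>\<close>.\<close>

definition phi_free :: "real \<Rightarrow> 4 list \<Rightarrow> jet free_alg" where
  "phi_free m xs = gen (Phi, mset xs) - cnst (of_real m) * g_free xs"

definition F0 :: "real \<Rightarrow> 4 \<Rightarrow> 4 \<Rightarrow> 4 list \<Rightarrow> jet free_alg set" where
  "F0 m \<mu> \<nu> \<rho>s =
     traceless_part m (\<lambda>xs. cls m (F_free (xs ! 0) (xs ! 1) (drop 2 xs))) (\<mu> # \<nu> # \<rho>s)"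

definition phi0 :: "real \<Rightarrow> 4 list \<Rightarrow> jet free_alg set" where
  "phi0 m xs = traceless_part m (\<lambda>xs. cls m (phi_free m xs)) xs"


section \<open>Polynomials in the traceless tensors and the Bianchi identities\<close>

definition P0 :: "real \<Rightarrow> jet free_alg set set" where
  "P0 m = generate_ring (P m)
     (range (scal m) \<union> {F0 m \<mu> \<nu> \<rho>s | \<mu> \<nu> \<rho>s. True} \<union> {phi0 m xs | xs. xs \<noteq> []})"

abbreviation P0_alg :: "real \<Rightarrow> jet free_alg set ring" where
  "P0_alg m \<equiv> (P m)\<lparr>carrier := P0 m\<rparr>"

definition bianchi :: "real \<Rightarrow> jet free_alg set set" where
  "bianchi m = Idl\<^bsub>P0_alg m\<^esub>
     {F0 m \<mu> \<nu> (\<rho> # \<sigma>s) \<oplus>\<^bsub>P m\<^esub> F0 m \<nu> \<rho> (\<mu> # \<sigma>s) \<oplus>\<^bsub>P m\<^esub> F0 m \<rho> \<mu> (\<nu> # \<sigma>s)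
      | \<mu> \<nu> \<rho> \<sigma>s. True}"

text \<open>Inside \<open>P\<close> the Bianchi identities already hold. To express that they are the only
  relations we also need polynomials in formal symbols for the components of the tensors.
  \<open>SPhi \<mu> \<nu>s\<close> stands for \<open>\<phi>\<close> with the indices \<open>\<mu> # \<nu>s\<close>, of which there is at least one.\<close>

datatype symb = SF 4 4 "4 list" | SPhi 4 "4 list"

definition symb_commutators :: "symb free_alg set" where
  "symb_commutators = {gen x * gen y - gen y * gen x | x y. True}"

definition traces :: "(4 list \<Rightarrow> symb free_alg) \<Rightarrow> nat \<Rightarrow> symb free_alg set" where
  "traces t n =
     {\<Sum>\<mu>\<in>UNIV. \<Sum>\<nu>\<in>UNIV. cnst (eta \<mu> \<nu>) * t (xs[i := \<mu>, j := \<nu>])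
      | xs i j. length xs = n \<and> i < j \<and> j < n}"

text \<open>What it means for the symbols to be components of traceless tensors with the index
  symmetries of \<open>F\<^sub>\<mu>\<^sub>\<nu>\<^sub>;\<^sub>\<rho>\<^sub>1\<^sub>\<dots>\<close> and \<open>\<phi>\<^sub>\<mu>\<^sub>1\<^sub>\<dots>\<close>.\<close>

definition symb_symmetries :: "symb free_alg set" where
  "symb_symmetries =
     {gen (SF \<mu> \<nu> \<rho>s) + gen (SF \<nu> \<mu> \<rho>s) | \<mu> \<nu> \<rho>s. True} \<union>
     {gen (SF \<mu> \<nu> \<rho>s) - gen (SF \<mu> \<nu> \<rho>s') | \<mu> \<nu> \<rho>s \<rho>s'. mset \<rho>s = mset \<rho>s'} \<union>
     {gen (SPhi \<mu> \<nu>s) - gen (SPhi \<mu>' \<nu>s') | \<mu> \<nu>s \<mu>' \<nu>s'. mset (\<mu> # \<nu>s) = mset (\<mu>' # \<nu>s')} \<union>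
     (\<Union>n\<in>{2..}. traces (\<lambda>xs. gen (SF (xs ! 0) (xs ! 1) (drop 2 xs))) n) \<union>
     (\<Union>n\<in>{1..}. traces (\<lambda>xs. gen (SPhi (hd xs) (tl xs))) n)"

definition symb_bianchi :: "symb free_alg set" where
  "symb_bianchi =
     {gen (SF \<mu> \<nu> (\<rho> # \<sigma>s)) + gen (SF \<nu> \<rho> (\<mu> # \<sigma>s)) + gen (SF \<rho> \<mu> (\<nu> # \<sigma>s))
      | \<mu> \<nu> \<rho> \<sigma>s. True}"

definition symb_ideal :: "symb free_alg set" where
  "symb_ideal = Idl\<^bsub>FA\<^esub> (symb_commutators \<union> symb_symmetries \<union> symb_bianchi)"

fun symb_val :: "real \<Rightarrow> symb \<Rightarrow> jet free_alg set" where
  "symb_val m (SF \<mu> \<nu> \<rho>s) = F0 m \<mu> \<nu> \<rho>s"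
| "symb_val m (SPhi \<mu> \<nu>s) = phi0 m (\<mu> # \<nu>s)"

definition symb_eval :: "real \<Rightarrow> symb free_alg \<Rightarrow> jet free_alg set" where
  "symb_eval m p =
     (\<Oplus>\<^bsub>P m\<^esub>w\<in>Poly_Mapping.keys p. scal m (Poly_Mapping.lookup p w) \<otimes>\<^bsub>P m\<^esub>
        foldr (\<lambda>x y. symb_val m x \<otimes>\<^bsub>P m\<^esub> y) (letters w) \<one>\<^bsub>P m\<^esub>)"


section \<open>Isomorphisms of complex vector spaces\<close>

text \<open>All spaces in question are quotients of complex algebras, in which multiplication by a
  scalar \<open>c\<close> is multiplication by \<open>\<iota> c\<close>, the image of \<open>c\<close> in the algebra.\<close>

definition linear_iso ::
  "('a, 'x) ring_scheme \<Rightarrow> (complex \<Rightarrow> 'a) \<Rightarrow> ('b, 'y) ring_scheme \<Rightarrow> (complex \<Rightarrow> 'b) \<Rightarrow>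
   ('a \<Rightarrow> 'b) \<Rightarrow> bool" where
  "linear_iso A \<iota> B \<kappa> f \<longleftrightarrow>
     f \<in> iso (add_monoid A) (add_monoid B) \<and>
     (\<forall>c. \<forall>x\<in>carrier A. f (\<iota> c \<otimes>\<^bsub>A\<^esub> x) = \<kappa> c \<otimes>\<^bsub>B\<^esub> f x)"

definition H_scal :: "real \<Rightarrow> complex \<Rightarrow> jet free_alg set set" where
  "H_scal m c = B_Q m +>\<^bsub>P m\<^esub> scal m c"

end

(*
  Proof idea. On the free algebra there is an odd derivation K whose anticommutator with d_Q is, on
  shell, a derivation that is the projection of the linear fields onto the span of Phi, u, the other
  ghost and the divergence of v. Decomposing a closed polynomial by the eigenvalues 0, 1, 2, ... of
  this derivation, all components of positive weight are exact, and what remains is a polynomial in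
  the jets of the divergence-free field v_mu + m^-2 d_mu d_nu v^nu. Up to exact terms this is
  -1/m times d_mu Phi - m v_mu, and induction on the order of the jet expresses it by the
  tensors F^(0) and phi^(0): all its traces are jets of lower order.

  Conversely, prescribed traceless tensors with the symmetries of F^(0) and phi^(0) that satisfy the
  Bianchi identities come from a Proca field A: take the harmonic jet with
  the given curl and symmetric part, extend it to a solution of the Klein-Gordon equation by a power
  series in x^2, and add m^-2 times the gradient of the divergence. Over the algebra of symbols
  modulo the relations, v -> A, all other fields -> 0, defines a homomorphism that kills the mass
  shell and the image of d_Q and inverts the evaluation of symbols. So the evaluation is injective
  modulo exact polynomials. As the Bianchi identities hold in the on-shell algebra, the first
  quotient is by the zero ideal.
*)

theory Submission
  imports Defs
begin

section \<open>Noncommutative polynomials: homomorphisms, graded derivations and ideals\<close>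

section \<open>Free algebras\<close>

text \<open>The hard point is that the listed relations are complete. No basis of the symbols modulo
  index symmetries, traces and Bianchi identities is chosen; completeness is witnessed by a left
  inverse of the evaluation. Sending \<open>Phi\<close> and the ghosts to zero is the unitary gauge,
  in which a massive vector field is a Proca field; so inverting the evaluation amounts to solving
  the Proca equations with prescribed traceless Taylor data.

  Tensor components live in arbitrary real vector spaces. The traceless projection has real
  coefficients, so a single projection acts on tensors over the free algebra of jets and over the
  algebra of symbols, and it commutes with linear maps between them.

  Derivations and homomorphisms are defined on free algebras by their values on generators, and
  relations enter as membership in an ideal; cosets are formed only at the end.

  The mass is inverted in three places: in the homotopy, in the removal of the divergence, and in
  recovering the scalar tensors from the symmetrization of \<open>v\<close>.\<close>

instantiation poly_mapping :: (type, real_vector) real_vector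
begin

lift_definition scaleR_poly_mapping :: "real \<Rightarrow> ('a \<Rightarrow>\<^sub>0 'b) \<Rightarrow> 'a \<Rightarrow>\<^sub>0 'b"
  is "\<lambda>r f x. r *\<^sub>R f x"
  by (rule finite_subset) auto

instance
  by standard (transfer, auto simp: fun_eq_iff algebra_simps)+

end

lemma lookup_scaleR [simp]: "Poly_Mapping.lookup (r *\<^sub>R p) x = r *\<^sub>R Poly_Mapping.lookup p x"
  by transfer simp

lemma letters_zero [simp]: "letters 0 = []"
  by (simp add: zero_fmon_def)

lemma letters_plus [simp]: "letters (x + y) = letters x @ letters y"
  by (simp add: plus_fmon_def)

lemma FMon_plus: "FMon xs + FMon ys = FMon (xs @ ys)"
  by (simp add: plus_fmon_def)

lemma word_append: "word (xs @ ys) = word xs * word ys"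
  by (simp add: word_def mult_single FMon_plus)

lemma word_Nil [simp]: "word [] = 1"
  by (simp add: word_def single_one flip: zero_fmon_def)

lemma word_Cons: "word (x # xs) = gen x * word xs"
  unfolding gen_def by (simp flip: word_append)

lemma cnst_0 [simp]: "cnst 0 = 0"
  by (simp add: cnst_def)

lemma cnst_1 [simp]: "cnst 1 = 1"
  by (simp add: cnst_def)

lemma cnst_add: "cnst (a + b) = cnst a + cnst b"
  by (simp add: cnst_def single_add)

lemma cnst_minus: "cnst (- a) = - cnst a"
  by (simp add: cnst_def single_uminus)

lemma cnst_mult: "cnst (a * b) = cnst a * cnst b"
  by (simp add: cnst_def mult_single)

lemma cnst_word: "cnst c * word xs = Poly_Mapping.single (FMon xs) c"
  by (simp add: cnst_def word_def mult_single)

lemma free_alg_sum: "p = (\<Sum>w\<in>Poly_Mapping.keys p. cnst (Poly_Mapping.lookup p w) * word (letters w))"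
proof (rule poly_mapping_eqI)
  fix w
  have "Poly_Mapping.lookup p w = (\<Sum>v\<in>Poly_Mapping.keys p. if v = w then Poly_Mapping.lookup p v else 0)"
    by (simp add: in_keys_iff)
  then show "Poly_Mapping.lookup p w =
      Poly_Mapping.lookup (\<Sum>w\<in>Poly_Mapping.keys p. cnst (Poly_Mapping.lookup p w) * word (letters w)) w"
    by (simp add: lookup_sum cnst_word lookup_single when_def)
qed

lemma free_alg_induct [case_names word add]:
  assumes word: "\<And>c xs. R (cnst c * word xs)" and add: "\<And>p q. R p \<Longrightarrow> R q \<Longrightarrow> R (p + q)"
  shows "R p"
proof -
  have "R (\<Sum>w\<in>A. cnst (f w) * word (letters w))" if "finite A" for A f
    using that by induction (use word[of 0] in \<open>auto intro: assms\<close>)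
  then show ?thesis
    by (subst free_alg_sum) simp
qed

lemma cnst_central: "cnst c * p = p * cnst c"
  by (induction p rule: free_alg_induct)
    (simp_all add: cnst_def word_def mult_single zero_fmon_def FMon_plus mult.commute distrib_left distrib_right)

lemma cnst_left_commute: "p * (cnst c * q) = cnst c * (p * q)"
  by (metis cnst_central mult.assoc)

lemma cnst_of_real: "cnst (of_real r) * p = r *\<^sub>R p"
proof (rule poly_mapping_eqI)
  have "Poly_Mapping.lookup (cnst c * p) w = c * Poly_Mapping.lookup p w" for c w
    by (induction p rule: free_alg_induct)
      (simp_all add: cnst_def word_def mult_single lookup_add algebra_simps zero_fmon_def FMon_plus
         lookup_single when_def)
  then show "Poly_Mapping.lookup (cnst (of_real r) * p) w = Poly_Mapping.lookup (r *\<^sub>R p) w" for w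
    by (simp add: scaleR_conv_of_real)
qed

lemma scaleR_mult_left: "(r *\<^sub>R p) * q = r *\<^sub>R (p * q)" for p q :: "'a free_alg"
  by (simp flip: cnst_of_real add: mult.assoc)

lemma scaleR_mult_right: "p * (r *\<^sub>R q) = r *\<^sub>R (p * q)" for p q :: "'a free_alg"
  by (simp flip: cnst_of_real add: cnst_left_commute)

subsection \<open>Linear extensions\<close>

definition word_ext :: "(complex \<Rightarrow> 'r::ring_1) \<Rightarrow> ('a list \<Rightarrow> 'r) \<Rightarrow> 'a free_alg \<Rightarrow> 'r" where
  "word_ext s f p = (\<Sum>w\<in>Poly_Mapping.keys p. s (Poly_Mapping.lookup p w) * f (letters w))"

lemma linear_ext_eq: "linear_ext = word_ext cnst"
  by (simp add: linear_ext_def word_ext_def fun_eq_iff)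

text \<open>These axioms say that \<open>s\<close> makes the ring a complex algebra. The instances
  are \<open>cnst\<close> for free algebras, \<open>sc\<close> for the symbols modulo relations, and
  the complex numbers themselves.\<close>

locale central_hom =
  fixes s :: "complex \<Rightarrow> 'r::ring_1"
  assumes add: "s (a + b) = s a + s b"
    and mult: "s (a * b) = s a * s b"
    and one: "s 1 = 1"
    and central: "s a * x = x * s a"
begin

lemma zero: "s 0 = 0"
  using add[of 0 0] by simp

lemma minus: "s (- a) = - s a"
  using add[of a "- a"] zero by (simp add: add_eq_0_iff)

lemma left_commute: "x * (s a * y) = s a * (x * y)"
  by (metis central mult.assoc)

lemma word_ext_superset:
  assumes "finite A" "Poly_Mapping.keys p \<subseteq> A"
  shows "word_ext s f p = (\<Sum>w\<in>A. s (Poly_Mapping.lookup p w) * f (letters w))"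
  unfolding word_ext_def using assms
  by (intro sum.mono_neutral_left) (auto simp: in_keys_iff zero)

lemma word_ext_0 [simp]: "word_ext s f 0 = 0"
  by (simp add: word_ext_def)

lemma word_ext_add: "word_ext s f (p + q) = word_ext s f p + word_ext s f q"
proof -
  let ?A = "Poly_Mapping.keys p \<union> Poly_Mapping.keys q"
  have "word_ext s f r = (\<Sum>w\<in>?A. s (Poly_Mapping.lookup r w) * f (letters w))"
    if "r \<in> {p, q, p + q}" for r
    using that Poly_Mapping.keys_add[of p q] by (intro word_ext_superset) auto
  then show ?thesis
    by (simp add: lookup_add add distrib_right sum.distrib)
qed

lemma word_ext_cnst_word: "word_ext s f (cnst c * word xs) = s c * f xs"
  by (cases "c = 0") (simp_all add: cnst_word word_ext_def zero)

lemma word_ext_word [simp]: "word_ext s f (word xs) = f xs"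
  using word_ext_cnst_word[of f 1] by (simp add: one)

lemma word_ext_cnst_mult: "word_ext s f (cnst c * p) = s c * word_ext s f p"
proof (induction p rule: free_alg_induct)
  case (word d xs)
  have "cnst c * (cnst d * word xs) = cnst (c * d) * word xs"
    by (simp add: cnst_mult mult.assoc)
  then show ?case
    by (simp only: word_ext_cnst_word) (simp add: mult mult.assoc)
qed (simp add: word_ext_add distrib_left)

lemma word_ext_minus: "word_ext s f (- p) = - word_ext s f p"
  using word_ext_add[of f p "- p"] by (simp add: add_eq_0_iff)

lemma word_ext_diff: "word_ext s f (p - q) = word_ext s f p - word_ext s f q"
  using word_ext_add[of f p "- q"] by (simp add: word_ext_minus)

lemma word_ext_sum: "word_ext s f (\<Sum>i\<in>I. g i) = (\<Sum>i\<in>I. word_ext s f (g i))"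
  by (induction I rule: infinite_finite_induct) (simp_all add: word_ext_add)

abbreviation alg_ext :: "('a \<Rightarrow> 'r) \<Rightarrow> 'a free_alg \<Rightarrow> 'r" where
  "alg_ext f \<equiv> word_ext s (\<lambda>xs. prod_list (map f xs))"

lemma alg_ext_gen [simp]: "alg_ext f (gen x) = f x"
  by (simp add: gen_def)

lemma alg_ext_1 [simp]: "alg_ext f 1 = 1"
  using word_ext_word[of _ "[]"] by (metis list.simps(8) prod_list.Nil word_Nil)

lemma alg_ext_cnst [simp]: "alg_ext f (cnst c) = s c"
  using word_ext_cnst_mult[of "\<lambda>xs. prod_list (map f xs)" c 1] by simp

lemma alg_ext_mult: "alg_ext f (p * q) = alg_ext f p * alg_ext f q"
proof (induction p rule: free_alg_induct)
  case (word c xs)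
  have "alg_ext f (word xs * q) = prod_list (map f xs) * alg_ext f q"
  proof (induction q rule: free_alg_induct)
    case (word d ys)
    have "word xs * (cnst d * word ys) = cnst d * word (xs @ ys)"
      by (simp add: cnst_left_commute word_append)
    then show ?case
      by (simp only: word_ext_cnst_word) (simp add: left_commute)
  qed (simp add: word_ext_add distrib_left)
  then show ?case
    by (simp add: word_ext_cnst_mult mult.assoc)
qed (simp add: word_ext_add distrib_right)

end

interpretation cnst: central_hom cnst
  by standard (rule cnst_add cnst_mult cnst_1 cnst_central)+

abbreviation free_hom :: "('a \<Rightarrow> 'b free_alg) \<Rightarrow> 'a free_alg \<Rightarrow> 'b free_alg" where
  "free_hom \<equiv> cnst.alg_ext"

subsection \<open>Derivations\<close>

lemma derivation_eq: "derivation s d = word_ext cnst (derivation_word s d)"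
  by (simp add: derivation_def linear_ext_eq)

lemma derivation_add: "derivation s d (p + q) = derivation s d p + derivation s d q"
  by (simp add: derivation_eq cnst.word_ext_add)

lemma derivation_diff: "derivation s d (p - q) = derivation s d p - derivation s d q"
  by (simp add: derivation_eq cnst.word_ext_diff)

lemma derivation_sum: "derivation s d (\<Sum>i\<in>I. g i) = (\<Sum>i\<in>I. derivation s d (g i))"
  by (simp add: derivation_eq cnst.word_ext_sum)

lemma derivation_cnst_mult: "derivation s d (cnst c * p) = cnst c * derivation s d p"
  by (simp add: derivation_eq cnst.word_ext_cnst_mult)

lemma derivation_gen [simp]: "derivation s d (gen x) = d x"
  by (simp add: derivation_eq gen_def)

lemma derivation_0 [simp]: "derivation s d 0 = 0"
  by (simp add: derivation_eq)

lemma derivation_1 [simp]: "derivation s d 1 = 0"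
  by (simp add: derivation_eq flip: word_Nil)

text \<open>For \<open>s = jet_sign\<close> this is the parity automorphism: the sign that an odd
  derivation picks up when it passes the factor \<open>p\<close>.\<close>

abbreviation twist :: "('a \<Rightarrow> complex) \<Rightarrow> 'a free_alg \<Rightarrow> 'a free_alg" where
  "twist s \<equiv> free_hom (\<lambda>x. cnst (s x) * gen x)"

lemma derivation_mult:
  "derivation s d (p * q) = derivation s d p * q + twist s p * derivation s d q"
proof (induction p rule: free_alg_induct)
  case (word c xs)
  have "derivation s d (word xs * q) = derivation_word s d xs * q
      + prod_list (map (\<lambda>x. cnst (s x) * gen x) xs) * derivation s d q"
  proof (induction q rule: free_alg_induct)
    case (word e ys)
    have "derivation_word s d (xs @ ys) = derivation_word s d xs * word ys
        + prod_list (map (\<lambda>x. cnst (s x) * gen x) xs) * derivation_word s d ys"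
      by (induction xs) (simp_all add: word_append algebra_simps)
    moreover have "word xs * (cnst e * word ys) = cnst e * word (xs @ ys)"
      by (simp add: cnst_left_commute word_append)
    ultimately show ?case
      by (simp add: derivation_eq cnst.word_ext_cnst_mult cnst_left_commute distrib_left)
  qed (simp add: derivation_add algebra_simps)
  then show ?case
    by (simp add: derivation_cnst_mult cnst.word_ext_cnst_mult mult.assoc distrib_left)
      (simp add: derivation_eq)
qed (simp add: derivation_add cnst.word_ext_add algebra_simps)

subsection \<open>Ideals of free algebras\<close>

lemma FA_simps [simp]:
  "carrier FA = UNIV" "x \<oplus>\<^bsub>FA\<^esub> y = x + y" "x \<otimes>\<^bsub>FA\<^esub> y = x * y" "\<zero>\<^bsub>FA\<^esub> = 0" "\<one>\<^bsub>FA\<^esub> = 1"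
  by (simp_all add: ring_of_type_algebra_def)

lemma ring_FA: "ring (FA :: 'a free_alg ring)"
proof -
  have "\<exists>y. x + y = 0" for x :: "'a free_alg"
    using add.right_inverse by blast
  then show ?thesis
    unfolding ring_of_type_algebra_def using add.right_inverse
    by unfold_locales (auto simp: algebra_simps Units_def)
qed

lemma FA_minus [simp]: "\<ominus>\<^bsub>FA\<^esub> x = - x" "x \<ominus>\<^bsub>FA\<^esub> y = x - y" for x y :: "'a free_alg"
proof -
  interpret ring "FA :: 'a free_alg ring"
    by (rule ring_FA)
  have "\<ominus>\<^bsub>FA\<^esub> z = - z" for z :: "'a free_alg"
    using minus_equality[of "- z" z] by simp
  then show "\<ominus>\<^bsub>FA\<^esub> x = - x" "x \<ominus>\<^bsub>FA\<^esub> y = x - y"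
    by (simp_all add: a_minus_def)
qed

lemma ideal_FA_I:
  fixes J :: "'a free_alg set"
  assumes "0 \<in> J" "\<And>p q. p \<in> J \<Longrightarrow> q \<in> J \<Longrightarrow> p + q \<in> J"
    "\<And>p a. p \<in> J \<Longrightarrow> a * p \<in> J" "\<And>p a. p \<in> J \<Longrightarrow> p * a \<in> J"
  shows "ideal J FA"
proof (rule idealI)
  have "- p \<in> J" if "p \<in> J" for p
    using assms(3)[OF that, of "- 1"] by simp
  then have "inv\<^bsub>add_monoid FA\<^esub> p \<in> J" if "p \<in> J" for p
    using that FA_minus(1) unfolding a_inv_def by metis
  then show "subgroup J (add_monoid FA)"
    by (intro subgroup.intro) (use assms in auto)
qed (use assms in \<open>auto simp: ring_FA\<close>)

lemma Idl_FA_base: "g \<in> G \<Longrightarrow> g \<in> Idl\<^bsub>FA\<^esub> G"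
  using ring.genideal_self[OF ring_FA, of G] by auto

lemma Idl_FA_ideal: "ideal (Idl\<^bsub>FA\<^esub> G) (FA :: 'a free_alg ring)"
  by (rule ring.genideal_ideal[OF ring_FA]) simp

lemma Idl_FA_induct [consumes 1, case_names base zero add left right]:
  fixes p :: "'a free_alg"
  assumes "p \<in> Idl\<^bsub>FA\<^esub> G" "\<And>g. g \<in> G \<Longrightarrow> R g" "R 0" "\<And>p q. R p \<Longrightarrow> R q \<Longrightarrow> R (p + q)"
    "\<And>p a. R p \<Longrightarrow> R (a * p)" "\<And>p a. R p \<Longrightarrow> R (p * a)"
  shows "R p"
proof -
  have "ideal (Collect R) FA"
    by (rule ideal_FA_I) (use assms in auto)
  then have "Idl\<^bsub>FA\<^esub> G \<subseteq> Collect R"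
    by (rule ring.genideal_minimal[OF ring_FA]) (use assms in auto)
  then show ?thesis
    using assms by auto
qed

locale FA_ideal =
  fixes J :: "'a free_alg set"
  assumes ideal: "ideal J FA"
begin

lemma zero_mem [simp]: "0 \<in> J"
  using additive_subgroup.zero_closed[OF ideal.axioms(1)[OF ideal]] by simp

lemma add_mem: "p \<in> J \<Longrightarrow> q \<in> J \<Longrightarrow> p + q \<in> J"
  using additive_subgroup.a_closed[OF ideal.axioms(1)[OF ideal], of p q] by simp

lemma left_mem: "p \<in> J \<Longrightarrow> a * p \<in> J"
  using ideal.I_l_closed[OF ideal, of p a] by simp

lemma right_mem: "p \<in> J \<Longrightarrow> p * a \<in> J"
  using ideal.I_r_closed[OF ideal, of p a] by simp

lemma minus_mem: "p \<in> J \<Longrightarrow> - p \<in> J"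
  using left_mem[of p "- 1"] by simp

lemma diff_mem: "p \<in> J \<Longrightarrow> q \<in> J \<Longrightarrow> p - q \<in> J"
  using add_mem[of p "- q"] minus_mem by simp

lemma sum_mem: "(\<And>i. i \<in> A \<Longrightarrow> f i \<in> J) \<Longrightarrow> sum f A \<in> J"
  by (induction A rule: infinite_finite_induct) (auto intro: add_mem)

lemma scaleR_mem: "p \<in> J \<Longrightarrow> r *\<^sub>R p \<in> J"
  using left_mem[of p "cnst (of_real r)"] by (simp add: cnst_of_real)

lemma diff_swap: "p - q \<in> J \<Longrightarrow> q - p \<in> J"
  using minus_mem[of "p - q"] by simp

lemma diff_trans: "p - q \<in> J \<Longrightarrow> q - r \<in> J \<Longrightarrow> p - r \<in> J"
  using add_mem[of "p - q" "q - r"] by simp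

lemma mult_cong: "p - p' \<in> J \<Longrightarrow> q - q' \<in> J \<Longrightarrow> p * q - p' * q' \<in> J"
  using add_mem[OF right_mem[of "p - p'" q] left_mem[of "q - q'" p']] by (simp add: algebra_simps)

end

lemma derivation_Idl:
  assumes "\<And>g. g \<in> G \<Longrightarrow> derivation s d g \<in> Idl\<^bsub>FA\<^esub> G" "\<And>g. g \<in> G \<Longrightarrow> twist s g \<in> Idl\<^bsub>FA\<^esub> G"
    and "p \<in> Idl\<^bsub>FA\<^esub> G"
  shows "derivation s d p \<in> Idl\<^bsub>FA\<^esub> G"
proof -
  interpret FA_ideal "Idl\<^bsub>FA\<^esub> G"
    by (rule FA_ideal.intro) (rule Idl_FA_ideal)
  \<comment> \<open>By the Leibniz rule a new left factor requires \<open>p\<close> itself to be in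
    the ideal, and a new right factor requires \<open>twist s p\<close> to be; hence the threefold
    induction hypothesis.\<close>
  have "derivation s d p \<in> Idl\<^bsub>FA\<^esub> G \<and> twist s p \<in> Idl\<^bsub>FA\<^esub> G \<and> p \<in> Idl\<^bsub>FA\<^esub> G"
    using assms(3)
    by (induction rule: Idl_FA_induct)
      (auto simp: derivation_add derivation_mult cnst.word_ext_add cnst.alg_ext_mult
        intro: assms(1,2) Idl_FA_base add_mem left_mem right_mem)
  then show ?thesis
    by simp
qed

lemma (in central_hom) alg_ext_Idl:
  assumes "\<And>g. g \<in> G \<Longrightarrow> alg_ext f g = 0" "p \<in> Idl\<^bsub>FA\<^esub> G"
  shows "alg_ext f p = 0"
  using assms(2)
  by (induction rule: Idl_FA_induct) (auto simp: assms(1) word_ext_add alg_ext_mult)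

lemma (in FA_ideal) free_hom_Idl:
  assumes "\<And>g. g \<in> G \<Longrightarrow> free_hom f g \<in> J" "p \<in> Idl\<^bsub>FA\<^esub> G"
  shows "free_hom f p \<in> J"
  using assms(2)
  by (induction rule: Idl_FA_induct)
    (auto simp: assms(1) cnst.word_ext_add cnst.alg_ext_mult intro: add_mem left_mem right_mem)

section \<open>Linear algebra of traces and of multiples of the metric\<close>

section \<open>Traceless projection\<close>

text \<open>The vectors whose Euclidean inner product with a tensor is a trace of it are the same ones that
  span the multiples of \<open>\<eta>\<close>. Hence the Euclidean orthogonal projection along their span takes the
  traceless part.\<close>

definition is_orth_proj :: "'x set \<Rightarrow> 'j set \<Rightarrow> ('j \<Rightarrow> 'x \<Rightarrow> real) \<Rightarrow> ('x \<Rightarrow> 'x \<Rightarrow> real) \<Rightarrow> ('j \<Rightarrow> 'x \<Rightarrow> real) \<Rightarrow> bool" where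
  "is_orth_proj A J e Q K \<longleftrightarrow>
     (\<forall>x\<in>A. \<forall>y\<in>A. Q x y = Q y x) \<and>
     (\<forall>k\<in>J. \<forall>x\<in>A. (\<Sum>y\<in>A. Q x y * e k y) = 0) \<and>
     (\<forall>x\<in>A. \<forall>y\<in>A. Q x y = of_bool (x = y) - (\<Sum>k\<in>J. K k x * e k y))"

text \<open>Gram-Schmidt, one vector at a time. The coefficients \<open>K\<close> are carried along
  because they later exhibit a tensor minus its projection as a sum of traces or of multiples of the
  metric.\<close>

lemma orth_proj_exists:
  assumes "finite A" "finite J"
  shows "\<exists>Q K. is_orth_proj A J e Q K"
  using assms(2)
proof (induction J)
  case empty
  show ?case
    by (rule exI[of _ "\<lambda>x y. of_bool (x = y)"]) (auto simp: is_orth_proj_def)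
next
  case (insert k J)
  then obtain Q K where QK: "is_orth_proj A J e Q K"
    by blast
  then have sym: "Q x y = Q y x" and span: "Q x y = of_bool (x = y) - (\<Sum>j\<in>J. K j x * e j y)"
    if "x \<in> A" "y \<in> A" for x y
    using that unfolding is_orth_proj_def by blast+
  from QK have kill: "(\<Sum>y\<in>A. Q x y * e j y) = 0" if "x \<in> A" "j \<in> J" for x j
    using that unfolding is_orth_proj_def by blast
  \<comment> \<open>\<open>e'\<close> is the component of \<open>e k\<close> orthogonal to the
    earlier vectors, \<open>s\<close> its squared length, and \<open>c\<close> the coefficients of
    the remaining part of \<open>e k\<close> in the earlier vectors.\<close>
  define e' where "e' x = (\<Sum>y\<in>A. Q x y * e k y)" for x
  define s where "s = (\<Sum>x\<in>A. e' x * e' x)"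
  define c where "c j = (\<Sum>z\<in>A. K j z * e k z)" for j
  have e'_eq: "e' y = e k y - (\<Sum>j\<in>J. c j * e j y)" if "y \<in> A" for y
  proof -
    have "e' y = (\<Sum>z\<in>A. Q z y * e k z)"
      unfolding e'_def using that sym by (intro sum.cong) auto
    also have "\<dots> = (\<Sum>z\<in>A. of_bool (z = y) * e k z - (\<Sum>j\<in>J. K j z * e j y * e k z))"
      using that span by (intro sum.cong) (auto simp: left_diff_distrib sum_distrib_right)
    also have "\<dots> = e k y - (\<Sum>z\<in>A. \<Sum>j\<in>J. K j z * e j y * e k z)"
      using that assms(1) by (simp add: sum_subtractf)
    also have "(\<Sum>z\<in>A. \<Sum>j\<in>J. K j z * e j y * e k z) = (\<Sum>j\<in>J. c j * e j y)"
      unfolding c_def sum_distrib_right by (subst sum.swap) (simp add: mult_ac)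
    finally show ?thesis .
  qed
  have ek_eq: "e k y = e' y + (\<Sum>j\<in>J. c j * e j y)" if "y \<in> A" for y
    using e'_eq[OF that] by simp
  have orth: "(\<Sum>y\<in>A. e' y * e j y) = 0" if "j \<in> J" for j
  proof -
    have "(\<Sum>y\<in>A. e' y * e j y) = (\<Sum>z\<in>A. \<Sum>y\<in>A. Q y z * e k z * e j y)"
      unfolding e'_def sum_distrib_right by (rule sum.swap)
    also have "\<dots> = (\<Sum>z\<in>A. e k z * (\<Sum>y\<in>A. Q z y * e j y))"
      unfolding sum_distrib_left by (intro sum.cong refl) (simp add: sym mult_ac)
    finally show ?thesis
      using kill that by simp
  qed
  have "(\<Sum>y\<in>A. e' y * e k y) = (\<Sum>y\<in>A. e' y * e' y) + (\<Sum>y\<in>A. \<Sum>j\<in>J. c j * (e' y * e j y))"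
    unfolding sum.distrib[symmetric]
    by (intro sum.cong refl) (simp add: ek_eq distrib_left sum_distrib_left mult.left_commute)
  also have "(\<Sum>y\<in>A. \<Sum>j\<in>J. c j * (e' y * e j y)) = (\<Sum>j\<in>J. c j * (\<Sum>y\<in>A. e' y * e j y))"
    by (subst sum.swap) (simp add: sum_distrib_left)
  finally have orth_k: "(\<Sum>y\<in>A. e' y * e k y) = s"
    by (simp add: orth s_def)
  \<comment> \<open>If \<open>e k\<close> depends on the earlier vectors, then \<open>s = 0\<close>,
    and division by zero makes the correction vanish, as it should.\<close>
  define Q' where "Q' x y = Q x y - e' x * e' y / s" for x y
  define K' where "K' j x = (if j = k then e' x / s else K j x - e' x * c j / s)" for j x
  have e'0: "e' x = 0" if "s = 0" "x \<in> A" for x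
    using that assms(1) unfolding s_def by (subst (asm) sum_nonneg_eq_0_iff) auto
  have "(\<Sum>y\<in>A. Q' x y * e j y) = 0" if "x \<in> A" "j \<in> insert k J" for x j
  proof -
    have "(\<Sum>y\<in>A. Q' x y * e j y) = (\<Sum>y\<in>A. Q x y * e j y) - e' x / s * (\<Sum>y\<in>A. e' y * e j y)"
      by (simp add: Q'_def left_diff_distrib sum_subtractf sum_distrib_left mult.assoc)
    then show ?thesis
      using that kill orth orth_k e'0[OF _ that(1)] by (cases "s = 0") (auto simp: e'_def[symmetric])
  qed
  moreover have "Q' x y = of_bool (x = y) - (\<Sum>j\<in>insert k J. K' j x * e j y)" if "x \<in> A" "y \<in> A" for x y
  proof -
    have "(\<Sum>j\<in>J. K' j x * e j y) = (\<Sum>j\<in>J. K j x * e j y - e' x / s * (c j * e j y))"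
      using insert.hyps by (intro sum.cong) (auto simp: K'_def algebra_simps)
    also have "\<dots> = (\<Sum>j\<in>J. K j x * e j y) - e' x / s * (\<Sum>j\<in>J. c j * e j y)"
      by (simp add: sum_subtractf sum_distrib_left)
    finally have "(\<Sum>j\<in>J. K' j x * e j y) = (\<Sum>j\<in>J. K j x * e j y) - e' x / s * (e k y - e' y)"
      using e'_eq[OF that(2)] by simp
    moreover have "K' k x = e' x / s"
      by (simp add: K'_def)
    ultimately show ?thesis
      using insert.hyps span[OF that] by (simp add: Q'_def diff_divide_distrib right_diff_distrib)
  qed
  moreover have "Q' x y = Q' y x" if "x \<in> A" "y \<in> A" for x y
    using sym[OF that] by (simp add: Q'_def mult.commute)
  ultimately have "is_orth_proj A (insert k J) e Q' K'"
    unfolding is_orth_proj_def by blast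
  then show ?case
    by blast
qed

text \<open>The product of \<open>R\<close> and \<open>Q\<close> equals \<open>Q\<close>, since
  \<open>R\<close> fixes the orthogonal complement, and equals \<open>R\<close>, since
  \<open>R\<close> kills the span; symmetry reconciles the index orders. This gives the invariance
  of the projection under permutations.\<close>

lemma orth_proj_unique:
  assumes "finite A" and "is_orth_proj A J e Q K" "x \<in> A" "y \<in> A"
    and "\<And>x y. x \<in> A \<Longrightarrow> y \<in> A \<Longrightarrow> R x y = R y x"
    and "\<And>x k. x \<in> A \<Longrightarrow> k \<in> J \<Longrightarrow> (\<Sum>y\<in>A. R x y * e k y) = 0"
    and fix_R: "\<And>x f. x \<in> A \<Longrightarrow> (\<And>k. k \<in> J \<Longrightarrow> (\<Sum>y\<in>A. f y * e k y) = 0) \<Longrightarrow> (\<Sum>y\<in>A. R x y * f y) = f x"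
  shows "R x y = Q x y"
proof -
  have "(\<Sum>z\<in>A. Q y z * e k z) = 0" if "k \<in> J" for k
    using assms(2,4) that unfolding is_orth_proj_def by blast
  then have "(\<Sum>z\<in>A. R x z * Q y z) = Q y x"
    using assms(3) by (intro fix_R)
  moreover have "(\<Sum>z\<in>A. Q y z * R x z) = R x y"
  proof -
    have span: "Q y z = of_bool (y = z) - (\<Sum>k\<in>J. K k y * e k z)" if "z \<in> A" for z
      using assms(2,4) that unfolding is_orth_proj_def by blast
    have "(\<Sum>z\<in>A. Q y z * R x z) = (\<Sum>z\<in>A. of_bool (y = z) * R x z - (\<Sum>k\<in>J. K k y * (R x z * e k z)))"
      by (intro sum.cong refl) (simp add: span left_diff_distrib sum_distrib_right mult.assoc mult.commute[of "e _ _"])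
    also have "\<dots> = R x y - (\<Sum>k\<in>J. K k y * (\<Sum>z\<in>A. R x z * e k z))"
      using assms(1,4) unfolding sum_subtractf by (subst sum.swap) (simp add: sum_distrib_left)
    finally show ?thesis
      using assms(6)[OF assms(3)] by simp
  qed
  moreover have "Q x y = Q y x"
    using assms(2-4) unfolding is_orth_proj_def by blast
  ultimately show ?thesis
    by (simp add: mult.commute)
qed

definition sg :: "4 \<Rightarrow> real" where
  "sg \<mu> = (if \<mu> = 0 then 1 else - 1)"

lemma sg_square [simp]: "sg \<mu> * sg \<mu> = 1"
  by (simp add: sg_def)

definition reta :: "4 \<Rightarrow> 4 \<Rightarrow> real" where
  "reta \<mu> \<nu> = (if \<mu> = \<nu> then sg \<mu> else 0)"

lemma eta_eq_reta: "eta \<mu> \<nu> = of_real (reta \<mu> \<nu>)"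
  by (simp add: eta_def reta_def sg_def)

lemma reta_sym: "reta \<mu> \<nu> = reta \<nu> \<mu>"
  by (simp add: reta_def)

lemma reta_sum:
  fixes f :: "4 \<Rightarrow> 4 \<Rightarrow> 'w::real_vector"
  shows "(\<Sum>\<mu>\<in>UNIV. \<Sum>\<nu>\<in>UNIV. reta \<mu> \<nu> *\<^sub>R f \<mu> \<nu>) = (\<Sum>\<mu>\<in>UNIV. sg \<mu> *\<^sub>R f \<mu> \<mu>)"
proof -
  have "(\<Sum>\<nu>\<in>UNIV. reta \<mu> \<nu> *\<^sub>R f \<mu> \<nu>) = (\<Sum>\<nu>\<in>UNIV. if \<mu> = \<nu> then sg \<mu> *\<^sub>R f \<mu> \<nu> else 0)" for \<mu>
    by (intro sum.cong) (auto simp: reta_def)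
  then show ?thesis
    by simp
qed

definition idx :: "nat \<Rightarrow> 4 list set" where
  "idx n = {xs. length xs = n}"

lemma finite_idx [simp]: "finite (idx n)"
  using finite_lists_length_eq[of "UNIV :: 4 set" n] by (simp add: idx_def)

text \<open>Overwriting two positions with the arbitrary index \<open>0\<close> remembers all other
  indices without changing length or positions.\<close>

abbreviation erase :: "nat \<Rightarrow> nat \<Rightarrow> 4 list \<Rightarrow> 4 list" where
  "erase i j xs \<equiv> xs[i := 0, j := 0]"

lemma finite_idx' [simp]: "finite {xs :: 4 list. length xs = n}"
  using finite_idx by (simp add: idx_def)

definition trace_idx :: "nat \<Rightarrow> (nat \<times> nat \<times> 4 list) set" where
  "trace_idx n = {(i, j, z). i < n \<and> j < n \<and> i \<noteq> j \<and> z \<in> idx n}"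

lemma finite_trace_idx [simp]: "finite (trace_idx n)"
  by (rule finite_subset[of _ "{..<n} \<times> {..<n} \<times> idx n"]) (auto simp: trace_idx_def)

fun trace_vec :: "nat \<times> nat \<times> 4 list \<Rightarrow> 4 list \<Rightarrow> real" where
  "trace_vec (i, j, z) x = reta (x ! i) (x ! j) * of_bool (erase i j x = z)"

definition prj :: "nat \<Rightarrow> 4 list \<Rightarrow> 4 list \<Rightarrow> real" where
  "prj n = (SOME Q. \<exists>K. is_orth_proj (idx n) (trace_idx n) trace_vec Q K)"

lemma prj: "\<exists>K. is_orth_proj (idx n) (trace_idx n) trace_vec (prj n) K"
  unfolding prj_def by (rule someI_ex[OF orth_proj_exists[OF finite_idx finite_trace_idx]])

lemma prj_sym: "x \<in> idx n \<Longrightarrow> y \<in> idx n \<Longrightarrow> prj n x y = prj n y x"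
  using prj[of n] by (auto simp: is_orth_proj_def)

lemma prj_kill: "x \<in> idx n \<Longrightarrow> k \<in> trace_idx n \<Longrightarrow> (\<Sum>y\<in>idx n. prj n x y * trace_vec k y) = 0"
  using prj[of n] unfolding is_orth_proj_def by blast

definition trl :: "(4 list \<Rightarrow> 'w::real_vector) \<Rightarrow> 4 list \<Rightarrow> 'w" where
  "trl T xs = (\<Sum>y\<in>idx (length xs). prj (length xs) xs y *\<^sub>R T y)"

definition trc :: "nat \<Rightarrow> nat \<Rightarrow> (4 list \<Rightarrow> 'w::real_vector) \<Rightarrow> 4 list \<Rightarrow> 'w" where
  "trc i j T xs = (\<Sum>\<mu>\<in>UNIV. sg \<mu> *\<^sub>R T (xs[i := \<mu>, j := \<mu>]))"

lemma trl_cong: "(\<And>y. length y = length xs \<Longrightarrow> T y = T' y) \<Longrightarrow> trl T xs = trl T' xs"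
  by (simp add: trl_def idx_def)

lemma trl_add: "trl (\<lambda>x. S x + T x) xs = trl S xs + trl T xs"
  by (simp add: trl_def scaleR_add_right sum.distrib)

lemma trl_diff: "trl (\<lambda>x. S x - T x) xs = trl S xs - trl T xs"
  by (simp add: trl_def scaleR_diff_right sum_subtractf)

lemma trl_scaleR: "trl (\<lambda>x. r *\<^sub>R T x) xs = r *\<^sub>R trl T xs"
  by (simp add: trl_def scaleR_sum_right mult.commute)

lemma trl_zero: "trl (\<lambda>x. 0) xs = 0"
  by (simp add: trl_def)

lemma trl_sum: "trl (\<lambda>x. \<Sum>i\<in>I. T i x) xs = (\<Sum>i\<in>I. trl (T i) xs)"
  unfolding trl_def scaleR_sum_right by (rule sum.swap)

lemma trace_vec_sum:
  fixes T :: "4 list \<Rightarrow> 'w::real_vector"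
  assumes "i < n" "j < n" "i \<noteq> j" "z \<in> idx n"
  shows "(\<Sum>y\<in>idx n. trace_vec (i, j, erase i j z) y *\<^sub>R T y) = trc i j T z"
proof -
  let ?h = "\<lambda>(\<mu>, \<nu>). z[i := \<mu>, j := \<nu>]"
  have z: "length z = n"
    using assms by (simp add: idx_def)
  have *: "y = z[i := y ! i, j := y ! j]" if "length y = n" "erase i j y = erase i j z" for y
  proof (rule nth_equalityI)
    show "y ! k = z[i := y ! i, j := y ! j] ! k" if "k < length y" for k
      using arg_cong[OF \<open>erase i j y = erase i j z\<close>, of "\<lambda>l. l ! k"] assms z that
      by (auto simp: nth_list_update \<open>length y = n\<close> split: if_splits)
  qed (use that z in simp)
  have "(\<Sum>y\<in>idx n. trace_vec (i, j, erase i j z) y *\<^sub>R T y)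
      = (\<Sum>y\<in>?h ` UNIV. reta (y ! i) (y ! j) *\<^sub>R T y)"
  proof (rule sum.mono_neutral_cong_right)
    show "\<forall>y\<in>idx n - range ?h. trace_vec (i, j, erase i j z) y *\<^sub>R T y = 0"
    proof
      fix y assume y: "y \<in> idx n - range ?h"
      have "erase i j y \<noteq> erase i j z"
      proof
        assume "erase i j y = erase i j z"
        then have "y = ?h (y ! i, y ! j)"
          using * y by (simp add: idx_def)
        then show False
          using y by blast
      qed
      then show "trace_vec (i, j, erase i j z) y *\<^sub>R T y = 0"
        by simp
    qed
  qed (use assms z in \<open>auto simp: idx_def list_update_swap[of i j]\<close>)
  also have "\<dots> = (\<Sum>(\<mu>, \<nu>)\<in>UNIV. reta \<mu> \<nu> *\<^sub>R T (z[i := \<mu>, j := \<nu>]))"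
  proof (subst sum.reindex)
    show "inj_on ?h UNIV"
    proof (rule inj_onI, clarify)
      fix a b c d
      assume "z[i := a, j := b] = z[i := c, j := d]"
      then have "z[i := a, j := b] ! k = z[i := c, j := d] ! k" for k
        by simp
      from this[of i] this[of j] show "a = c \<and> b = d"
        using assms z by (simp add: nth_list_update)
    qed
  qed (use assms z in \<open>auto intro!: sum.cong\<close>)
  also have "\<dots> = (\<Sum>\<mu>\<in>UNIV. \<Sum>\<nu>\<in>UNIV. reta \<mu> \<nu> *\<^sub>R T (z[i := \<mu>, j := \<nu>]))"
    by (simp add: sum.cartesian_product)
  finally show ?thesis
    by (simp add: reta_sum trc_def)
qed

lemma trace_vec_sum_subspace:
  fixes T :: "4 list \<Rightarrow> 'w::real_vector"
  assumes "k \<in> trace_idx n" "0 \<in> W"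
    and "\<And>i j z. i < n \<Longrightarrow> j < n \<Longrightarrow> i \<noteq> j \<Longrightarrow> length z = n \<Longrightarrow> trc i j T z \<in> W"
  shows "(\<Sum>y\<in>idx n. trace_vec k y *\<^sub>R T y) \<in> W"
proof -
  obtain i j z where k: "k = (i, j, z)" "i < n" "j < n" "i \<noteq> j" "z \<in> idx n"
    using assms(1) by (auto simp: trace_idx_def)
  show ?thesis
  proof (cases "erase i j z = z")
    case True
    then have "(\<Sum>y\<in>idx n. trace_vec k y *\<^sub>R T y) = trc i j T z"
      using trace_vec_sum[of i n j z T] k by simp
    then show ?thesis
      using assms(3) k by (simp add: idx_def)
  next
    case False
    \<comment> \<open>A label \<open>z\<close> that is not of erased form is never matched, so its
      vector is zero.\<close>
    have "trace_vec k y = 0" if "y \<in> idx n" for y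
    proof -
      have "erase i j (erase i j y) = erase i j y"
        using k that by (simp add: list_update_swap[of i j] idx_def)
      then show ?thesis
        using False k by auto
    qed
    then show ?thesis
      using assms(2) by simp
  qed
qed

text \<open>The first expansion is in traces of \<open>T\<close>, the second in multiples of the
  metric; the symmetry of \<open>prj\<close> turns one into the other. \<open>K\<close> is chosen
  before \<open>T\<close>, so the expansions are linear in \<open>T\<close>.\<close>

lemma trl_eq_diff:
  "\<exists>K. \<forall>T::4 list \<Rightarrow> 'w::real_vector. \<forall>xs\<in>idx n. T xs - trl T xs
      = (\<Sum>k\<in>trace_idx n. K k xs *\<^sub>R (\<Sum>y\<in>idx n. trace_vec k y *\<^sub>R T y))
    \<and> T xs - trl T xs = (\<Sum>k\<in>trace_idx n. trace_vec k xs *\<^sub>R (\<Sum>y\<in>idx n. K k y *\<^sub>R T y))"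
proof -
  obtain K where K: "is_orth_proj (idx n) (trace_idx n) trace_vec (prj n) K"
    using prj by blast
  have eq: "T xs - trl T xs = (\<Sum>k\<in>trace_idx n. \<Sum>y\<in>idx n. L k xs y *\<^sub>R T y)"
    if "xs \<in> idx n" and L: "\<And>y. y \<in> idx n \<Longrightarrow> prj n xs y = of_bool (xs = y) - (\<Sum>k\<in>trace_idx n. L k xs y)"
    for T :: "4 list \<Rightarrow> 'w" and xs L
  proof -
    have "trl T xs = (\<Sum>y\<in>idx n. (of_bool (xs = y) - (\<Sum>k\<in>trace_idx n. L k xs y)) *\<^sub>R T y)"
      using that by (simp add: trl_def idx_def)
    also have "\<dots> = (\<Sum>y\<in>idx n. if xs = y then T y else 0) - (\<Sum>y\<in>idx n. \<Sum>k\<in>trace_idx n. L k xs y *\<^sub>R T y)"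
      unfolding sum_subtractf[symmetric] by (intro sum.cong) (auto simp: scaleR_diff_left scaleR_sum_left)
    finally show ?thesis
      using that by (subst sum.swap) simp
  qed
  show ?thesis
  proof (intro exI allI ballI conjI)
    fix T :: "4 list \<Rightarrow> 'w" and xs assume xs: "xs \<in> idx n"
    show "T xs - trl T xs = (\<Sum>k\<in>trace_idx n. K k xs *\<^sub>R (\<Sum>y\<in>idx n. trace_vec k y *\<^sub>R T y))"
    proof -
      have "prj n xs y = of_bool (xs = y) - (\<Sum>k\<in>trace_idx n. K k xs * trace_vec k y)" if "y \<in> idx n" for y
        using that xs K unfolding is_orth_proj_def by blast
      from eq[OF xs, of "\<lambda>k xs y. K k xs * trace_vec k y" T, OF this] show ?thesis
        by (simp add: scaleR_sum_right)
    qed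
    show "T xs - trl T xs = (\<Sum>k\<in>trace_idx n. trace_vec k xs *\<^sub>R (\<Sum>y\<in>idx n. K k y *\<^sub>R T y))"
    proof -
      have "prj n xs y = of_bool (xs = y) - (\<Sum>k\<in>trace_idx n. K k y * trace_vec k xs)" if "y \<in> idx n" for y
      proof -
        have "prj n y xs = of_bool (y = xs) - (\<Sum>k\<in>trace_idx n. K k y * trace_vec k xs)"
          using that xs K unfolding is_orth_proj_def by blast
        then show ?thesis
          by (simp only: prj_sym[OF xs that] eq_commute[of xs])
      qed
      from eq[OF xs, of "\<lambda>k xs y. K k y * trace_vec k xs" T, OF this] show ?thesis
        by (simp add: scaleR_sum_right mult.commute)
    qed
  qed
qed

text \<open>The difference is a linear combination of traces. It is applied with the zero subspace,
  the mass shell ideal, and the polynomials that are symbol evaluations up to exact terms.\<close>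

lemma trl_diff_mem:
  fixes T :: "4 list \<Rightarrow> 'w::real_vector"
  assumes "subspace W"
    and "\<And>i j z. i < length xs \<Longrightarrow> j < length xs \<Longrightarrow> i \<noteq> j \<Longrightarrow> length z = length xs \<Longrightarrow> trc i j T z \<in> W"
  shows "T xs - trl T xs \<in> W"
proof -
  let ?n = "length xs"
  obtain K where "T xs - trl T xs
      = (\<Sum>k\<in>trace_idx ?n. K k xs *\<^sub>R (\<Sum>y\<in>idx ?n. trace_vec k y *\<^sub>R T y))"
    using trl_eq_diff[where 'w = 'w and n = ?n] by (auto simp: idx_def)
  also have "\<dots> \<in> W"
    using assms by (intro subspace_sum subspace_scale trace_vec_sum_subspace) (auto intro: subspace_0)
  finally show ?thesis .
qed

lemma trl_traceless:
  assumes "\<And>i j z. i < length xs \<Longrightarrow> j < length xs \<Longrightarrow> i \<noteq> j \<Longrightarrow> length z = length xs \<Longrightarrow> trc i j T z = 0"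
  shows "trl T xs = T xs"
  using trl_diff_mem[of "{0}" xs T] assms by (simp add: subspace_def)

lemma trl_diff_eta:
  fixes T :: "4 list \<Rightarrow> 'w::real_vector"
  obtains S where "\<And>xs. length xs = n \<Longrightarrow> T xs - trl T xs
    = (\<Sum>i<n. \<Sum>j\<in>{..<n} - {i}. reta (xs ! i) (xs ! j) *\<^sub>R S i j (erase i j xs))"
proof -
  from trl_eq_diff[where 'w = 'w and n = n] obtain K where
    "\<forall>T::4 list \<Rightarrow> 'w. \<forall>xs\<in>idx n. T xs - trl T xs
      = (\<Sum>k\<in>trace_idx n. K k xs *\<^sub>R (\<Sum>y\<in>idx n. trace_vec k y *\<^sub>R T y))
      \<and> T xs - trl T xs = (\<Sum>k\<in>trace_idx n. trace_vec k xs *\<^sub>R (\<Sum>y\<in>idx n. K k y *\<^sub>R T y))"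
    by (rule exE)
  then have K: "T xs - trl T xs = (\<Sum>k\<in>trace_idx n. trace_vec k xs *\<^sub>R (\<Sum>y\<in>idx n. K k y *\<^sub>R T y))"
    if "xs \<in> idx n" for xs
    using that by blast
  have ti: "trace_idx n = (SIGMA i:{..<n}. SIGMA j:{..<n} - {i}. idx n)"
    by (auto simp: trace_idx_def)
  show ?thesis
  proof (rule that)
    fix xs :: "4 list" assume xs: "length xs = n"
    have "T xs - trl T xs = (\<Sum>i<n. \<Sum>j\<in>{..<n} - {i}. \<Sum>z\<in>idx n.
        trace_vec (i, j, z) xs *\<^sub>R (\<Sum>y\<in>idx n. K (i, j, z) y *\<^sub>R T y))"
    proof -
      have sum_ti: "(\<Sum>k\<in>trace_idx n. g k) = (\<Sum>i<n. \<Sum>j\<in>{..<n} - {i}. \<Sum>z\<in>idx n. g (i, j, z))"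
        for g :: "nat \<times> nat \<times> 4 list \<Rightarrow> 'w"
      proof -
        have "(\<Sum>k\<in>trace_idx n. g k) = (\<Sum>i<n. \<Sum>p\<in>(SIGMA j:{..<n} - {i}. idx n). g (i, p))"
          unfolding ti by (subst sum.Sigma) (auto simp: case_prod_unfold)
        also have "\<dots> = (\<Sum>i<n. \<Sum>j\<in>{..<n} - {i}. \<Sum>z\<in>idx n. g (i, j, z))"
          by (intro sum.cong refl, subst sum.Sigma) (auto simp: case_prod_unfold)
        finally show ?thesis .
      qed
      have "xs \<in> idx n"
        using xs by (simp add: idx_def)
      then show ?thesis
        by (simp only: K sum_ti)
    qed
    also have "\<dots> = (\<Sum>i<n. \<Sum>j\<in>{..<n} - {i}. reta (xs ! i) (xs ! j) *\<^sub>R (\<Sum>y\<in>idx n. K (i, j, erase i j xs) y *\<^sub>R T y))"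
    proof (intro sum.cong refl)
      fix i j
      have "(\<Sum>z\<in>idx n. trace_vec (i, j, z) xs *\<^sub>R (\<Sum>y\<in>idx n. K (i, j, z) y *\<^sub>R T y))
          = (\<Sum>z\<in>idx n. if erase i j xs = z then reta (xs ! i) (xs ! j) *\<^sub>R (\<Sum>y\<in>idx n. K (i, j, z) y *\<^sub>R T y) else 0)"
        by (intro sum.cong) auto
      also have "\<dots> = reta (xs ! i) (xs ! j) *\<^sub>R (\<Sum>y\<in>idx n. K (i, j, erase i j xs) y *\<^sub>R T y)"
        using xs by (subst sum.delta'[OF finite_idx]) (auto simp: idx_def)
      finally show "(\<Sum>z\<in>idx n. trace_vec (i, j, z) xs *\<^sub>R (\<Sum>y\<in>idx n. K (i, j, z) y *\<^sub>R T y))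
          = reta (xs ! i) (xs ! j) *\<^sub>R (\<Sum>y\<in>idx n. K (i, j, erase i j xs) y *\<^sub>R T y)" .
    qed
    finally show "T xs - trl T xs = (\<Sum>i<n. \<Sum>j\<in>{..<n} - {i}. reta (xs ! i) (xs ! j) *\<^sub>R
        (\<lambda>i j z. \<Sum>y\<in>idx n. K (i, j, z) y *\<^sub>R T y) i j (erase i j xs))" .
  qed
qed

lemma trc_trl:
  assumes "i < length z" "j < length z" "i \<noteq> j"
  shows "trc i j (trl T) z = 0"
proof -
  let ?n = "length z"
  have k: "(i, j, erase i j z) \<in> trace_idx ?n"
    using assms by (simp add: trace_idx_def idx_def)
  have "trc i j (trl T) z = (\<Sum>y\<in>idx ?n. trace_vec (i, j, erase i j z) y *\<^sub>R trl T y)"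
    using assms by (subst trace_vec_sum) (auto simp: idx_def)
  also have "\<dots> = (\<Sum>y\<in>idx ?n. \<Sum>x\<in>idx ?n. (prj ?n x y * trace_vec (i, j, erase i j z) y) *\<^sub>R T x)"
    unfolding trl_def scaleR_sum_right
    by (intro sum.cong) (auto simp: idx_def prj_sym mult.commute simp del: trace_vec.simps)
  also have "\<dots> = (\<Sum>x\<in>idx ?n. (\<Sum>y\<in>idx ?n. prj ?n x y * trace_vec (i, j, erase i j z) y) *\<^sub>R T x)"
    unfolding scaleR_sum_left by (rule sum.swap)
  also have "\<dots> = 0"
    by (intro sum.neutral ballI) (simp only: prj_kill[OF _ k] scaleR_zero_left)
  finally show ?thesis .
qed

text \<open>The hypothesis on \<open>S\<close> expresses that it ignores the indices in positions
  \<open>i\<close> and \<open>j\<close>. The tensor is then a combination of trace vectors, which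
  the projection annihilates.\<close>

lemma trl_kill:
  fixes S :: "4 list \<Rightarrow> 'w::real_vector"
  assumes "i < length xs" "j < length xs" "i \<noteq> j"
    and S: "\<And>y. length y = length xs \<Longrightarrow> S (erase i j y) = S y"
  shows "trl (\<lambda>y. reta (y ! i) (y ! j) *\<^sub>R S y) xs = 0"
proof -
  let ?n = "length xs"
  have eq: "reta (y ! i) (y ! j) *\<^sub>R S y = (\<Sum>z\<in>idx ?n. trace_vec (i, j, z) y *\<^sub>R S z)" if "y \<in> idx ?n" for y
  proof -
    have "(\<Sum>z\<in>idx ?n. trace_vec (i, j, z) y *\<^sub>R S z)
        = (\<Sum>z\<in>idx ?n. if erase i j y = z then reta (y ! i) (y ! j) *\<^sub>R S z else 0)"
      by (intro sum.cong) auto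
    also have "\<dots> = reta (y ! i) (y ! j) *\<^sub>R S (erase i j y)"
      using that by (subst sum.delta'[OF finite_idx]) (auto simp: idx_def)
    finally show ?thesis
      using S that by (simp add: idx_def)
  qed
  have "trl (\<lambda>y. reta (y ! i) (y ! j) *\<^sub>R S y) xs
      = (\<Sum>y\<in>idx ?n. \<Sum>z\<in>idx ?n. (prj ?n xs y * trace_vec (i, j, z) y) *\<^sub>R S z)"
    unfolding trl_def by (intro sum.cong refl) (simp add: eq scaleR_sum_right del: trace_vec.simps)
  also have "\<dots> = (\<Sum>z\<in>idx ?n. (\<Sum>y\<in>idx ?n. prj ?n xs y * trace_vec (i, j, z) y) *\<^sub>R S z)"
    unfolding scaleR_sum_left by (rule sum.swap)
  also have "\<dots> = 0"
  proof (intro sum.neutral ballI)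
    fix z assume "z \<in> idx ?n"
    then have "(i, j, z) \<in> trace_idx ?n"
      using assms by (simp add: trace_idx_def)
    then show "(\<Sum>y\<in>idx ?n. prj ?n xs y * trace_vec (i, j, z) y) *\<^sub>R S z = 0"
      using prj_kill[of xs ?n "(i, j, z)"] by (simp add: idx_def del: trace_vec.simps)
  qed
  finally show ?thesis .
qed

subsection \<open>Equivariance under permutations of the indices\<close>

lemma permute_list_inverse:
  assumes "\<sigma> permutes {..<length xs}"
  shows "permute_list (inv_into UNIV \<sigma>) (permute_list \<sigma> xs) = xs"
    and "permute_list \<sigma> (permute_list (inv_into UNIV \<sigma>) xs) = xs"
  using permute_list_compose[OF permutes_inv[OF assms], of \<sigma>] permute_list_compose[OF assms, of "inv_into UNIV \<sigma>"]
    permutes_inv_o[OF assms] by simp_all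

lemma permute_idx_sum:
  assumes "\<sigma> permutes {..<n}"
  shows "(\<Sum>y\<in>idx n. g (permute_list \<sigma> y)) = (\<Sum>y\<in>idx n. g y)"
  by (rule sum.reindex_bij_witness[of _ "permute_list (inv_into UNIV \<sigma>)" "permute_list \<sigma>"])
    (use assms in \<open>auto simp: idx_def permute_list_inverse\<close>)

lemma trace_vec_permute:
  assumes \<sigma>: "\<sigma> permutes {..<n}" and "(i, j, z) \<in> trace_idx n" "y \<in> idx n"
  shows "trace_vec (i, j, z) (permute_list \<sigma> y) = trace_vec (\<sigma> i, \<sigma> j, permute_list (inv_into UNIV \<sigma>) z) y"
    and "(\<sigma> i, \<sigma> j, permute_list (inv_into UNIV \<sigma>) z) \<in> trace_idx n"
proof -
  have ij: "i < n" "j < n" "i \<noteq> j" "length z = n" "length y = n"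
    using assms by (auto simp: trace_idx_def idx_def)
  have \<sigma>ij: "\<sigma> i < n" "\<sigma> j < n"
    using permutes_in_image[OF \<sigma>] ij by auto
  have inj: "\<sigma> k = \<sigma> l \<longleftrightarrow> k = l" for k l
    using permutes_inj[OF \<sigma>] by (auto dest: injD)
  have "erase i j (permute_list \<sigma> y) = permute_list \<sigma> (erase (\<sigma> i) (\<sigma> j) y)"
  proof (rule nth_equalityI)
    fix k assume k: "k < length (erase i j (permute_list \<sigma> y))"
    then have "\<sigma> k < n"
      using permutes_in_image[OF \<sigma>, of k] ij by auto
    then show "erase i j (permute_list \<sigma> y) ! k = permute_list \<sigma> (erase (\<sigma> i) (\<sigma> j) y) ! k"
      using k ij \<sigma> \<sigma>ij by (auto simp: nth_list_update permute_list_nth inj)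
  qed simp
  moreover have "permute_list \<sigma> w = z \<longleftrightarrow> w = permute_list (inv_into UNIV \<sigma>) z" if "length w = n" for w
    using permute_list_inverse[of \<sigma> w] permute_list_inverse[of \<sigma> z] that \<sigma> ij by auto
  ultimately show "trace_vec (i, j, z) (permute_list \<sigma> y) = trace_vec (\<sigma> i, \<sigma> j, permute_list (inv_into UNIV \<sigma>) z) y"
    using ij \<sigma> by (simp add: permute_list_nth)
  show "(\<sigma> i, \<sigma> j, permute_list (inv_into UNIV \<sigma>) z) \<in> trace_idx n"
    using ij \<sigma>ij inj by (simp add: trace_idx_def idx_def)
qed

text \<open>Permuting indices maps trace vectors to trace vectors, so the conjugated projection has
  the properties that characterize \<open>prj\<close>.\<close>

lemma prj_permute:
  assumes \<sigma>: "\<sigma> permutes {..<n}" and "x \<in> idx n" "y \<in> idx n"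
  shows "prj n (permute_list \<sigma> x) (permute_list \<sigma> y) = prj n x y"
proof -
  define \<tau> where "\<tau> = inv_into UNIV \<sigma>"
  have \<tau>: "\<tau> permutes {..<n}"
    unfolding \<tau>_def using \<sigma> by (rule permutes_inv)
  have [simp]: "permute_list \<tau> (permute_list \<sigma> y) = y" "permute_list \<sigma> (permute_list \<tau> y) = y"
    if "y \<in> idx n" for y
    using that \<sigma> by (auto simp: \<tau>_def idx_def permute_list_inverse)
  have [simp]: "permute_list \<sigma> y \<in> idx n" "permute_list \<tau> y \<in> idx n" if "y \<in> idx n" for y
    using that by (simp_all add: idx_def)
  obtain K where K: "is_orth_proj (idx n) (trace_idx n) trace_vec (prj n) K"
    using prj by blast
  have fix_prj: "(\<Sum>y\<in>idx n. prj n x y * f y) = f x"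
    if "x \<in> idx n" "\<And>k. k \<in> trace_idx n \<Longrightarrow> (\<Sum>y\<in>idx n. f y * trace_vec k y) = 0" for x :: "4 list" and f
  proof -
    have "trl f x = f x"
    proof (rule trl_traceless)
      fix i j and z :: "4 list" assume ij: "i < length x" "j < length x" "i \<noteq> j" "length z = length x"
      then have "(i, j, erase i j z) \<in> trace_idx n"
        using that by (simp add: trace_idx_def idx_def)
      with that show "trc i j f z = 0"
        using trace_vec_sum[of i n j z f] ij
        by (simp add: idx_def mult.commute del: trace_vec.simps)
    qed
    then show ?thesis
      using that by (simp add: trl_def idx_def)
  qed
  show ?thesis
  proof (rule orth_proj_unique[OF finite_idx K assms(2,3)])
    show "(\<Sum>y\<in>idx n. prj n (permute_list \<sigma> x) (permute_list \<sigma> y) * trace_vec k y) = 0"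
      if "x \<in> idx n" "k \<in> trace_idx n" for x k
    proof -
      obtain i j z where k: "k = (i, j, z)"
        by (cases k)
      define k' where "k' = (\<tau> i, \<tau> j, permute_list (inv_into UNIV \<tau>) z)"
      have k': "trace_vec k (permute_list \<tau> y) = trace_vec k' y" if "y \<in> idx n" for y
        unfolding k k'_def by (rule trace_vec_permute) (use that \<tau> \<open>k \<in> trace_idx n\<close> k in auto)
      have "k' \<in> trace_idx n"
        unfolding k'_def by (rule trace_vec_permute(2)[OF \<tau>, of _ _ _ x]) (use that k in auto)
      then have "(\<Sum>y\<in>idx n. prj n (permute_list \<sigma> x) y * trace_vec k' y) = 0"
        using that prj_kill by simp
      also have "(\<Sum>y\<in>idx n. prj n (permute_list \<sigma> x) y * trace_vec k' y)
        = (\<Sum>y\<in>idx n. prj n (permute_list \<sigma> x) (permute_list \<sigma> y) * trace_vec k' (permute_list \<sigma> y))"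
        using permute_idx_sum[OF \<sigma>, of "\<lambda>y. prj n (permute_list \<sigma> x) y * trace_vec k' y"] by simp
      finally show ?thesis
        by (simp flip: k')
    qed
    show "(\<Sum>y\<in>idx n. prj n (permute_list \<sigma> x) (permute_list \<sigma> y) * f y) = f x"
      if "x \<in> idx n" "\<And>k. k \<in> trace_idx n \<Longrightarrow> (\<Sum>y\<in>idx n. f y * trace_vec k y) = 0" for x f
    proof -
      have "(\<Sum>y\<in>idx n. prj n (permute_list \<sigma> x) y * f (permute_list \<tau> y)) = f (permute_list \<tau> (permute_list \<sigma> x))"
      proof (rule fix_prj)
        fix k assume kt: "k \<in> trace_idx n"
        obtain i j z where k: "k = (i, j, z)"
          by (cases k)
        define k' where "k' = (\<sigma> i, \<sigma> j, permute_list (inv_into UNIV \<sigma>) z)"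
        have k': "trace_vec k (permute_list \<sigma> y) = trace_vec k' y" if "y \<in> idx n" for y
          unfolding k k'_def by (rule trace_vec_permute) (use that \<sigma> kt k in auto)
        have "k' \<in> trace_idx n"
          unfolding k'_def by (rule trace_vec_permute(2)[OF \<sigma>, of _ _ _ x]) (use that kt k in auto)
        then have "(\<Sum>y\<in>idx n. f y * trace_vec k' y) = 0"
          using that by simp
        then show "(\<Sum>y\<in>idx n. f (permute_list \<tau> y) * trace_vec k y) = 0"
          using permute_idx_sum[OF \<sigma>, of "\<lambda>y. f (permute_list \<tau> y) * trace_vec k y"]
          by (simp add: k')
      qed (use that in simp)
      then show ?thesis
        using that permute_idx_sum[OF \<sigma>, of "\<lambda>y. prj n (permute_list \<sigma> x) y * f (permute_list \<tau> y)"] by simp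
    qed
  qed (simp add: prj_sym)
qed

lemma trl_permute:
  assumes "\<sigma> permutes {..<length xs}"
  shows "trl (\<lambda>y. T (permute_list \<sigma> y)) xs = trl T (permute_list \<sigma> xs)"
proof -
  let ?n = "length xs"
  have "trl T (permute_list \<sigma> xs)
      = (\<Sum>y\<in>idx ?n. prj ?n (permute_list \<sigma> xs) (permute_list \<sigma> y) *\<^sub>R T (permute_list \<sigma> y))"
    using permute_idx_sum[OF assms, of "\<lambda>y. prj ?n (permute_list \<sigma> xs) y *\<^sub>R T y"]
    by (simp add: trl_def)
  also have "\<dots> = trl (\<lambda>y. T (permute_list \<sigma> y)) xs"
    unfolding trl_def by (intro sum.cong refl) (simp add: prj_permute[OF assms] idx_def)
  finally show ?thesis
    by simp
qed

section \<open>Taylor series of harmonic functions and of Klein-Gordon solutions\<close>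

section \<open>Operators on jets of linear fields\<close>

text \<open>A field is given by the values \<open>g \<alpha>\<close> of its derivatives at a point, that is, by its Taylor
  series. Then \<open>sh \<mu>\<close> is the partial derivative, \<open>ml \<mu>\<close> the multiplication by the \<open>\<mu>\<close>-th coordinate,
  \<open>bx\<close> the wave operator, \<open>r2\<close> the multiplication by the Minkowski square of the position and \<open>dv\<close>
  the divergence; the commutation rules below are those of the Weyl algebra.\<close>

definition sh :: "4 \<Rightarrow> (4 multiset \<Rightarrow> 'w) \<Rightarrow> 4 multiset \<Rightarrow> 'w" where
  "sh \<mu> g \<alpha> = g (add_mset \<mu> \<alpha>)"

definition ml :: "4 \<Rightarrow> (4 multiset \<Rightarrow> 'w::real_vector) \<Rightarrow> 4 multiset \<Rightarrow> 'w" where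
  "ml \<mu> g \<alpha> = real (count \<alpha> \<mu>) *\<^sub>R g (\<alpha> - {#\<mu>#})"

definition bx :: "(4 multiset \<Rightarrow> 'w::real_vector) \<Rightarrow> 4 multiset \<Rightarrow> 'w" where
  "bx g \<alpha> = (\<Sum>\<mu>\<in>UNIV. sg \<mu> *\<^sub>R g (add_mset \<mu> (add_mset \<mu> \<alpha>)))"

definition r2 :: "(4 multiset \<Rightarrow> 'w::real_vector) \<Rightarrow> 4 multiset \<Rightarrow> 'w" where
  "r2 g \<alpha> = (\<Sum>\<mu>\<in>UNIV. sg \<mu> *\<^sub>R ml \<mu> (ml \<mu> g) \<alpha>)"

definition dv :: "(4 \<Rightarrow> 4 multiset \<Rightarrow> 'w::real_vector) \<Rightarrow> 4 multiset \<Rightarrow> 'w" where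
  "dv A \<alpha> = (\<Sum>\<mu>\<in>UNIV. sg \<mu> *\<^sub>R A \<mu> (add_mset \<mu> \<alpha>))"

lemma ml_add: "ml \<mu> (\<lambda>\<beta>. g \<beta> + h \<beta>) \<alpha> = ml \<mu> g \<alpha> + ml \<mu> h \<alpha>"
  by (simp add: ml_def scaleR_add_right)

lemma ml_scaleR: "ml \<mu> (\<lambda>\<beta>. r *\<^sub>R g \<beta>) \<alpha> = r *\<^sub>R ml \<mu> g \<alpha>"
  by (simp add: ml_def)

lemma ml_sum: "ml \<mu> (\<lambda>\<beta>. \<Sum>i\<in>I. g i \<beta>) \<alpha> = (\<Sum>i\<in>I. ml \<mu> (g i) \<alpha>)"
  by (simp add: ml_def scaleR_sum_right)

lemma ml_zero [simp]: "ml \<mu> (\<lambda>\<beta>. 0) \<alpha> = 0"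
  by (simp add: ml_def)

lemma r2_add: "r2 (\<lambda>\<beta>. g \<beta> + h \<beta>) \<alpha> = r2 g \<alpha> + r2 h \<alpha>"
  by (simp add: r2_def ext[OF ml_add] scaleR_add_right sum.distrib)

lemma r2_scaleR: "r2 (\<lambda>\<beta>. r *\<^sub>R g \<beta>) \<alpha> = r *\<^sub>R r2 g \<alpha>"
  by (simp add: r2_def ext[OF ml_scaleR] scaleR_sum_right mult.commute)

lemma r2_zero [simp]: "r2 (\<lambda>\<beta>. 0) \<alpha> = 0"
  by (simp add: r2_def ext[OF ml_zero])

lemma r2_sum: "r2 (\<lambda>\<beta>. \<Sum>i\<in>I. g i \<beta>) \<alpha> = (\<Sum>i\<in>I. r2 (g i) \<alpha>)"
  by (induction I rule: infinite_finite_induct) (simp_all add: r2_add)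

lemma r2_cong:
  assumes "\<And>\<beta>. size \<beta> + 2 = size \<alpha> \<Longrightarrow> g \<beta> = h \<beta>"
  shows "r2 g \<alpha> = r2 h \<alpha>"
  unfolding r2_def
proof (intro sum.cong refl)
  fix \<mu>
  show "sg \<mu> *\<^sub>R ml \<mu> (ml \<mu> g) \<alpha> = sg \<mu> *\<^sub>R ml \<mu> (ml \<mu> h) \<alpha>"
  proof (cases "\<mu> \<in># \<alpha> \<and> \<mu> \<in># \<alpha> - {#\<mu>#}")
    case True
    then have "size (\<alpha> - {#\<mu>#} - {#\<mu>#}) + 2 = size \<alpha>"
      by (metis (no_types, opaque_lifting) Suc_eq_plus1 add_Suc_right insert_DiffM one_add_one size_add_mset)
    then show ?thesis
      by (simp add: ml_def assms)
  next
    case False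
    then show ?thesis
      by (auto simp: ml_def not_in_iff)
  qed
qed

lemma sh_ml: "ml \<mu> g (add_mset \<nu> \<alpha>) = ml \<mu> (sh \<nu> g) \<alpha> + (if \<mu> = \<nu> then g \<alpha> else 0)"
proof (cases "\<mu> = \<nu>")
  case True
  then show ?thesis
    by (cases "\<mu> \<in># \<alpha>") (auto simp: ml_def sh_def scaleR_add_left not_in_iff)
next
  case False
  then show ?thesis
    by (simp add: ml_def sh_def diff_add_mset_swap)
qed

lemma ml_commute: "ml \<mu> (ml \<nu> g) \<alpha> = ml \<nu> (ml \<mu> g) \<alpha>"
  by (cases "\<mu> = \<nu>") (auto simp: ml_def add_mset_commute mult.commute)

lemma ml_r2: "ml \<nu> (r2 g) \<alpha> = r2 (ml \<nu> g) \<alpha>"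
proof -
  have "ml \<nu> (r2 g) \<alpha> = (\<Sum>\<mu>\<in>UNIV. sg \<mu> *\<^sub>R ml \<nu> (ml \<mu> (ml \<mu> g)) \<alpha>)"
    using ml_sum[of \<nu> "\<lambda>\<mu> \<beta>. sg \<mu> *\<^sub>R ml \<mu> (ml \<mu> g) \<beta>" UNIV \<alpha>]
    by (simp add: ml_scaleR flip: r2_def)
  also have "\<dots> = r2 (ml \<nu> g) \<alpha>"
    unfolding r2_def by (intro sum.cong refl) (metis (no_types) ml_commute ext)
  finally show ?thesis .
qed

lemma sh_r2: "r2 g (add_mset \<nu> \<alpha>) = r2 (sh \<nu> g) \<alpha> + (2 * sg \<nu>) *\<^sub>R ml \<nu> g \<alpha>"
proof -
  have "ml \<mu> (ml \<mu> g) (add_mset \<nu> \<alpha>) = ml \<mu> (ml \<mu> (sh \<nu> g)) \<alpha> + (if \<mu> = \<nu> then 2 *\<^sub>R ml \<mu> g \<alpha> else 0)" for \<mu>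
  proof -
    have "sh \<nu> (ml \<mu> g) = (\<lambda>\<beta>. ml \<mu> (sh \<nu> g) \<beta> + (if \<mu> = \<nu> then g \<beta> else 0))"
      by (simp add: fun_eq_iff sh_def[of \<nu> "ml \<mu> g"] sh_ml)
    then have "ml \<mu> (sh \<nu> (ml \<mu> g)) \<alpha> = ml \<mu> (ml \<mu> (sh \<nu> g)) \<alpha> + (if \<mu> = \<nu> then ml \<mu> g \<alpha> else 0)"
      by (simp add: ml_add)
    then show ?thesis
      by (simp add: sh_ml scaleR_2)
  qed
  then have "r2 g (add_mset \<nu> \<alpha>) = (\<Sum>\<mu>\<in>UNIV. sg \<mu> *\<^sub>R ml \<mu> (ml \<mu> (sh \<nu> g)) \<alpha>
      + (if \<nu> = \<mu> then (2 * sg \<mu>) *\<^sub>R ml \<mu> g \<alpha> else 0))"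
    unfolding r2_def by (intro sum.cong refl) (simp add: scaleR_add_right)
  then show ?thesis
    by (simp add: sum.distrib r2_def)
qed

lemma sum_count: "(\<Sum>\<mu>\<in>UNIV. count \<alpha> \<mu>) = size \<alpha>" for \<alpha> :: "4 multiset"
  unfolding size_multiset_overloaded_eq by (rule sum.mono_neutral_right) (auto simp: not_in_iff)

lemma ml_sh: "ml \<mu> (sh \<mu> g) \<alpha> = real (count \<alpha> \<mu>) *\<^sub>R g \<alpha>"
  by (cases "\<mu> \<in># \<alpha>") (auto simp: ml_def sh_def not_in_iff)

text \<open>In dimension \<open>n\<close> the commutator of the wave operator with the squared
  position is \<open>4 E + 2 n\<close>. Here \<open>n = 4\<close>, and the Euler operator
  \<open>E\<close> acts on a jet as its order, because \<open>ml\<close> after \<open>sh\<close>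
  counts occurrences.\<close>

lemma bx_r2: "bx (r2 g) \<alpha> = r2 (bx g) \<alpha> + (4 * real (size \<alpha>) + 8) *\<^sub>R g \<alpha>"
proof -
  have "bx (r2 g) \<alpha> = (\<Sum>\<mu>\<in>UNIV. sg \<mu> *\<^sub>R r2 (sh \<mu> (sh \<mu> g)) \<alpha> + 4 *\<^sub>R ml \<mu> (sh \<mu> g) \<alpha> + 2 *\<^sub>R g \<alpha>)"
    unfolding bx_def
  proof (intro sum.cong refl)
    fix \<mu>
    have "4 *\<^sub>R x = 2 *\<^sub>R x + 2 *\<^sub>R x" for x :: 'a
      by (simp flip: scaleR_add_left)
    moreover have "sg \<mu> * (2 * sg \<mu>) = 2"
      using sg_square[of \<mu>] by simp
    ultimately show "sg \<mu> *\<^sub>R r2 g (add_mset \<mu> (add_mset \<mu> \<alpha>))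
        = sg \<mu> *\<^sub>R r2 (sh \<mu> (sh \<mu> g)) \<alpha> + 4 *\<^sub>R ml \<mu> (sh \<mu> g) \<alpha> + 2 *\<^sub>R g \<alpha>"
      by (simp only: sh_r2 sh_ml scaleR_add_right scaleR_scaleR) (simp add: scaleR_add_right add.assoc)
  qed
  also have "\<dots> = (\<Sum>\<mu>\<in>UNIV. sg \<mu> *\<^sub>R r2 (sh \<mu> (sh \<mu> g)) \<alpha>) + (4 * real (size \<alpha>)) *\<^sub>R g \<alpha> + 8 *\<^sub>R g \<alpha>"
    by (simp add: sum.distrib ml_sh flip: sum_count)
      (simp add: scaleR_sum_left sum_distrib_left sum_constant_scaleR)
  also have "(\<Sum>\<mu>\<in>UNIV. sg \<mu> *\<^sub>R r2 (sh \<mu> (sh \<mu> g)) \<alpha>) = r2 (bx g) \<alpha>"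
    using r2_sum[of "\<lambda>\<mu> \<beta>. sg \<mu> *\<^sub>R sh \<mu> (sh \<mu> g) \<beta>" UNIV \<alpha>]
    by (simp add: r2_scaleR sh_def[abs_def] bx_def[abs_def])
  finally show ?thesis
    by (simp add: scaleR_add_left)
qed

subsection \<open>Solving the Klein-Gordon equation\<close>

lemma funpow_r2_add: "(r2 ^^ j) (\<lambda>\<beta>. g \<beta> + h \<beta>) \<alpha> = (r2 ^^ j) g \<alpha> + (r2 ^^ j) h \<alpha>"
proof (induction j arbitrary: \<alpha>)
  case (Suc j)
  then have "(r2 ^^ j) (\<lambda>\<beta>. g \<beta> + h \<beta>) = (\<lambda>\<beta>. (r2 ^^ j) g \<beta> + (r2 ^^ j) h \<beta>)"
    by (simp add: fun_eq_iff)
  then show ?case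
    by (simp add: r2_add)
qed simp

lemma funpow_r2_scaleR: "(r2 ^^ j) (\<lambda>\<beta>. r *\<^sub>R g \<beta>) \<alpha> = r *\<^sub>R (r2 ^^ j) g \<alpha>"
proof (induction j arbitrary: \<alpha>)
  case (Suc j)
  then have "(r2 ^^ j) (\<lambda>\<beta>. r *\<^sub>R g \<beta>) = (\<lambda>\<beta>. r *\<^sub>R (r2 ^^ j) g \<beta>)"
    by (simp add: fun_eq_iff)
  then show ?case
    by (simp add: r2_scaleR)
qed simp

lemma funpow_r2_small: "size \<alpha> < 2 * j \<Longrightarrow> (r2 ^^ j) g \<alpha> = 0"
proof (induction j arbitrary: \<alpha>)
  case (Suc j)
  have "r2 ((r2 ^^ j) g) \<alpha> = r2 (\<lambda>\<beta>. 0) \<alpha>"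
    by (rule r2_cong) (use Suc in auto)
  then show ?case
    by simp
qed simp

text \<open>Each \<open>r2\<close> reads jets of order two lower, so a factor depending on the order
  is shifted when it is moved inside.\<close>

lemma funpow_r2_size:
  "f (size \<alpha>) *\<^sub>R (r2 ^^ j) g \<alpha> = (r2 ^^ j) (\<lambda>\<beta>. f (size \<beta> + 2 * j) *\<^sub>R g \<beta>) \<alpha>"
proof (induction j arbitrary: f \<alpha>)
  case (Suc j)
  have "f (size \<alpha>) *\<^sub>R r2 ((r2 ^^ j) g) \<alpha> = r2 (\<lambda>\<beta>. f (size \<alpha>) *\<^sub>R (r2 ^^ j) g \<beta>) \<alpha>"
    by (simp add: r2_scaleR)
  also have "\<dots> = r2 (\<lambda>\<beta>. f (size \<beta> + 2) *\<^sub>R (r2 ^^ j) g \<beta>) \<alpha>"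
    by (rule r2_cong) simp
  also have "\<dots> = r2 ((r2 ^^ j) (\<lambda>\<beta>. f (size \<beta> + 2 * j + 2) *\<^sub>R g \<beta>)) \<alpha>"
    using Suc.IH[of "\<lambda>k. f (k + 2)"] by simp
  finally show ?case
    by (simp add: algebra_simps)
qed simp

text \<open>This is the classical formula by which the Laplacian sends \<open>r^(2k) h\<close> to
  \<open>2k (2k + 2d + n - 2) r^(2k-2) h\<close> for harmonic \<open>h\<close> of degree
  \<open>d\<close>, with \<open>n = 4\<close> and \<open>k = j + 1\<close>.\<close>

lemma bx_funpow_r2:
  assumes "\<And>\<alpha>. bx g \<alpha> = 0"
  shows "bx ((r2 ^^ Suc j) g) \<alpha>
    = (r2 ^^ j) (\<lambda>\<beta>. (4 * (real j + 1) * (real (size \<beta>) + real j + 2)) *\<^sub>R g \<beta>) \<alpha>"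
proof (induction j arbitrary: \<alpha>)
  case 0
  have "bx g = (\<lambda>\<beta>. 0)"
    using assms by auto
  then show ?case
    by (simp add: bx_r2 algebra_simps)
next
  case (Suc j)
  have "bx ((r2 ^^ Suc j) g)
      = (r2 ^^ j) (\<lambda>\<beta>. (4 * (real j + 1) * (real (size \<beta>) + real j + 2)) *\<^sub>R g \<beta>)"
    using Suc by (simp add: fun_eq_iff)
  then have "bx ((r2 ^^ Suc (Suc j)) g) \<alpha>
      = (r2 ^^ Suc j) (\<lambda>\<beta>. (4 * (real j + 1) * (real (size \<beta>) + real j + 2)) *\<^sub>R g \<beta>) \<alpha>
        + (4 * real (size \<alpha>) + 8) *\<^sub>R (r2 ^^ Suc j) g \<alpha>"
    using bx_r2[of "(r2 ^^ Suc j) g" \<alpha>] by simp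
  also have "\<dots> = (r2 ^^ Suc j) (\<lambda>\<beta>. (4 * (real j + 1) * (real (size \<beta>) + real j + 2)) *\<^sub>R g \<beta>
      + (4 * real (size \<beta> + 2 * Suc j) + 8) *\<^sub>R g \<beta>) \<alpha>"
    unfolding funpow_r2_add
    using funpow_r2_size[of "\<lambda>k. 4 * real k + 8" \<alpha> "Suc j" g] by simp
  also have "(\<lambda>\<beta>. (4 * (real j + 1) * (real (size \<beta>) + real j + 2)) *\<^sub>R g \<beta>
      + (4 * real (size \<beta> + 2 * Suc j) + 8) *\<^sub>R g \<beta>)
      = (\<lambda>\<beta>. (4 * (real (Suc j) + 1) * (real (size \<beta>) + real (Suc j) + 2)) *\<^sub>R g \<beta>)"
    unfolding scaleR_add_left[symmetric] by (intro ext arg_cong2[where f = scaleR] refl) (simp add: algebra_simps)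
  finally show ?case .
qed

lemma bx_sum: "bx (\<lambda>\<beta>. \<Sum>i\<in>I. g i \<beta>) \<alpha> = (\<Sum>i\<in>I. bx (g i) \<alpha>)"
  unfolding bx_def scaleR_sum_right by (rule sum.swap)

text \<open>The Klein-Gordon solution with prescribed harmonic part \<open>g\<close>: its jets are a power series in
  \<^const>\<open>r2\<close> applied to those of \<open>g\<close>, with coefficients depending on the order of the jet.\<close>

lemma klein_gordon_extension:
  fixes g :: "4 multiset \<Rightarrow> 'w::real_vector" and M :: real
  assumes g: "\<And>\<alpha>. bx g \<alpha> = 0"
  obtains B H where "\<And>\<alpha>. bx B \<alpha> = - M *\<^sub>R B \<alpha>"
    and "\<And>\<alpha>. B \<alpha> = g \<alpha> + r2 (\<lambda>\<beta>. (- M / (4 * (real (size \<beta>) + 2))) *\<^sub>R g \<beta>) \<alpha> + r2 (r2 H) \<alpha>"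
proof -
  \<comment> \<open>The denominators are the factors from \<open>bx_funpow_r2\<close>; with them the
    wave operator sends each term of the series to \<open>- M\<close> times the preceding
    one.\<close>
  define c :: "nat \<Rightarrow> nat \<Rightarrow> real" where
    "c j k = (\<Prod>i<j. - M / (4 * (real i + 1) * (real k + real i + 2)))" for j k
  have c_Suc: "c (Suc j) k * (4 * (real j + 1) * (real k + real j + 2)) = - M * c j k" for j k
  proof -
    have "4 * (real j + 1) * (real k + real j + 2) > 0"
      by (intro mult_pos_pos add_nonneg_pos) auto
    then show ?thesis
      by (simp add: c_def)
  qed
  define h where "h j \<beta> = c j (size \<beta>) *\<^sub>R g \<beta>" for j \<beta>
  define b where "b j = (r2 ^^ j) (h j)" for j
  have bx_h: "bx (h j) \<alpha> = 0" for j \<alpha>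
  proof -
    have "bx (h j) \<alpha> = c j (Suc (Suc (size \<alpha>))) *\<^sub>R bx g \<alpha>"
      by (simp add: bx_def h_def scaleR_sum_right mult.commute)
    then show ?thesis
      by (simp add: g)
  qed
  have bx_b: "bx (b (Suc j)) \<alpha> = - M *\<^sub>R b j \<alpha>" for j \<alpha>
  proof -
    have "(\<lambda>\<beta>. (4 * (real j + 1) * (real (size \<beta>) + real j + 2)) *\<^sub>R h (Suc j) \<beta>) = (\<lambda>\<beta>. (- M) *\<^sub>R h j \<beta>)"
      using c_Suc[of j] by (simp add: h_def fun_eq_iff mult.commute)
    then show ?thesis
      unfolding b_def using bx_funpow_r2[of "h (Suc j)" j \<alpha>] bx_h
      by (simp only: funpow_r2_scaleR)
  qed
  have b_small: "b j \<alpha> = 0" if "size \<alpha> < 2 * j" for j \<alpha>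
    unfolding b_def by (rule funpow_r2_small) (rule that)
  \<comment> \<open>Every \<open>r2\<close> uses up two derivatives, so at a fixed jet the power
    series is a finite sum.\<close>
  define B where "B \<alpha> = (\<Sum>j\<le>size \<alpha>. b j \<alpha>)" for \<alpha>
  have B: "B \<alpha> = (\<Sum>j\<le>N. b j \<alpha>)" if "size \<alpha> \<le> N" for \<alpha> N
    unfolding B_def using that by (intro sum.mono_neutral_left) (auto intro!: b_small)
  have "bx B \<alpha> = - M *\<^sub>R B \<alpha>" for \<alpha>
  proof -
    let ?N = "size \<alpha>"
    have "bx B \<alpha> = bx (\<lambda>\<beta>. \<Sum>j\<le>Suc (Suc ?N). b j \<beta>) \<alpha>"
      unfolding bx_def by (intro sum.cong refl arg_cong2[where f = scaleR] B) simp
    also have "\<dots> = (\<Sum>j\<le>Suc (Suc ?N). bx (b j) \<alpha>)"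
      by (rule bx_sum)
    also have "\<dots> = bx (b 0) \<alpha> + (\<Sum>j\<le>Suc ?N. bx (b (Suc j)) \<alpha>)"
      by (rule sum.atMost_Suc_shift)
    also have "\<dots> = - M *\<^sub>R B \<alpha>"
      using bx_h[of 0] B[of \<alpha> "Suc ?N"] by (simp only: bx_b scaleR_sum_right) (simp add: b_def)
    finally show ?thesis .
  qed
  \<comment> \<open>Only the first correction is kept explicit: its divergence can have a part
    outside the image of \<open>r2\<close>, whereas a term with two factors \<open>r2\<close> has
    its divergence inside that image.\<close>
  moreover define H where "H \<beta> = (\<Sum>j\<le>size \<beta>. (r2 ^^ j) (h (Suc (Suc j))) \<beta>)" for \<beta>
  have "B \<alpha> = g \<alpha> + r2 (\<lambda>\<beta>. (- M / (4 * (real (size \<beta>) + 2))) *\<^sub>R g \<beta>) \<alpha> + r2 (r2 H) \<alpha>" for \<alpha>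
  proof -
    let ?N = "size \<alpha>"
    have "H \<beta> = (\<Sum>j\<le>?N. (r2 ^^ j) (h (Suc (Suc j))) \<beta>)" if "size \<beta> \<le> ?N" for \<beta>
      unfolding H_def using that by (intro sum.mono_neutral_left) (auto intro!: funpow_r2_small)
    then have "r2 (r2 H) \<alpha> = r2 (r2 (\<lambda>\<beta>. \<Sum>j\<le>?N. (r2 ^^ j) (h (Suc (Suc j))) \<beta>)) \<alpha>"
      by (intro r2_cong) simp
    also have "\<dots> = (\<Sum>j\<le>?N. b (Suc (Suc j)) \<alpha>)"
    proof -
      have "r2 (\<lambda>\<beta>. \<Sum>j\<le>?N. (r2 ^^ j) (h (Suc (Suc j))) \<beta>)
          = (\<lambda>\<beta>. \<Sum>j\<le>?N. (r2 ^^ Suc j) (h (Suc (Suc j))) \<beta>)"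
        by (simp add: fun_eq_iff r2_sum)
      then show ?thesis
        by (simp add: r2_sum b_def)
    qed
    also have "B \<alpha> = b 0 \<alpha> + (b 1 \<alpha> + (\<Sum>j\<le>?N. b (Suc (Suc j)) \<alpha>))"
      using B[of \<alpha> "Suc (Suc ?N)"] by (simp add: sum.atMost_Suc_shift del: sum.atMost_Suc)
    moreover have "b 0 \<alpha> = g \<alpha>"
      by (simp add: b_def h_def c_def)
    moreover have "b 1 \<alpha> = r2 (\<lambda>\<beta>. (- M / (4 * (real (size \<beta>) + 2))) *\<^sub>R g \<beta>) \<alpha>"
      by (simp add: b_def h_def[abs_def] c_def)
    ultimately show ?thesis
      by simp
  qed
  ultimately show thesis
    by (rule that)
qed

section \<open>Proca fields from their curl and their symmetrization\<close>

section \<open>The Proca field with given field strength and scalar part\<close>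

lemma sum_nth_count:
  fixes F :: "4 \<Rightarrow> 'w::real_vector"
  shows "(\<Sum>i<length ys. F (ys ! i)) = (\<Sum>\<mu>\<in>UNIV. real (count (mset ys) \<mu>) *\<^sub>R F \<mu>)"
proof (induction ys)
  case (Cons y ys)
  have "(\<Sum>\<mu>\<in>UNIV. real (count (mset (y # ys)) \<mu>) *\<^sub>R F \<mu>)
      = (\<Sum>\<mu>\<in>UNIV. real (count (mset ys) \<mu>) *\<^sub>R F \<mu> + (if y = \<mu> then F \<mu> else 0))"
    by (intro sum.cong) (auto simp: scaleR_add_left)
  then show ?case
    using Cons by (simp add: sum.lessThan_Suc_shift sum.distrib del: sum.lessThan_Suc)
qed simp

lemma sum_ml_nth:
  "(\<Sum>\<mu>\<in>UNIV. ml \<mu> (A \<mu>) (mset ys)) = (\<Sum>i<length ys. A (ys ! i) (mset ys - {#ys ! i#}))"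
  by (simp add: sum_nth_count[of "\<lambda>\<mu>. A \<mu> (mset ys - {#\<mu>#})"] ml_def)

text \<open>Translates from multiplicities in a multiset to pairs of distinct positions in a list:
  an index of multiplicity \<open>k\<close> occupies \<open>k (k - 1)\<close> ordered pairs. In this
  form \<open>trl_kill\<close> applies.\<close>

lemma r2_nth:
  "r2 G (mset ys) = (\<Sum>i<length ys. \<Sum>j\<in>{..<length ys} - {i}.
     reta (ys ! i) (ys ! j) *\<^sub>R G (mset ys - {#ys ! i#} - {#ys ! j#}))"
proof -
  have "r2 G (mset ys) = (\<Sum>\<mu>\<in>UNIV. ml \<mu> (\<lambda>\<beta>. sg \<mu> *\<^sub>R ml \<mu> G \<beta>) (mset ys))"
    by (simp add: r2_def ml_scaleR)
  also have "\<dots> = (\<Sum>i<length ys. sg (ys ! i) *\<^sub>R ml (ys ! i) G (mset ys - {#ys ! i#}))"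
    by (rule sum_ml_nth)
  also have "\<dots> = (\<Sum>i<length ys. \<Sum>j\<in>{..<length ys} - {i}.
     reta (ys ! i) (ys ! j) *\<^sub>R G (mset ys - {#ys ! i#} - {#ys ! j#}))"
  proof (intro sum.cong refl)
    fix i assume i: "i \<in> {..<length ys}"
    let ?a = "ys ! i"
    have "real (count (mset ys) ?a) = (\<Sum>\<mu>\<in>UNIV. real (count (mset ys) \<mu>) *\<^sub>R of_bool (?a = \<mu>))"
      by (simp add: of_bool_def if_distrib[of "\<lambda>x. _ * x"] cong: if_cong)
    also have "\<dots> = (\<Sum>j<length ys. of_bool (?a = ys ! j))"
      by (rule sum_nth_count[symmetric])
    also have "\<dots> = 1 + (\<Sum>j\<in>{..<length ys} - {i}. of_bool (?a = ys ! j))"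
      using sum.remove[of "{..<length ys}" i "\<lambda>j. of_bool (?a = ys ! j) :: real"] i by simp
    finally have "real (count (mset ys - {#?a#}) ?a) = (\<Sum>j\<in>{..<length ys} - {i}. of_bool (?a = ys ! j))"
      using i by (simp add: of_nat_diff Suc_leI)
    then have "sg ?a *\<^sub>R ml ?a G (mset ys - {#?a#})
        = (\<Sum>j\<in>{..<length ys} - {i}. (sg ?a * of_bool (?a = ys ! j)) *\<^sub>R G (mset ys - {#?a#} - {#?a#}))"
      by (simp only: ml_def scaleR_scaleR scaleR_sum_left scaleR_sum_right)
    also have "\<dots> = (\<Sum>j\<in>{..<length ys} - {i}. reta ?a (ys ! j) *\<^sub>R G (mset ys - {#?a#} - {#ys ! j#}))"
      by (intro sum.cong) (auto simp: reta_def)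
    finally show "sg ?a *\<^sub>R ml ?a G (mset ys - {#?a#})
        = (\<Sum>j\<in>{..<length ys} - {i}. reta ?a (ys ! j) *\<^sub>R G (mset ys - {#?a#} - {#ys ! j#}))" .
  qed
  finally show ?thesis .
qed

lemma mset_update2:
  fixes zs :: "4 list"
  assumes "i < length zs" "j < length zs" "i \<noteq> j"
  shows "mset (zs[i := a, j := b]) = add_mset a (add_mset b (mset zs - {#zs ! i#} - {#zs ! j#}))"
proof -
  \<comment> \<open>Position \<open>i\<close> receives a value different from \<open>zs ! j\<close>,
    so the occurrence found here survives the removal of \<open>zs ! i\<close>.\<close>
  have "zs ! j \<in># mset (zs[i := zs ! j + 1])"
    using assms by (metis length_list_update nth_list_update_neq nth_mem_mset)
  then have "zs ! j \<in># mset zs - {#zs ! i#}"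
    using assms by (simp add: mset_update)
  then show ?thesis
    using assms by (auto simp: mset_update)
qed

text \<open>In terms of positions, \<open>r2\<close> yields only multiples of the metric in the
  trailing indices. The first \<open>d\<close> indices are parameters: \<open>d = 1\<close> for a
  vector field and \<open>d = 0\<close> for a scalar.\<close>

lemma trl_r2:
  fixes G :: "4 list \<Rightarrow> 4 multiset \<Rightarrow> 'w::real_vector"
  assumes "d \<le> length xs"
  shows "trl (\<lambda>y. r2 (G (take d y)) (mset (drop d y))) xs = 0"
proof -
  let ?n = "length xs - d"
  define S where "S i j y = G (take d y) (mset (drop d y) - {#drop d y ! i#} - {#drop d y ! j#})" for i j y
  have "trl (\<lambda>y. r2 (G (take d y)) (mset (drop d y))) xs
      = trl (\<lambda>y. \<Sum>i<?n. \<Sum>j\<in>{..<?n} - {i}. reta (y ! (d + i)) (y ! (d + j)) *\<^sub>R S i j y) xs"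
    using assms by (intro trl_cong) (simp add: r2_nth S_def)
  also have "\<dots> = (\<Sum>i<?n. \<Sum>j\<in>{..<?n} - {i}. trl (\<lambda>y. reta (y ! (d + i)) (y ! (d + j)) *\<^sub>R S i j y) xs)"
    by (simp add: trl_sum)
  also have "\<dots> = 0"
  proof (intro sum.neutral ballI trl_kill)
    fix i j and y :: "4 list"
    assume ij: "i \<in> {..<?n}" "j \<in> {..<?n} - {i}" and y: "length y = length xs"
    then show "S i j (erase (d + i) (d + j) y) = S i j y"
      by (simp add: S_def drop_update_swap nth_list_update mset_update2)
  qed auto
  finally show ?thesis .
qed

subsection \<open>Symmetrization and curl\<close>

definition tens :: "(4 \<Rightarrow> 4 multiset \<Rightarrow> 'w) \<Rightarrow> 4 list \<Rightarrow> 'w" where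
  "tens A y = A (hd y) (mset (tl y))"

definition swp :: "nat \<Rightarrow> 4 list \<Rightarrow> 4 list" where
  "swp l y = permute_list (Transposition.transpose 0 l) y"

definition symt :: "(4 \<Rightarrow> 4 multiset \<Rightarrow> 'w::real_vector) \<Rightarrow> 4 list \<Rightarrow> 'w" where
  "symt A y = (1 / real (length y)) *\<^sub>R (\<Sum>l<length y. A (y ! l) (mset y - {#y ! l#}))"

definition curl :: "(4 \<Rightarrow> 4 multiset \<Rightarrow> 'w::real_vector) \<Rightarrow> 4 list \<Rightarrow> 'w" where
  "curl A y = A (y ! 1) (mset (y ! 0 # drop 2 y)) - A (y ! 0) (mset (y ! 1 # drop 2 y))"

lemma length_swp [simp]: "length (swp l y) = length y"
  by (simp add: swp_def)

lemma transpose_permutes: "l < length y \<Longrightarrow> Transposition.transpose 0 l permutes {..<length y}"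
  by (rule permutes_swap_id) auto

lemma tens_swp:
  assumes "l < length y"
  shows "tens A (swp l y) = A (y ! l) (mset y - {#y ! l#})"
proof -
  have nonempty: "swp l y \<noteq> []"
    using assms by (metis length_greater_0_conv length_swp less_nat_zero_code list.size(3))
  have "y \<noteq> []"
    using assms by auto
  then have "hd (swp l y) = y ! l"
    using assms nonempty permute_list_nth[OF transpose_permutes[OF assms], of 0]
    by (subst hd_conv_nth) (auto simp: swp_def)
  moreover have "mset (swp l y) = mset y"
    unfolding swp_def by (rule mset_permute_list) (rule transpose_permutes[OF assms])
  ultimately obtain zs where "swp l y = y ! l # zs" "mset y = add_mset (y ! l) (mset zs)"
    using nonempty by (cases "swp l y") auto
  then show ?thesis
    by (simp add: tens_def)
qed

lemma trl_swp: "l < length xs \<Longrightarrow> trl (\<lambda>y. T (swp l y)) xs = trl T (swp l xs)"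
  unfolding swp_def by (rule trl_permute) (rule transpose_permutes)

lemma curl_eq:
  assumes "2 \<le> length y"
  shows "curl A y = tens A (swp 1 y) - tens A y"
proof -
  obtain a b zs where "y = a # b # zs"
    using assms by (metis Suc_le_length_iff numeral_2_eq_2)
  then show ?thesis
    by (simp add: tens_swp curl_def) (simp add: tens_def)
qed

lemma symt_eq: "symt A y = (1 / real (length y)) *\<^sub>R (\<Sum>l<length y. tens A (swp l y))"
  unfolding symt_def by (intro arg_cong2[where f = scaleR] sum.cong refl) (simp add: tens_swp)

lemma trl_curl: "2 \<le> length xs \<Longrightarrow> trl (curl A) xs = trl (tens A) (swp 1 xs) - trl (tens A) xs"
  by (subst trl_cong[of xs _ "\<lambda>y. tens A (swp 1 y) - tens A y"]) (auto simp: curl_eq trl_diff trl_swp)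

lemma trl_symt: "trl (symt A) xs = (1 / real (length xs)) *\<^sub>R (\<Sum>l<length xs. trl (tens A) (swp l xs))"
proof -
  have "trl (symt A) xs = trl (\<lambda>y. (1 / real (length xs)) *\<^sub>R (\<Sum>l<length xs. tens A (swp l y))) xs"
    by (rule trl_cong) (simp add: symt_eq)
  then show ?thesis
    by (simp add: trl_scaleR trl_sum trl_swp)
qed

text \<open>A trace involving the first index is a divergence, and any other trace is a wave
  operator applied to a component. The sizes record the loss of order, on which an induction depends
  later.\<close>

lemma trc_tens:
  assumes "i < length z" "j < length z" "i \<noteq> j"
  shows "(\<exists>\<beta>. size \<beta> + 2 = length z \<and> trc i j (tens A) z = dv A \<beta>)
    \<or> (\<exists>\<mu> \<beta>. size \<beta> + 3 = length z \<and> trc i j (tens A) z = bx (A \<mu>) \<beta>)"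
proof -
  obtain x zs where z: "z = x # zs"
    using assms by (cases z) auto
  have dv: "\<exists>\<beta>. size \<beta> + 2 = length z \<and> (\<Sum>\<mu>\<in>UNIV. sg \<mu> *\<^sub>R tens A (\<mu> # zs[k := \<mu>])) = dv A \<beta>"
    if "k < length zs" for k
    using that z by (intro exI[of _ "mset zs - {#zs ! k#}"])
      (auto simp: tens_def dv_def mset_update size_Diff_singleton)
  show ?thesis
  proof (cases "i = 0 \<or> j = 0")
    case True
    then obtain k where "k < length zs" "i = 0 \<and> j = Suc k \<or> j = 0 \<and> i = Suc k"
      using assms z by (cases i; cases j) auto
    then show ?thesis
      using dv[of k] by (auto simp: trc_def z)
  next
    case False
    then obtain i' j' where ij: "i = Suc i'" "j = Suc j'" "i' < length zs" "j' < length zs" "i' \<noteq> j'"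
      using assms z by (cases i; cases j) auto
    then have "size (mset zs - {#zs ! i'#} - {#zs ! j'#}) + 2 = length zs"
      using mset_update2[of i' zs j' 0 0] by (metis add_2_eq_Suc' size_add_mset size_mset length_list_update)
    with ij show ?thesis
      by (intro disjI2 exI[of _ x] exI[of _ "mset zs - {#zs ! i'#} - {#zs ! j'#}"])
        (auto simp: trc_def z tens_def mset_update2 bx_def)
  qed
qed

subsection \<open>Construction of the Proca field\<close>

lemma tens_traceless:
  assumes "\<And>\<alpha>. dv A \<alpha> = 0" "\<And>\<mu> \<alpha>. bx (A \<mu>) \<alpha> = 0"
  shows "trl (tens A) xs = tens A xs"
proof (rule trl_traceless)
  fix i j and z :: "4 list" assume "i < length xs" "j < length xs" "i \<noteq> j" "length z = length xs"
  then show "trc i j (tens A) z = 0"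
    using trc_tens[of i z j A] assms by auto
qed

lemma bx_ml: "bx (ml \<nu> g) \<alpha> = ml \<nu> (bx g) \<alpha> + (2 * sg \<nu>) *\<^sub>R g (add_mset \<nu> \<alpha>)"
proof -
  have "ml \<nu> g (add_mset \<mu> (add_mset \<mu> \<alpha>)) = ml \<nu> (sh \<mu> (sh \<mu> g)) \<alpha>
      + (if \<nu> = \<mu> then 2 *\<^sub>R g (add_mset \<nu> \<alpha>) else 0)" for \<mu>
    by (simp add: sh_ml scaleR_2) (simp add: sh_def)
  then have "bx (ml \<nu> g) \<alpha> = (\<Sum>\<mu>\<in>UNIV. sg \<mu> *\<^sub>R ml \<nu> (sh \<mu> (sh \<mu> g)) \<alpha>
      + (if \<nu> = \<mu> then (2 * sg \<nu>) *\<^sub>R g (add_mset \<nu> \<alpha>) else 0))"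
    unfolding bx_def by (intro sum.cong refl) (simp add: scaleR_add_right)
  also have "\<dots> = ml \<nu> (bx g) \<alpha> + (2 * sg \<nu>) *\<^sub>R g (add_mset \<nu> \<alpha>)"
    by (simp add: sum.distrib ml_def bx_def sh_def scaleR_sum_right mult.commute)
  finally show ?thesis .
qed

lemma dv_ml:
  "dv (\<lambda>\<mu>. ml \<nu> (A \<mu>)) \<alpha> = ml \<nu> (dv A) \<alpha> + sg \<nu> *\<^sub>R A \<nu> \<alpha>"
proof -
  have "dv (\<lambda>\<mu>. ml \<nu> (A \<mu>)) \<alpha>
      = (\<Sum>\<mu>\<in>UNIV. sg \<mu> *\<^sub>R ml \<nu> (sh \<mu> (A \<mu>)) \<alpha> + (if \<nu> = \<mu> then sg \<mu> *\<^sub>R A \<mu> \<alpha> else 0))"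
    unfolding dv_def by (intro sum.cong refl) (simp add: sh_ml scaleR_add_right)
  then show ?thesis
    by (simp add: sum.distrib ml_def dv_def sh_def scaleR_sum_right mult.commute)
qed

lemma dv_r2: "dv (\<lambda>\<nu>. r2 (A \<nu>)) \<alpha> = r2 (dv A) \<alpha> + 2 *\<^sub>R (\<Sum>\<nu>\<in>UNIV. ml \<nu> (A \<nu>) \<alpha>)"
proof -
  have "sg \<nu> * (2 * sg \<nu>) = 2" for \<nu>
    using sg_square[of \<nu>] by simp
  then have "dv (\<lambda>\<nu>. r2 (A \<nu>)) \<alpha> = (\<Sum>\<nu>\<in>UNIV. r2 (\<lambda>\<beta>. sg \<nu> *\<^sub>R A \<nu> (add_mset \<nu> \<beta>)) \<alpha> + 2 *\<^sub>R ml \<nu> (A \<nu>) \<alpha>)"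
    unfolding dv_def
    by (intro sum.cong refl) (simp add: sh_r2 scaleR_add_right r2_scaleR sh_def[abs_def])
  also have "\<dots> = r2 (dv A) \<alpha> + 2 *\<^sub>R (\<Sum>\<nu>\<in>UNIV. ml \<nu> (A \<nu>) \<alpha>)"
    by (simp add: sum.distrib dv_def[abs_def] r2_sum scaleR_sum_right)
  finally show ?thesis .
qed

text \<open>Adding \<open>m\<^sup>-\<^sup>2\<close> times the gradient of the divergence turns a Klein-Gordon field into a
  divergence-free one and does not affect its curl; it rescales the traceless symmetric part.\<close>

lemma proca_extension:
  fixes a :: "4 \<Rightarrow> 4 multiset \<Rightarrow> 'w::real_vector" and m :: real
  assumes "m \<noteq> 0" and dv: "\<And>\<alpha>. dv a \<alpha> = 0" and bx: "\<And>\<mu> \<alpha>. bx (a \<mu>) \<alpha> = 0"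
  obtains A where "\<And>\<mu> \<alpha>. bx (A \<mu>) \<alpha> = - m\<^sup>2 *\<^sub>R A \<mu> \<alpha>" "\<And>\<alpha>. dv A \<alpha> = 0"
    "\<And>xs. xs \<noteq> [] \<Longrightarrow> trl (tens A) xs
       = tens a xs - (1 / (2 * (real (length xs) + 1))) *\<^sub>R (\<Sum>l<length xs. tens a (swp l xs))"
proof -
  define M where "M = m\<^sup>2"
  have "M \<noteq> 0"
    using assms by (simp add: M_def)
  define h where "h \<nu> \<beta> = (- M / (4 * (real (size \<beta>) + 2))) *\<^sub>R a \<nu> \<beta>" for \<nu> \<beta>
  have "\<exists>B H. (\<forall>\<alpha>. bx B \<alpha> = - M *\<^sub>R B \<alpha>) \<and> (\<forall>\<alpha>. B \<alpha> = a \<nu> \<alpha> + r2 (h \<nu>) \<alpha> + r2 (r2 H) \<alpha>)" for \<nu>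
  proof -
    obtain B H where "\<And>\<alpha>. bx B \<alpha> = - M *\<^sub>R B \<alpha>"
      "\<And>\<alpha>. B \<alpha> = a \<nu> \<alpha> + r2 (\<lambda>\<beta>. (- M / (4 * (real (size \<beta>) + 2))) *\<^sub>R a \<nu> \<beta>) \<alpha> + r2 (r2 H) \<alpha>"
      by (rule klein_gordon_extension[where M = M, OF bx[of \<nu>]]) blast
    then show ?thesis
      unfolding h_def[abs_def] by blast
  qed
  then have "\<exists>B. \<forall>\<nu>. \<exists>H. (\<forall>\<alpha>. bx (B \<nu>) \<alpha> = - M *\<^sub>R B \<nu> \<alpha>)
      \<and> (\<forall>\<alpha>. B \<nu> \<alpha> = a \<nu> \<alpha> + r2 (h \<nu>) \<alpha> + r2 (r2 H) \<alpha>)"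
    by (intro choice allI)
  then obtain B where "\<forall>\<nu>. \<exists>H. (\<forall>\<alpha>. bx (B \<nu>) \<alpha> = - M *\<^sub>R B \<nu> \<alpha>)
      \<and> (\<forall>\<alpha>. B \<nu> \<alpha> = a \<nu> \<alpha> + r2 (h \<nu>) \<alpha> + r2 (r2 H) \<alpha>)"
    by blast
  then have "\<exists>H. \<forall>\<nu>. (\<forall>\<alpha>. bx (B \<nu>) \<alpha> = - M *\<^sub>R B \<nu> \<alpha>)
      \<and> (\<forall>\<alpha>. B \<nu> \<alpha> = a \<nu> \<alpha> + r2 (h \<nu>) \<alpha> + r2 (r2 (H \<nu>)) \<alpha>)"
    by (rule choice)
  then obtain H where bxB: "\<And>\<nu> \<alpha>. bx (B \<nu>) \<alpha> = - M *\<^sub>R B \<nu> \<alpha>"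
    and B': "\<And>\<nu> \<alpha>. B \<nu> \<alpha> = a \<nu> \<alpha> + r2 (h \<nu>) \<alpha> + r2 (r2 (H \<nu>)) \<alpha>"
    by blast
  then have B: "B \<nu> = (\<lambda>\<alpha>. a \<nu> \<alpha> + r2 (h \<nu>) \<alpha> + r2 (r2 (H \<nu>)) \<alpha>)" for \<nu>
    by blast
  define A where "A \<mu> \<alpha> = B \<mu> \<alpha> + (1 / M) *\<^sub>R dv B (add_mset \<mu> \<alpha>)" for \<mu> \<alpha>
  have bx_dvB: "(\<Sum>\<mu>\<in>UNIV. sg \<mu> *\<^sub>R dv B (add_mset \<mu> (add_mset \<mu> \<alpha>))) = - M *\<^sub>R dv B \<alpha>" for \<alpha>
  proof -
    have "(\<Sum>\<mu>\<in>UNIV. sg \<mu> *\<^sub>R dv B (add_mset \<mu> (add_mset \<mu> \<alpha>)))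
        = (\<Sum>\<nu>\<in>UNIV. sg \<nu> *\<^sub>R bx (B \<nu>) (add_mset \<nu> \<alpha>))"
      unfolding dv_def bx_def scaleR_sum_right
      by (subst sum.swap) (simp add: mult.commute add_mset_commute)
    then show ?thesis
      by (simp add: bxB dv_def scaleR_sum_right mult.commute sum_negf)
  qed
  show ?thesis
  proof (rule that)
    show "bx (A \<mu>) \<alpha> = - m\<^sup>2 *\<^sub>R A \<mu> \<alpha>" for \<mu> \<alpha>
    proof -
      have "bx (A \<mu>) \<alpha> = bx (B \<mu>) \<alpha> + (1 / M) *\<^sub>R
          (\<Sum>\<nu>\<in>UNIV. sg \<nu> *\<^sub>R dv B (add_mset \<nu> (add_mset \<nu> (add_mset \<mu> \<alpha>))))"
        unfolding bx_def A_def
        by (simp add: scaleR_add_right sum.distrib scaleR_sum_right mult.commute add_mset_commute)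
      then show ?thesis
        by (simp only: bx_dvB bxB) (simp add: A_def M_def algebra_simps)
    qed
    show "dv A \<alpha> = 0" for \<alpha>
    proof -
      have "dv A \<alpha> = dv B \<alpha> + (1 / M) *\<^sub>R (\<Sum>\<nu>\<in>UNIV. sg \<nu> *\<^sub>R dv B (add_mset \<nu> (add_mset \<nu> \<alpha>)))"
        unfolding dv_def[of A] A_def
        by (simp add: scaleR_add_right sum.distrib scaleR_sum_right mult.commute flip: dv_def)
      then show ?thesis
        using \<open>M \<noteq> 0\<close> by (simp add: bx_dvB)
    qed
    show "trl (tens A) xs
       = tens a xs - (1 / (2 * (real (length xs) + 1))) *\<^sub>R (\<Sum>l<length xs. tens a (swp l xs))"
      if "xs \<noteq> []" for xs
    proof -
      let ?n = "length xs"
      define G where "G \<alpha> = dv h \<alpha> + (dv (\<lambda>\<nu>. r2 (H \<nu>)) \<alpha> + 2 *\<^sub>R (\<Sum>\<nu>\<in>UNIV. ml \<nu> (H \<nu>) \<alpha>))" for \<alpha>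
      have dvB: "dv B \<alpha> = 2 *\<^sub>R (\<Sum>\<nu>\<in>UNIV. ml \<nu> (h \<nu>) \<alpha>) + r2 G \<alpha>" for \<alpha>
      proof -
        have "dv B \<alpha> = dv a \<alpha> + dv (\<lambda>\<nu>. r2 (h \<nu>)) \<alpha> + dv (\<lambda>\<nu>. r2 (r2 (H \<nu>))) \<alpha>"
          unfolding dv_def B by (simp add: scaleR_add_right sum.distrib)
        also have "\<dots> = r2 (dv h) \<alpha> + 2 *\<^sub>R (\<Sum>\<nu>\<in>UNIV. ml \<nu> (h \<nu>) \<alpha>)
            + (r2 (dv (\<lambda>\<nu>. r2 (H \<nu>))) \<alpha> + 2 *\<^sub>R (\<Sum>\<nu>\<in>UNIV. r2 (ml \<nu> (H \<nu>)) \<alpha>))"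
          by (simp add: dv dv_r2 ml_r2)
        also have "\<dots> = 2 *\<^sub>R (\<Sum>\<nu>\<in>UNIV. ml \<nu> (h \<nu>) \<alpha>) + r2 G \<alpha>"
          unfolding G_def[abs_def] by (simp add: r2_add r2_scaleR r2_sum)
        finally show ?thesis .
      qed
      \<comment> \<open>The jets of \<open>h\<close> occurring here have order one less than the
        length \<open>n\<close>, so their factor is \<open>- M / (4 (n + 1))\<close>; the factor
        \<open>1 / M\<close> in \<open>A\<close> will cancel the mass.\<close>
      have sum_h: "2 *\<^sub>R (\<Sum>\<nu>\<in>UNIV. ml \<nu> (h \<nu>) (mset y))
          = (- M / (2 * (real ?n + 1))) *\<^sub>R (\<Sum>l<?n. tens a (swp l y))" if "length y = ?n" for y
      proof -
        have "(\<Sum>\<nu>\<in>UNIV. ml \<nu> (h \<nu>) (mset y)) = (\<Sum>l<?n. (- M / (4 * (real ?n + 1))) *\<^sub>R tens a (swp l y))"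
          unfolding sum_ml_nth that
        proof (intro sum.cong refl)
          fix l assume "l \<in> {..<?n}"
          moreover from this have "real (size (mset y - {#y ! l#})) + 2 = real ?n + 1"
            using that by (simp add: size_Diff_singleton of_nat_diff Suc_leI)
          ultimately show "h (y ! l) (mset y - {#y ! l#}) = (- M / (4 * (real ?n + 1))) *\<^sub>R tens a (swp l y)"
            using that by (simp only: h_def tens_swp lessThan_iff)
        qed
        moreover have "2 * (- M / (4 * (real ?n + 1))) = - M / (2 * (real ?n + 1))"
          by (simp add: field_simps)
        ultimately show ?thesis
          by (simp only: scaleR_sum_right scaleR_scaleR)
      qed
      have kill: "trl (\<lambda>y. r2 (h' (hd y)) (mset (tl y))) xs = 0" for h' :: "4 \<Rightarrow> 4 multiset \<Rightarrow> 'w"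
        using trl_r2[of 1 xs "\<lambda>ys. h' (hd ys)"] \<open>xs \<noteq> []\<close>
        by (subst trl_cong[of xs _ "\<lambda>y. r2 (h' (hd (take 1 y))) (mset (drop 1 y))"])
          (auto simp: Suc_le_eq drop_Suc hd_take)
      \<comment> \<open>Apart from \<open>a\<close> and the sum over its swaps, everything lies in
        the image of \<open>r2\<close> and is removed by the projection.\<close>
      have "tens A y = tens a y
          + (r2 (h (hd y)) (mset (tl y)) + r2 (r2 (H (hd y))) (mset (tl y))
            + ((- 1 / (2 * (real ?n + 1))) *\<^sub>R (\<Sum>l<?n. tens a (swp l y)) + (1 / M) *\<^sub>R r2 G (mset y)))"
        if y: "length y = ?n" for y
      proof -
        have "add_mset (hd y) (mset (tl y)) = mset y"
          using y \<open>xs \<noteq> []\<close> by (cases y) auto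
        then have "tens A y = B (hd y) (mset (tl y)) + (1 / M) *\<^sub>R dv B (mset y)"
          by (simp add: tens_def A_def)
        then show ?thesis
          using \<open>M \<noteq> 0\<close> by (simp add: dvB sum_h[OF y] B tens_def scaleR_add_right scaleR_diff_right)
      qed
      then have "trl (tens A) xs = trl (\<lambda>y. tens a y
          + (r2 (h (hd y)) (mset (tl y)) + r2 (r2 (H (hd y))) (mset (tl y))
            + ((- 1 / (2 * (real ?n + 1))) *\<^sub>R (\<Sum>l<?n. tens a (swp l y)) + (1 / M) *\<^sub>R r2 G (mset y)))) xs"
        by (rule trl_cong)
      also have "\<dots> = trl (tens a) xs
          + (trl (\<lambda>y. r2 (h (hd y)) (mset (tl y))) xs + trl (\<lambda>y. r2 (r2 (H (hd y))) (mset (tl y))) xs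
            + ((- 1 / (2 * (real ?n + 1))) *\<^sub>R (\<Sum>l<?n. trl (\<lambda>y. tens a (swp l y)) xs)
              + (1 / M) *\<^sub>R trl (\<lambda>y. r2 G (mset y)) xs))"
        by (simp only: trl_add trl_scaleR trl_sum)
      also have "trl (\<lambda>y. r2 (h (hd y)) (mset (tl y))) xs = 0"
        by (rule kill)
      also have "trl (\<lambda>y. r2 (r2 (H (hd y))) (mset (tl y))) xs = 0"
        by (rule kill)
      also have "trl (\<lambda>y. r2 G (mset y)) xs = 0"
        using trl_r2[of 0 xs "\<lambda>ys. G"] by simp
      also have "(\<Sum>l<?n. trl (\<lambda>y. tens a (swp l y)) xs) = (\<Sum>l<?n. tens a (swp l xs))"
        by (intro sum.cong refl) (simp add: trl_swp tens_traceless dv bx)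
      also have "trl (tens a) xs = tens a xs"
        by (simp add: tens_traceless dv bx)
      finally show ?thesis
        by simp
    qed
  qed
qed

lemma eq_uminus_imp_zero:
  fixes x :: "'w::real_vector"
  assumes "x = - x"
  shows "x = 0"
proof -
  have "x + x = x + - x"
    by (subst (2) assms) (rule refl)
  then have "2 *\<^sub>R x = 0"
    by (simp add: scaleR_2)
  then show ?thesis
    by simp
qed

text \<open>Contracting \<open>f\<close> with the position is the homotopy of the Poincare lemma and
  supplies the curl; the term in \<open>p\<close> is symmetric in all indices, hence without curl,
  and supplies the symmetrization. \<open>bxf\<close>, \<open>dvf\<close> and \<open>bxp\<close>
  express that the prescribed tensors are traceless; together with antisymmetry they make
  \<open>a\<close> harmonic and divergence-free.\<close>

lemma proca_field:
  fixes f :: "4 \<Rightarrow> 4 \<Rightarrow> 4 multiset \<Rightarrow> 'w::real_vector" and p :: "4 multiset \<Rightarrow> 'w" and m :: real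
  assumes "m \<noteq> 0"
    and antisym: "\<And>\<mu> \<nu> \<alpha>. f \<mu> \<nu> \<alpha> = - f \<nu> \<mu> \<alpha>"
    and bianchi: "\<And>\<mu> \<nu> \<rho> \<alpha>. f \<mu> \<nu> (add_mset \<rho> \<alpha>) + f \<nu> \<rho> (add_mset \<mu> \<alpha>) + f \<rho> \<mu> (add_mset \<nu> \<alpha>) = 0"
    and bxf: "\<And>\<mu> \<nu> \<alpha>. bx (f \<mu> \<nu>) \<alpha> = 0"
    and dvf: "\<And>\<mu> \<alpha>. dv (f \<mu>) \<alpha> = 0"
    and bxp: "\<And>\<alpha>. bx p \<alpha> = 0"
  obtains A where "\<And>\<mu> \<alpha>. bx (A \<mu>) \<alpha> = - m\<^sup>2 *\<^sub>R A \<mu> \<alpha>" "\<And>\<alpha>. dv A \<alpha> = 0"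
    "\<And>xs. 2 \<le> length xs \<Longrightarrow> trl (curl A) xs = f (xs ! 0) (xs ! 1) (mset (drop 2 xs))"
    "\<And>xs. xs \<noteq> [] \<Longrightarrow> - m *\<^sub>R trl (symt A) xs = p (mset xs)"
proof -
  define c where "c k = - 1 / (real k + 1)" for k :: nat
  define \<kappa> where "\<kappa> k = - (2 * (real k + 2)) / (m * (real k + 3))" for k :: nat
  \<comment> \<open>\<open>c\<close> makes the curl of \<open>a\<close> equal to \<open>f\<close>; \<open>\<kappa>\<close> compensates the rescaling of the symmetric part by
    \<open>(n + 2) / (2 (n + 1))\<close> in the extension, where \<open>n = k + 1\<close>.\<close>
  define e where "e \<mu> \<alpha> = (\<Sum>\<rho>\<in>UNIV. ml \<rho> (f \<mu> \<rho>) \<alpha>)" for \<mu> \<alpha>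
  define a where "a \<mu> \<alpha> = c (size \<alpha>) *\<^sub>R e \<mu> \<alpha> + \<kappa> (size \<alpha>) *\<^sub>R p (add_mset \<mu> \<alpha>)" for \<mu> \<alpha>
  have f0: "f \<mu> \<mu> \<alpha> = 0" for \<mu> \<alpha>
    by (rule eq_uminus_imp_zero) (rule antisym)
  have bx_e: "bx (e \<mu>) \<alpha> = 0" for \<mu> \<alpha>
  proof -
    have "bx (e \<mu>) \<alpha> = (\<Sum>\<rho>\<in>UNIV. bx (ml \<rho> (f \<mu> \<rho>)) \<alpha>)"
      unfolding e_def[abs_def] by (rule bx_sum)
    also have "\<dots> = 2 *\<^sub>R dv (f \<mu>) \<alpha>"
      by (simp add: bx_ml ext[OF bxf] dv_def scaleR_sum_right)
    finally show ?thesis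
      by (simp add: dvf)
  qed
  have dv_e: "dv e \<alpha> = 0" for \<alpha>
  proof -
    have "dv e \<alpha> = (\<Sum>\<rho>\<in>UNIV. dv (\<lambda>\<mu>. ml \<rho> (f \<mu> \<rho>)) \<alpha>)"
      unfolding e_def[abs_def] dv_def scaleR_sum_right by (rule sum.swap)
    also have "\<dots> = 0"
    proof (intro sum.neutral ballI)
      fix \<rho>
      have "dv (\<lambda>\<mu>. f \<mu> \<rho>) = (\<lambda>\<alpha>. - dv (f \<rho>) \<alpha>)"
        by (simp add: dv_def antisym[of _ \<rho>] sum_negf fun_eq_iff)
      then show "dv (\<lambda>\<mu>. ml \<rho> (f \<mu> \<rho>)) \<alpha> = 0"
        using dv_ml[of \<rho> "\<lambda>\<mu>. f \<mu> \<rho>" \<alpha>] by (simp add: dvf f0)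
    qed
    finally show ?thesis .
  qed
  have bx_a: "bx (a \<mu>) \<alpha> = 0" for \<mu> \<alpha>
  proof -
    have "bx (a \<mu>) \<alpha> = c (size \<alpha> + 2) *\<^sub>R bx (e \<mu>) \<alpha> + \<kappa> (size \<alpha> + 2) *\<^sub>R bx p (add_mset \<mu> \<alpha>)"
      by (simp add: bx_def a_def scaleR_add_right sum.distrib scaleR_sum_right mult.commute add_mset_commute)
    then show ?thesis
      by (simp add: bx_e bxp)
  qed
  have dv_a: "dv a \<alpha> = 0" for \<alpha>
  proof -
    have "dv a \<alpha> = c (size \<alpha> + 1) *\<^sub>R dv e \<alpha> + \<kappa> (size \<alpha> + 1) *\<^sub>R bx p \<alpha>"
      by (simp add: bx_def dv_def a_def scaleR_add_right sum.distrib scaleR_sum_right mult.commute)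
    then show ?thesis
      by (simp add: dv_e bxp)
  qed
  have curl_e: "e \<nu> (add_mset \<mu> \<alpha>) - e \<mu> (add_mset \<nu> \<alpha>) = - ((real (size \<alpha>) + 2) *\<^sub>R f \<mu> \<nu> \<alpha>)" for \<mu> \<nu> \<alpha>
  proof -
    have e_add: "e \<nu> (add_mset \<mu> \<alpha>) = (\<Sum>\<rho>\<in>UNIV. ml \<rho> (sh \<mu> (f \<nu> \<rho>)) \<alpha>) + f \<nu> \<mu> \<alpha>" for \<mu> \<nu>
      by (simp add: e_def sh_ml sum.distrib)
    \<comment> \<open>The Bianchi identity converts the difference of two derivatives into one along
      \<rho>; contracted with the position, this counts the occurrences of \<rho>, and the counts
      add up to the order.\<close>
    have "ml \<rho> (sh \<mu> (f \<nu> \<rho>)) \<alpha> - ml \<rho> (sh \<nu> (f \<mu> \<rho>)) \<alpha> = - (real (count \<alpha> \<rho>) *\<^sub>R f \<mu> \<nu> \<alpha>)" for \<rho>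
    proof (cases "\<rho> \<in># \<alpha>")
      case True
      then obtain \<beta> where "\<alpha> = add_mset \<rho> \<beta>"
        by (metis insert_DiffM)
      moreover have "f \<nu> \<rho> (add_mset \<mu> \<beta>) - f \<mu> \<rho> (add_mset \<nu> \<beta>) = - f \<mu> \<nu> (add_mset \<rho> \<beta>)"
      proof -
        have "f \<nu> \<rho> (add_mset \<mu> \<beta>) - f \<mu> \<rho> (add_mset \<nu> \<beta>) + f \<mu> \<nu> (add_mset \<rho> \<beta>)
            = f \<mu> \<nu> (add_mset \<rho> \<beta>) + f \<nu> \<rho> (add_mset \<mu> \<beta>) + f \<rho> \<mu> (add_mset \<nu> \<beta>)"
          by (subst antisym[of \<rho> \<mu>]) simp
        then show ?thesis
          by (simp only: bianchi eq_neg_iff_add_eq_0)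
      qed
      ultimately show ?thesis
        by (simp add: ml_def sh_def flip: scaleR_diff_right)
    qed (simp add: ml_def not_in_iff)
    then have "(\<Sum>\<rho>\<in>UNIV. ml \<rho> (sh \<mu> (f \<nu> \<rho>)) \<alpha> - ml \<rho> (sh \<nu> (f \<mu> \<rho>)) \<alpha>) = - (real (size \<alpha>) *\<^sub>R f \<mu> \<nu> \<alpha>)"
      by (simp add: sum_negf scaleR_sum_left flip: sum_count)
    then show ?thesis
      using antisym[of \<nu> \<mu> \<alpha>]
      by (simp add: e_add sum_subtractf algebra_simps scaleR_2)
  qed
  have curl_a: "a \<nu> (add_mset \<mu> \<alpha>) - a \<mu> (add_mset \<nu> \<alpha>) = f \<mu> \<nu> \<alpha>" for \<mu> \<nu> \<alpha>
  proof -
    have "a \<nu> (add_mset \<mu> \<alpha>) - a \<mu> (add_mset \<nu> \<alpha>)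
        = c (size \<alpha> + 1) *\<^sub>R (e \<nu> (add_mset \<mu> \<alpha>) - e \<mu> (add_mset \<nu> \<alpha>))"
      by (simp add: a_def scaleR_diff_right add_mset_commute)
    also have "\<dots> = (- (c (size \<alpha> + 1) * (real (size \<alpha>) + 2))) *\<^sub>R f \<mu> \<nu> \<alpha>"
      by (simp add: curl_e)
    also have "- (c (size \<alpha> + 1) * (real (size \<alpha>) + 2)) = 1"
      by (simp add: c_def)
    finally show ?thesis
      by simp
  qed
  have sym_a: "(\<Sum>l<length xs. tens a (swp l xs)) = (real (length xs) * \<kappa> (length xs - 1)) *\<^sub>R p (mset xs)" for xs
  proof -
    \<comment> \<open>Multiplications by coordinates commute and \<open>f\<close> is antisymmetric,
      so \<open>e\<close> does not contribute to the symmetrization.\<close>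
    have "(\<Sum>\<mu>\<in>UNIV. ml \<mu> (e \<mu>) \<alpha>) = 0" for \<alpha>
    proof -
      let ?s = "\<Sum>\<mu>\<in>UNIV. \<Sum>\<rho>\<in>UNIV. ml \<mu> (ml \<rho> (f \<mu> \<rho>)) \<alpha>"
      have "?s = (\<Sum>\<rho>\<in>UNIV. \<Sum>\<mu>\<in>UNIV. ml \<mu> (ml \<rho> (f \<mu> \<rho>)) \<alpha>)"
        by (rule sum.swap)
      also have "\<dots> = (\<Sum>\<rho>\<in>UNIV. \<Sum>\<mu>\<in>UNIV. - ml \<rho> (ml \<mu> (f \<rho> \<mu>)) \<alpha>)"
      proof (intro sum.cong refl)
        fix \<mu> \<rho>
        have "f \<mu> \<rho> = (\<lambda>\<beta>. - 1 *\<^sub>R f \<rho> \<mu> \<beta>)"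
          using antisym[of \<mu> \<rho>] by auto
        then have "ml \<mu> (ml \<rho> (f \<mu> \<rho>)) \<alpha> = - ml \<mu> (ml \<rho> (f \<rho> \<mu>)) \<alpha>"
          by (simp add: ml_def)
        then show "ml \<mu> (ml \<rho> (f \<mu> \<rho>)) \<alpha> = - ml \<rho> (ml \<mu> (f \<rho> \<mu>)) \<alpha>"
          by (simp add: ml_commute)
      qed
      finally have "?s = - ?s"
        by (simp add: sum_negf)
      then have "?s = 0"
        by (rule eq_uminus_imp_zero)
      then show ?thesis
        by (simp add: e_def[abs_def] ml_sum)
    qed
    moreover have "ml \<mu> (a \<mu>) (mset xs) = c (length xs - 1) *\<^sub>R ml \<mu> (e \<mu>) (mset xs)
        + (real (count (mset xs) \<mu>) * \<kappa> (length xs - 1)) *\<^sub>R p (mset xs)" for \<mu>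
    proof (cases "count (mset xs) \<mu> = 0")
      case True
      show ?thesis
        unfolding ml_def True by simp
    next
      case False
      then have "\<mu> \<in># mset xs"
        by (meson not_in_iff)
      then show ?thesis
        by (simp add: ml_def a_def size_Diff_singleton scaleR_add_right mult.commute)
    qed
    moreover have "(\<Sum>l<length xs. tens a (swp l xs)) = (\<Sum>\<mu>\<in>UNIV. ml \<mu> (a \<mu>) (mset xs))"
      by (simp add: sum_ml_nth tens_swp)
    moreover have "(\<Sum>\<mu>\<in>UNIV. real (count (mset xs) \<mu>)) = real (length xs)"
      using sum_count[of "mset xs"] by (simp flip: of_nat_sum)
    ultimately show ?thesis
      by (simp add: sum.distrib flip: scaleR_sum_left scaleR_sum_right sum_distrib_right)
  qed
  obtain A where A: "\<And>\<mu> \<alpha>. bx (A \<mu>) \<alpha> = - m\<^sup>2 *\<^sub>R A \<mu> \<alpha>" "\<And>\<alpha>. dv A \<alpha> = 0"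
    and trl_A: "\<And>xs. xs \<noteq> [] \<Longrightarrow> trl (tens A) xs
       = tens a xs - (1 / (2 * (real (length xs) + 1))) *\<^sub>R (\<Sum>l<length xs. tens a (swp l xs))"
    by (rule proca_extension[of m a]) (use assms(1) dv_a bx_a in auto)
  have mset_swp: "mset (swp l xs) = mset xs" if "l < length xs" for l xs
    unfolding swp_def by (rule mset_permute_list) (rule transpose_permutes[OF that])
  show thesis
  proof (rule that[OF A])
    show "trl (curl A) xs = f (xs ! 0) (xs ! 1) (mset (drop 2 xs))" if "2 \<le> length xs" for xs
    proof -
      have nonempty: "xs \<noteq> []" "swp 1 xs \<noteq> []"
        using that by (auto simp flip: length_0_conv)
      have "trl (curl A) xs = curl a xs"
        using that nonempty sym_a[of "swp 1 xs"] by (simp add: trl_curl trl_A sym_a mset_swp curl_eq)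
      then show ?thesis
        by (simp add: curl_def curl_a)
    qed
    show "- m *\<^sub>R trl (symt A) xs = p (mset xs)" if "xs \<noteq> []" for xs
    proof -
      let ?n = "real (length xs)"
      have n: "?n > 0"
        using that by simp
      have "trl (tens A) (swp l xs) = tens a (swp l xs)
          - (?n * \<kappa> (length xs - 1) / (2 * (?n + 1))) *\<^sub>R p (mset xs)" if "l < length xs" for l
      proof -
        have "swp l xs \<noteq> []"
          using that by (auto simp flip: length_0_conv)
        then show ?thesis
          using that sym_a[of "swp l xs"] by (simp add: trl_A mset_swp)
      qed
      then have "trl (symt A) xs = (1 / ?n) *\<^sub>R (\<Sum>l<length xs. tens a (swp l xs)
          - (?n * \<kappa> (length xs - 1) / (2 * (?n + 1))) *\<^sub>R p (mset xs))"
        unfolding trl_symt by (intro arg_cong2[where f = scaleR] sum.cong) auto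
      also have "\<dots> = (1 / ?n * (?n * \<kappa> (length xs - 1) - ?n * (?n * \<kappa> (length xs - 1) / (2 * (?n + 1))))) *\<^sub>R p (mset xs)"
        unfolding sum_subtractf sym_a by (simp only: sum_constant_scaleR card_lessThan scaleR_scaleR scaleR_diff_left[symmetric])
      also have "1 / ?n * (?n * \<kappa> (length xs - 1) - ?n * (?n * \<kappa> (length xs - 1) / (2 * (?n + 1))))
          = \<kappa> (length xs - 1) * ((?n + 2) / (2 * (?n + 1)))"
        using n by (simp add: field_simps)
      also have "\<kappa> (length xs - 1) = - (2 * (?n + 1)) / (m * (?n + 2))"
        using that by (simp add: \<kappa>_def of_nat_diff Suc_leI algebra_simps)
      also have "- (2 * (?n + 1)) / (m * (?n + 2)) * ((?n + 2) / (2 * (?n + 1))) = - 1 / m"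
        using n assms(1) by (simp add: divide_simps)
      finally show ?thesis
        using assms(1) by simp
    qed
  qed
qed

section \<open>A left inverse of the evaluation of symbols\<close>

section \<open>The algebra of symbols modulo its relations\<close>

lemma (in FA_ideal) commutator_mem:
  assumes "\<And>x y. gen x * gen y - gen y * gen x \<in> J"
  shows "p * q - q * p \<in> J"
proof -
  have gw: "gen x * word ys - word ys * gen x \<in> J" for x ys
  proof (induction ys)
    case (Cons y ys)
    have "gen x * word (y # ys) - word (y # ys) * gen x
        = (gen x * gen y - gen y * gen x) * word ys + gen y * (gen x * word ys - word ys * gen x)"
      by (simp add: word_Cons algebra_simps)
    then show ?case
      using Cons assms by (auto intro: add_mem left_mem right_mem)
  qed simp
  have ww: "word xs * word ys - word ys * word xs \<in> J" for xs ys
  proof (induction xs)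
    case (Cons x xs)
    have "word (x # xs) * word ys - word ys * word (x # xs)
        = gen x * (word xs * word ys - word ys * word xs) + (gen x * word ys - word ys * gen x) * word xs"
      by (simp add: word_Cons algebra_simps)
    then show ?case
      using Cons gw by (auto intro: add_mem left_mem right_mem)
  qed simp
  have wq: "word xs * q - q * word xs \<in> J" for xs
  proof (induction q rule: free_alg_induct)
    case (word c ys)
    have "word xs * (cnst c * word ys) - cnst c * word ys * word xs = cnst c * (word xs * word ys - word ys * word xs)"
      by (simp add: cnst_left_commute right_diff_distrib mult.assoc)
    then show ?case
      using ww by (auto intro: left_mem)
  next
    case (add p q)
    then show ?case
      using add_mem[OF add] by (simp add: algebra_simps)
  qed
  show ?thesis
  proof (induction p rule: free_alg_induct)
    case (word c xs)
    have "cnst c * word xs * q - q * (cnst c * word xs) = cnst c * (word xs * q - q * word xs)"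
      by (simp add: cnst_left_commute right_diff_distrib mult.assoc)
    then show ?case
      using wq by (auto intro: left_mem)
  next
    case (add p q)
    then show ?case
      using add_mem[OF add] by (simp add: algebra_simps)
  qed
qed

interpretation symb_ideal: FA_ideal symb_ideal
  unfolding symb_ideal_def by (rule FA_ideal.intro) (rule Idl_FA_ideal)

lemma symb_ideal_base:
  "g \<in> symb_commutators \<union> symb_symmetries \<union> symb_bianchi \<Longrightarrow> g \<in> symb_ideal"
  unfolding symb_ideal_def by (rule Idl_FA_base)

\<comment> \<open>A type rather than a set of cosets, so that the quotient is a real vector space in
  the sense of the type class and the Proca construction can be carried out with values in
  it.\<close>
quotient_type salg = "symb free_alg" / "\<lambda>p q. p - q \<in> symb_ideal"
  by (intro equivpI reflpI sympI transpI)
    (simp, erule symb_ideal.diff_swap, erule (1) symb_ideal.diff_trans)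

instantiation salg :: comm_ring_1
begin

lift_definition zero_salg :: salg is 0 .
lift_definition one_salg :: salg is 1 .
lift_definition plus_salg :: "salg \<Rightarrow> salg \<Rightarrow> salg" is "(+)"
  by (metis add_diff_add symb_ideal.add_mem)
lift_definition uminus_salg :: "salg \<Rightarrow> salg" is uminus
  by (metis minus_diff_minus symb_ideal.minus_mem)
lift_definition minus_salg :: "salg \<Rightarrow> salg \<Rightarrow> salg" is minus
proof -
  fix p p' q q' :: "symb free_alg"
  assume "p - p' \<in> symb_ideal" "q - q' \<in> symb_ideal"
  then show "p - q - (p' - q') \<in> symb_ideal"
    using symb_ideal.diff_mem[of "p - p'" "q - q'"] by (simp add: algebra_simps)
qed
lift_definition times_salg :: "salg \<Rightarrow> salg \<Rightarrow> salg" is times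
  by (rule symb_ideal.mult_cong)

instance
proof
  \<comment> \<open>No relation has a constant term, so setting all symbols to \<open>0\<close>
    separates \<open>1\<close> from the ideal.\<close>
  have "1 \<notin> symb_ideal"
  proof
    interpret z: central_hom "\<lambda>c :: complex. c"
      by standard auto
    assume "1 \<in> symb_ideal"
    then have one: "1 \<in> Idl\<^bsub>FA\<^esub> (symb_commutators \<union> symb_symmetries \<union> symb_bianchi)"
      unfolding symb_ideal_def .
    have "z.alg_ext (\<lambda>_. 0) (1 :: symb free_alg) = 0"
      by (rule z.alg_ext_Idl[OF _ one])
        (auto simp: symb_commutators_def symb_symmetries_def symb_bianchi_def traces_def
          z.word_ext_add z.word_ext_diff z.word_ext_sum z.alg_ext_mult)
    then show False
      by simp
  qed
  then show "(0 :: salg) \<noteq> 1"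
    by transfer (auto dest: symb_ideal.minus_mem)
  show "a * b = b * a" for a b :: salg
    by transfer (rule symb_ideal.commutator_mem, rule symb_ideal_base, auto simp: symb_commutators_def)
qed (transfer; simp add: algebra_simps)+

end

definition sc :: "complex \<Rightarrow> salg" where
  "sc c = abs_salg (cnst c)"

lemma abs_salg_eq_iff: "abs_salg p = abs_salg q \<longleftrightarrow> p - q \<in> symb_ideal"
  by (rule salg.abs_eq_iff)

lemma abs_salg_eq_0_iff: "abs_salg p = 0 \<longleftrightarrow> p \<in> symb_ideal"
  using abs_salg_eq_iff[of p 0] by (simp add: zero_salg_def)

lemma abs_salg_add: "abs_salg (p + q) = abs_salg p + abs_salg q"
  by (simp add: plus_salg.abs_eq)

lemma abs_salg_mult: "abs_salg (p * q) = abs_salg p * abs_salg q"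
  by (simp add: times_salg.abs_eq)

lemma abs_salg_1: "abs_salg 1 = 1"
  by (simp add: one_salg.abs_eq)

lemma abs_salg_0: "abs_salg 0 = 0"
  by (simp add: zero_salg.abs_eq)

lemma abs_salg_sum: "abs_salg (\<Sum>i\<in>I. f i) = (\<Sum>i\<in>I. abs_salg (f i))"
  by (induction I rule: infinite_finite_induct) (simp_all add: abs_salg_add abs_salg_0)

interpretation sc: central_hom sc
  by standard (simp_all add: sc_def cnst_add cnst_mult abs_salg_add abs_salg_mult abs_salg_1 mult.commute)

lemma abs_salg_cnst: "abs_salg (cnst c) = sc c"
  by (simp add: sc_def)

instantiation salg :: real_vector
begin

definition scaleR_salg :: "real \<Rightarrow> salg \<Rightarrow> salg" where
  "scaleR_salg r x = sc (of_real r) * x"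

instance
  by standard (simp_all add: scaleR_salg_def sc.add sc.mult sc.one algebra_simps)

end

lemma abs_salg_scaleR: "abs_salg (r *\<^sub>R p) = r *\<^sub>R abs_salg p"
  by (simp add: scaleR_salg_def abs_salg_cnst abs_salg_mult flip: cnst_of_real)

lemma sc_alg_ext_scaleR: "sc.alg_ext f (r *\<^sub>R p) = r *\<^sub>R sc.alg_ext f p"
  by (simp add: scaleR_salg_def sc.word_ext_cnst_mult flip: cnst_of_real)

lemma eta_sum:
  "(\<Sum>\<mu>\<in>UNIV. \<Sum>\<nu>\<in>UNIV. cnst (eta \<mu> \<nu>) * f \<mu> \<nu>) = (\<Sum>\<mu>\<in>UNIV. sg \<mu> *\<^sub>R f \<mu> \<mu>)"
  by (simp add: eta_eq_reta cnst_of_real reta_sum)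

lemma abs_salg_relation: "g \<in> symb_symmetries \<union> symb_bianchi \<Longrightarrow> abs_salg g = 0"
  by (subst abs_salg_eq_0_iff) (rule symb_ideal_base, auto)

lemma abs_salg_SF_antisym: "abs_salg (gen (SF \<mu> \<nu> \<rho>s)) = - abs_salg (gen (SF \<nu> \<mu> \<rho>s))"
proof -
  have "abs_salg (gen (SF \<mu> \<nu> \<rho>s) + gen (SF \<nu> \<mu> \<rho>s)) = 0"
    by (rule abs_salg_relation) (auto simp: symb_symmetries_def)
  then show ?thesis
    by (simp add: abs_salg_add eq_neg_iff_add_eq_0)
qed

lemma abs_salg_SF_cong:
  assumes "mset \<rho>s = mset \<rho>s'"
  shows "abs_salg (gen (SF \<mu> \<nu> \<rho>s)) = abs_salg (gen (SF \<mu> \<nu> \<rho>s'))"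
  unfolding abs_salg_eq_iff by (rule symb_ideal_base) (use assms in \<open>auto simp: symb_symmetries_def\<close>)

lemma abs_salg_SPhi_cong:
  assumes "mset (\<mu> # \<nu>s) = mset (\<mu>' # \<nu>s')"
  shows "abs_salg (gen (SPhi \<mu> \<nu>s)) = abs_salg (gen (SPhi \<mu>' \<nu>s'))"
  unfolding abs_salg_eq_iff
  by (rule symb_ideal_base) (use assms in \<open>unfold symb_symmetries_def, blast\<close>)

lemma abs_salg_bianchi:
  "abs_salg (gen (SF \<mu> \<nu> (\<rho> # \<sigma>s))) + abs_salg (gen (SF \<nu> \<rho> (\<mu> # \<sigma>s))) + abs_salg (gen (SF \<rho> \<mu> (\<nu> # \<sigma>s))) = 0"
proof -
  have "abs_salg (gen (SF \<mu> \<nu> (\<rho> # \<sigma>s)) + gen (SF \<nu> \<rho> (\<mu> # \<sigma>s)) + gen (SF \<rho> \<mu> (\<nu> # \<sigma>s))) = 0"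
    by (rule abs_salg_relation) (unfold symb_bianchi_def, blast)
  then show ?thesis
    by (simp add: abs_salg_add)
qed

lemma abs_salg_SF_trace:
  assumes "i < j" "j < length xs"
  shows "(\<Sum>\<mu>\<in>UNIV. sg \<mu> *\<^sub>R abs_salg (gen (SF (xs[i := \<mu>, j := \<mu>] ! 0) (xs[i := \<mu>, j := \<mu>] ! 1)
    (drop 2 (xs[i := \<mu>, j := \<mu>]))))) = 0"
proof -
  have "abs_salg (\<Sum>\<mu>\<in>UNIV. \<Sum>\<nu>\<in>UNIV. cnst (eta \<mu> \<nu>) * gen (SF (xs[i := \<mu>, j := \<nu>] ! 0)
      (xs[i := \<mu>, j := \<nu>] ! 1) (drop 2 (xs[i := \<mu>, j := \<nu>])))) = 0"
  proof (rule abs_salg_relation, rule UnI1)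
    have n: "length xs \<in> {2..}"
      using assms by auto
    have "(\<Sum>\<mu>\<in>UNIV. \<Sum>\<nu>\<in>UNIV. cnst (eta \<mu> \<nu>) * gen (SF (xs[i := \<mu>, j := \<nu>] ! 0)
        (xs[i := \<mu>, j := \<nu>] ! 1) (drop 2 (xs[i := \<mu>, j := \<nu>])))) \<in> traces (\<lambda>xs. gen (SF (xs ! 0) (xs ! 1) (drop 2 xs))) (length xs)"
      unfolding traces_def using assms
      by (intro CollectI exI[of _ xs] exI[of _ i] exI[of _ j] conjI refl)
    then show "(\<Sum>\<mu>\<in>UNIV. \<Sum>\<nu>\<in>UNIV. cnst (eta \<mu> \<nu>) * gen (SF (xs[i := \<mu>, j := \<nu>] ! 0)
        (xs[i := \<mu>, j := \<nu>] ! 1) (drop 2 (xs[i := \<mu>, j := \<nu>])))) \<in> symb_symmetries"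
      unfolding symb_symmetries_def
      by - (rule UnI1, rule UnI2, rule UN_I[OF n])
  qed
  then show ?thesis
    by (simp only: eta_sum abs_salg_sum abs_salg_scaleR)
qed

lemma abs_salg_SPhi_trace:
  assumes "i < j" "j < length xs"
  shows "(\<Sum>\<mu>\<in>UNIV. sg \<mu> *\<^sub>R abs_salg (gen (SPhi (hd (xs[i := \<mu>, j := \<mu>])) (tl (xs[i := \<mu>, j := \<mu>]))))) = 0"
proof -
  have "abs_salg (\<Sum>\<mu>\<in>UNIV. \<Sum>\<nu>\<in>UNIV. cnst (eta \<mu> \<nu>) *
      gen (SPhi (hd (xs[i := \<mu>, j := \<nu>])) (tl (xs[i := \<mu>, j := \<nu>])))) = 0"
  proof (rule abs_salg_relation, rule UnI1)
    have n: "length xs \<in> {1..}"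
      using assms by auto
    have "(\<Sum>\<mu>\<in>UNIV. \<Sum>\<nu>\<in>UNIV. cnst (eta \<mu> \<nu>) *
        gen (SPhi (hd (xs[i := \<mu>, j := \<nu>])) (tl (xs[i := \<mu>, j := \<nu>])))) \<in> traces (\<lambda>xs. gen (SPhi (hd xs) (tl xs))) (length xs)"
      unfolding traces_def using assms
      by (intro CollectI exI[of _ xs] exI[of _ i] exI[of _ j] conjI refl)
    then show "(\<Sum>\<mu>\<in>UNIV. \<Sum>\<nu>\<in>UNIV. cnst (eta \<mu> \<nu>) *
        gen (SPhi (hd (xs[i := \<mu>, j := \<nu>])) (tl (xs[i := \<mu>, j := \<nu>])))) \<in> symb_symmetries"
      unfolding symb_symmetries_def
      by - (rule UnI2, rule UN_I[OF n])
  qed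
  then show ?thesis
    by (simp only: eta_sum abs_salg_sum abs_salg_scaleR)
qed

lemma symbol_field:
  fixes m :: real
  assumes "m \<noteq> 0"
  obtains A :: "4 \<Rightarrow> 4 multiset \<Rightarrow> salg" where
    "\<And>\<mu> \<alpha>. bx (A \<mu>) \<alpha> = - m\<^sup>2 *\<^sub>R A \<mu> \<alpha>" "\<And>\<alpha>. dv A \<alpha> = 0"
    "\<And>\<mu> \<nu> \<rho>s. trl (curl A) (\<mu> # \<nu> # \<rho>s) = abs_salg (gen (SF \<mu> \<nu> \<rho>s))"
    "\<And>\<mu> \<nu>s. - m *\<^sub>R trl (symt A) (\<mu> # \<nu>s) = abs_salg (gen (SPhi \<mu> \<nu>s))"
proof -
  note main = that
  \<comment> \<open>Symbols carry lists while jets carry multisets. Any ordering of the multiset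
    will do, because the symmetry relations identify the resulting symbols.\<close>
  define lst :: "4 multiset \<Rightarrow> 4 list" where "lst \<alpha> = (SOME xs. mset xs = \<alpha>)" for \<alpha>
  have lst: "mset (lst \<alpha>) = \<alpha>" for \<alpha>
    unfolding lst_def by (rule someI_ex) (rule ex_mset)
  define f where "f \<mu> \<nu> \<alpha> = abs_salg (gen (SF \<mu> \<nu> (lst \<alpha>)))" for \<mu> \<nu> \<alpha>
  define p where "p \<alpha> = abs_salg (gen (SPhi (hd (lst \<alpha>)) (tl (lst \<alpha>))))" for \<alpha>
  have f: "f \<mu> \<nu> (mset \<rho>s) = abs_salg (gen (SF \<mu> \<nu> \<rho>s))" for \<mu> \<nu> \<rho>s
    unfolding f_def by (rule abs_salg_SF_cong) (rule lst)
  have f': "f \<mu> \<nu> \<alpha> = abs_salg (gen (SF \<mu> \<nu> (lst \<alpha>)))"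
    "f \<mu> \<nu> (add_mset \<rho> \<alpha>) = abs_salg (gen (SF \<mu> \<nu> (\<rho> # lst \<alpha>)))"
    "f \<mu> \<nu> (add_mset \<rho> (add_mset \<sigma> \<alpha>)) = abs_salg (gen (SF \<mu> \<nu> (\<rho> # \<sigma> # lst \<alpha>)))" for \<mu> \<nu> \<rho> \<sigma> \<alpha>
    by (simp_all add: lst flip: f)
  have p: "p (mset (\<mu> # \<nu>s)) = abs_salg (gen (SPhi \<mu> \<nu>s))" for \<mu> \<nu>s
  proof -
    have nonempty: "lst (mset (\<mu> # \<nu>s)) \<noteq> []"
      using lst[of "mset (\<mu> # \<nu>s)"] by auto
    show ?thesis
      unfolding p_def by (rule abs_salg_SPhi_cong) (simp only: list.collapse[OF nonempty] lst)
  qed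
  show thesis
  proof (rule proca_field[OF assms, of f p])
    show "f \<mu> \<nu> \<alpha> = - f \<nu> \<mu> \<alpha>" for \<mu> \<nu> \<alpha>
      unfolding f'(1) by (rule abs_salg_SF_antisym)
    show "f \<mu> \<nu> (add_mset \<rho> \<alpha>) + f \<nu> \<rho> (add_mset \<mu> \<alpha>) + f \<rho> \<mu> (add_mset \<nu> \<alpha>) = 0" for \<mu> \<nu> \<rho> \<alpha>
      unfolding f'(2) by (rule abs_salg_bianchi)
    \<comment> \<open>The entries \<open>0\<close> are placeholders overwritten by the trace.
      Positions 2 and 3 are both derivative indices and give the wave operator; below, positions 1
      and 2 give the divergence.\<close>
    show "bx (f \<mu> \<nu>) \<alpha> = 0" for \<mu> \<nu> \<alpha>
      using abs_salg_SF_trace[of 2 3 "\<mu> # \<nu> # 0 # 0 # lst \<alpha>"]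
      by (simp add: bx_def f'(3) numeral_2_eq_2 numeral_3_eq_3)
    show "dv (f \<mu>) \<alpha> = 0" for \<mu> \<alpha>
      using abs_salg_SF_trace[of 1 2 "\<mu> # 0 # 0 # lst \<alpha>"]
      by (simp add: dv_def f'(2) numeral_2_eq_2)
    show "bx p \<alpha> = 0" for \<alpha>
    proof -
      have "p (add_mset \<mu> (add_mset \<mu> \<alpha>)) = abs_salg (gen (SPhi \<mu> (\<mu> # lst \<alpha>)))" for \<mu>
        using p[of \<mu> "\<mu> # lst \<alpha>"] by (simp add: lst)
      then show ?thesis
        using abs_salg_SPhi_trace[of 0 1 "0 # 0 # lst \<alpha>"] by (simp add: bx_def)
    qed
    show thesis if "\<And>\<mu> \<alpha>. bx (A \<mu>) \<alpha> = - m\<^sup>2 *\<^sub>R A \<mu> \<alpha>" "\<And>\<alpha>. dv A \<alpha> = 0"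
      "\<And>xs. 2 \<le> length xs \<Longrightarrow> trl (curl A) xs = f (xs ! 0) (xs ! 1) (mset (drop 2 xs))"
      "\<And>xs. xs \<noteq> [] \<Longrightarrow> - m *\<^sub>R trl (symt A) xs = p (mset xs)" for A
    proof (rule main[OF that(1,2)])
      show "trl (curl A) (\<mu> # \<nu> # \<rho>s) = abs_salg (gen (SF \<mu> \<nu> \<rho>s))" for \<mu> \<nu> \<rho>s
        using that(3)[of "\<mu> # \<nu> # \<rho>s"] by (simp add: f)
      show "- m *\<^sub>R trl (symt A) (\<mu> # \<nu>s) = abs_salg (gen (SPhi \<mu> \<nu>s))" for \<mu> \<nu>s
        using that(4)[of "\<mu> # \<nu>s"] by (simp only: p) simp
    qed
  qed
qed

subsection \<open>Evaluation of symbols and its left inverse\<close>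

abbreviation Vg :: "4 \<Rightarrow> 4 multiset \<Rightarrow> jet free_alg" where
  "Vg \<mu> \<alpha> \<equiv> gen (V \<mu>, \<alpha>)"

lemma F_free_eq: "F_free (xs ! 0) (xs ! 1) (drop 2 xs) = curl Vg xs"
  by (simp add: F_free_def curl_def)

lemma g_free_eq: "g_free xs = symt Vg xs"
  using cnst_of_real[of "1 / real (length xs)"] by (simp add: g_free_def symt_def)

lemma phi_free_eq: "phi_free m xs = gen (Phi, mset xs) - m *\<^sub>R symt Vg xs"
  by (simp add: phi_free_def g_free_eq cnst_of_real)

text \<open>Representatives of the classes \<open>symb_val\<close> in the free algebra, which make
  the evaluation a homomorphism of free algebras before any quotient is taken.\<close>

fun ev_gen :: "real \<Rightarrow> symb \<Rightarrow> jet free_alg" where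
  "ev_gen m (SF \<mu> \<nu> \<rho>s) = trl (curl Vg) (\<mu> # \<nu> # \<rho>s)"
| "ev_gen m (SPhi \<mu> \<nu>s) = trl (phi_free m) (\<mu> # \<nu>s)"

abbreviation ev :: "real \<Rightarrow> symb free_alg \<Rightarrow> jet free_alg" where
  "ev m \<equiv> free_hom (ev_gen m)"

lemma to_symb_exists:
  fixes m :: real
  assumes "m \<noteq> 0"
  obtains h :: "jet \<Rightarrow> salg" where "\<And>p. p \<in> shell_ideal m \<Longrightarrow> sc.alg_ext h p = 0"
    "\<And>p. sc.alg_ext h (dQ_free m p) = 0" "\<And>q. sc.alg_ext h (ev m q) = abs_salg q"
proof (rule symbol_field[OF assms])
  fix A assume A: "\<And>\<mu> \<alpha>. bx (A \<mu>) \<alpha> = - m\<^sup>2 *\<^sub>R A \<mu> \<alpha>" "\<And>\<alpha>. dv A \<alpha> = 0"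
    "\<And>\<mu> \<nu> \<rho>s. trl (curl A) (\<mu> # \<nu> # \<rho>s) = abs_salg (gen (SF \<mu> \<nu> \<rho>s))"
    "\<And>\<mu> \<nu>s. - m *\<^sub>R trl (symt A) (\<mu> # \<nu>s) = abs_salg (gen (SPhi \<mu> \<nu>s))"
  define h where "h x = (case x of (V \<mu>, \<alpha>) \<Rightarrow> A \<mu> \<alpha> | _ \<Rightarrow> 0)" for x
  have h: "h (V \<mu>, \<alpha>) = A \<mu> \<alpha>" "h (Phi, \<alpha>) = 0" "h (U, \<alpha>) = 0" "h (Ut, \<alpha>) = 0" for \<mu> \<alpha>
    by (simp_all add: h_def)
  \<comment> \<open>Odd generators vanish, so the graded commutators reduce to ordinary ones, and
    these vanish in the commutative target.\<close>
  have h_odd: "h x = 0" if "jet_sign x = - 1" for x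
    using that by (cases x; cases "fst x") (auto simp: jet_sign_def h split: if_splits)
  let ?h = "sc.alg_ext h"
  note hom = sc.word_ext_add sc.word_ext_diff sc.word_ext_minus sc.word_ext_sum sc_alg_ext_scaleR sc.alg_ext_mult
  have trl_hom: "?h (trl T xs) = trl (\<lambda>y. ?h (T y)) xs" for T xs
    by (simp add: trl_def hom)
  show thesis
  proof (rule that)
    show "?h p = 0" if "p \<in> shell_ideal m" for p
      using that unfolding shell_ideal_def
    proof (rule sc.alg_ext_Idl[rotated])
      fix g assume "g \<in> graded_commutators \<union> mass_shell m"
      then show "?h g = 0"
      proof
        assume "g \<in> graded_commutators"
        then obtain x y where "g = gen x * gen y
            - cnst (if jet_sign x = - 1 \<and> jet_sign y = - 1 then - 1 else 1) * gen y * gen x"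
          by (auto simp: graded_commutators_def)
        then show ?thesis
          by (auto simp: hom h_odd sc.one mult.commute)
      next
        assume "g \<in> mass_shell m"
        then obtain y \<alpha> where "g = (\<Sum>\<mu>\<in>UNIV. sg \<mu> *\<^sub>R gen (y, add_mset \<mu> (add_mset \<mu> \<alpha>))) + m\<^sup>2 *\<^sub>R gen (y, \<alpha>)"
          by (auto simp: mass_shell_def eta_sum simp flip: cnst_of_real)
        then have "?h g = (\<Sum>\<mu>\<in>UNIV. sg \<mu> *\<^sub>R h (y, add_mset \<mu> (add_mset \<mu> \<alpha>))) + m\<^sup>2 *\<^sub>R h (y, \<alpha>)"
          by (simp add: hom)
        then show ?thesis
          using A(1) by (cases y) (simp_all add: h bx_def)
      qed
    qed
    show "?h (dQ_free m p) = 0" for p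
    proof -
      \<comment> \<open>On generators \<open>d_Q\<close> produces multiples of jets of
        \<open>u\<close>, which go to \<open>0\<close>, or of jets of \<open>C\<close>, whose image
        is the divergence of \<open>A\<close>. Every term of the Leibniz expansion contains such a
        factor.\<close>
      have gen: "?h (dQ_jet m x) = 0" for x
      proof (cases x)
        case (Pair y \<alpha>)
        then show ?thesis
          using A(2)[of \<alpha>] by (cases y) (simp_all add: h hom eta_sum dv_def)
      qed
      have "?h (derivation_word jet_sign (dQ_jet m) xs) = 0" for xs
        by (induction xs) (simp_all add: hom gen)
      then show ?thesis
        unfolding dQ_free_def
        by (induction p rule: free_alg_induct)
          (simp_all add: derivation_add derivation_cnst_mult hom, simp add: derivation_eq)
    qed
    show "?h (ev m q) = abs_salg q" for q
    proof -
      have gen: "?h (ev_gen m s) = abs_salg (gen s)" for s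
      proof (cases s)
        case (SF \<mu> \<nu> \<rho>s)
        have "?h (curl Vg y) = curl A y" for y
          by (simp add: curl_def hom h)
        then show ?thesis
          by (simp add: SF trl_hom A(3))
      next
        case (SPhi \<mu> \<nu>s)
        have "?h (phi_free m y) = - m *\<^sub>R symt A y" for y
          by (simp add: phi_free_eq symt_def hom h)
        then show ?thesis
          using A(4)[of \<mu> \<nu>s] by (simp only: SPhi ev_gen.simps trl_hom trl_scaleR)
      qed
      have "?h (ev m (word xs)) = abs_salg (word xs)" for xs
        by (induction xs) (simp_all add: word_Cons cnst.alg_ext_mult hom gen abs_salg_mult abs_salg_1
            del: cnst.word_ext_word)
      then show ?thesis
        by (induction q rule: free_alg_induct)
          (simp_all add: cnst.word_ext_add cnst.word_ext_cnst_mult hom abs_salg_add abs_salg_mult abs_salg_cnst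
            del: cnst.word_ext_word)
    qed
  qed
qed

section \<open>Odd derivations and their descent to the mass shell\<close>

section \<open>Odd derivations of the free algebra of jets\<close>

lemma jet_sign_cases: "jet_sign x = 1 \<or> jet_sign x = - 1"
  by (simp add: jet_sign_def)

lemma jet_sign_square [simp]: "jet_sign x * jet_sign x = 1"
  using jet_sign_cases[of x] by auto

text \<open>Both \<open>d_Q\<close> and the homotopy send generators to linear elements of opposite
  parity. The parameter is the sign by which \<open>twist\<close> acts on them.\<close>

inductive_set lin :: "complex \<Rightarrow> jet free_alg set" for s where
  gen: "jet_sign y = s \<Longrightarrow> gen y \<in> lin s"
| zero: "0 \<in> lin s"
| add: "p \<in> lin s \<Longrightarrow> q \<in> lin s \<Longrightarrow> p + q \<in> lin s"
| cnst: "p \<in> lin s \<Longrightarrow> cnst c * p \<in> lin s"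

lemma lin_sum: "(\<And>i. i \<in> I \<Longrightarrow> f i \<in> lin s) \<Longrightarrow> sum f I \<in> lin s"
  by (induction I rule: infinite_finite_induct) (auto intro: lin.intros)

lemma lin_scaleR: "p \<in> lin s \<Longrightarrow> r *\<^sub>R p \<in> lin s"
  by (simp flip: cnst_of_real add: lin.cnst)

lemma twist_lin: "p \<in> lin s \<Longrightarrow> twist jet_sign p = cnst s * p"
proof (induction rule: lin.induct)
  case (cnst p c)
  then show ?case
    by (simp add: cnst.word_ext_cnst_mult) (rule cnst_left_commute)
qed (simp_all add: cnst.word_ext_add distrib_left)

lemma twist_twist: "twist jet_sign (twist jet_sign p) = p"
proof -
  have "twist jet_sign (twist jet_sign (word xs)) = word xs" for xs
    by (induction xs)
      (simp_all add: word_Cons cnst.alg_ext_mult cnst.word_ext_cnst_mult del: cnst.word_ext_word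
         flip: cnst_mult mult.assoc)
  then show ?thesis
    by (induction p rule: free_alg_induct)
      (simp_all add: cnst.word_ext_add cnst.word_ext_cnst_mult del: cnst.word_ext_word)
qed

lemma derivation_cnst [simp]: "derivation s d (cnst c) = 0"
  using derivation_cnst_mult[of s d c 1] by simp

locale odd_derivation =
  fixes d :: "jet \<Rightarrow> jet free_alg"
  assumes odd: "d x \<in> lin (- jet_sign x)"
begin

abbreviation der :: "jet free_alg \<Rightarrow> jet free_alg" where
  "der \<equiv> derivation jet_sign d"

lemma twist_der: "twist jet_sign (der p) = - der (twist jet_sign p)"
proof -
  have "twist jet_sign (der (word xs)) = - der (twist jet_sign (word xs))" for xs
  proof (induction xs)
    case (Cons x xs)
    have "twist jet_sign (der (word (x # xs)))
        = cnst (- jet_sign x) * d x * twist jet_sign (word xs)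
          + cnst (jet_sign x) * (cnst (jet_sign x) * gen x) * twist jet_sign (der (word xs))"
      by (simp add: word_Cons derivation_mult cnst.word_ext_add cnst.alg_ext_mult twist_lin[OF odd]
          del: cnst.word_ext_word)
    moreover have "der (twist jet_sign (word (x # xs)))
        = cnst (jet_sign x) * (d x * twist jet_sign (word xs)
          + cnst (jet_sign x) * gen x * der (twist jet_sign (word xs)))"
      by (simp add: word_Cons derivation_mult derivation_cnst_mult cnst.alg_ext_mult mult.assoc
          del: cnst.word_ext_word)
    ultimately show ?case
      using Cons.IH by (simp add: cnst_minus distrib_left mult.assoc del: cnst.word_ext_word)
  qed simp
  then show ?thesis
    by (induction p rule: free_alg_induct)
      (simp_all add: derivation_add derivation_cnst_mult cnst.word_ext_add cnst.word_ext_cnst_mult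
        del: cnst.word_ext_word)
qed

end

definition anticomm :: "(jet \<Rightarrow> jet free_alg) \<Rightarrow> (jet \<Rightarrow> jet free_alg) \<Rightarrow> jet free_alg \<Rightarrow> jet free_alg" where
  "anticomm d e p = derivation jet_sign d (derivation jet_sign e p) + derivation jet_sign e (derivation jet_sign d p)"

lemma anticomm_add: "anticomm d e (p + q) = anticomm d e p + anticomm d e q"
  by (simp add: anticomm_def derivation_add)

lemma anticomm_diff: "anticomm d e (p - q) = anticomm d e p - anticomm d e q"
  by (simp add: anticomm_def derivation_diff)

lemma anticomm_cnst_mult: "anticomm d e (cnst c * p) = cnst c * anticomm d e p"
  by (simp add: anticomm_def derivation_cnst_mult distrib_left)

lemma anticomm_scaleR: "anticomm d e (r *\<^sub>R p) = r *\<^sub>R anticomm d e p"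
  by (simp flip: cnst_of_real add: anticomm_cnst_mult)

lemma anticomm_sum: "anticomm d e (\<Sum>i\<in>I. f i) = (\<Sum>i\<in>I. anticomm d e (f i))"
  by (simp add: anticomm_def derivation_sum sum.distrib)

text \<open>The parity automorphism anticommutes with odd derivations, so the mixed terms of the two
  Leibniz expansions cancel: the result is an even derivation, determined by its values on
  generators.\<close>

lemma anticomm_mult:
  assumes "odd_derivation d" "odd_derivation e"
  shows "anticomm d e (p * q) = anticomm d e p * q + p * anticomm d e q"
  by (simp add: anticomm_def derivation_mult derivation_add twist_twist
      odd_derivation.twist_der[OF assms(1)] odd_derivation.twist_der[OF assms(2)] algebra_simps)

lemma anticomm_1: "anticomm d e 1 = 0"
  by (simp add: anticomm_def)

lemma anticomm_mem:
  assumes J: "FA_ideal J" and "odd_derivation d" "odd_derivation e" "\<And>x. anticomm d e (gen x) \<in> J"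
  shows "anticomm d e p \<in> J"
proof -
  interpret FA_ideal J
    by (rule J)
  have "anticomm d e (word xs) \<in> J" for xs
    by (induction xs)
      (auto simp: word_Cons anticomm_1 anticomm_mult[OF assms(2,3)] intro: add_mem left_mem right_mem assms(4))
  then show ?thesis
    by (induction p rule: free_alg_induct)
      (auto simp: anticomm_add anticomm_cnst_mult intro: add_mem left_mem)
qed

section \<open>The mass shell\<close>

interpretation shell: FA_ideal "shell_ideal m" for m
  unfolding shell_ideal_def by (rule FA_ideal.intro) (rule Idl_FA_ideal)

lemma shell_base: "g \<in> graded_commutators \<union> mass_shell m \<Longrightarrow> g \<in> shell_ideal m"
  unfolding shell_ideal_def by (rule Idl_FA_base)

definition comm_sign :: "complex \<Rightarrow> complex \<Rightarrow> complex" where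
  "comm_sign s t = (if s = - 1 \<and> t = - 1 then - 1 else 1)"

lemma shell_commute_gen: "gen x * gen y - cnst (comm_sign (jet_sign x) (jet_sign y)) * gen y * gen x \<in> shell_ideal m"
  by (rule shell_base, rule UnI1) (unfold graded_commutators_def comm_sign_def, blast)

text \<open>Differentiating a commutator of generators replaces one of them by a linear element,
  hence graded commutativity is needed in this generality.\<close>

lemma shell_commute:
  assumes "p \<in> lin s" "q \<in> lin t"
  shows "p * q - cnst (comm_sign s t) * q * p \<in> shell_ideal m"
  using assms(1)
proof induction
  case (gen x)
  show ?case
    using assms(2)
  proof induction
    case (gen y)
    then show ?case
      using shell_commute_gen[of x y] \<open>jet_sign x = s\<close> by simp
  next
    case (add p q)
    then show ?case
      using shell.add_mem[OF add.IH] by (simp add: algebra_simps)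
  next
    case (cnst p c)
    then show ?case
      using shell.left_mem[OF cnst.IH, of "cnst c"]
      by (simp only: right_diff_distrib cnst_left_commute[of _ c] mult.assoc)
  qed simp
next
  case (add p p')
  then show ?case
    using shell.add_mem[OF add.IH] by (simp add: algebra_simps)
next
  case (cnst p c)
  then show ?case
    using shell.left_mem[OF cnst.IH, of "cnst c"]
    by (simp only: right_diff_distrib cnst_left_commute[of _ c] mult.assoc)
qed simp

definition kg :: "real \<Rightarrow> field \<Rightarrow> 4 multiset \<Rightarrow> jet free_alg" where
  "kg m y \<alpha> = (\<Sum>\<mu>\<in>UNIV. sg \<mu> *\<^sub>R gen (y, add_mset \<mu> (add_mset \<mu> \<alpha>))) + m\<^sup>2 *\<^sub>R gen (y, \<alpha>)"

lemma kg_eq: "(\<Sum>\<mu>\<in>UNIV. \<Sum>\<nu>\<in>UNIV. cnst (eta \<mu> \<nu>) * gen (y, add_mset \<mu> (add_mset \<nu> \<alpha>)))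
    + cnst ((of_real m)\<^sup>2) * gen (y, \<alpha>) = kg m y \<alpha>"
  by (simp add: kg_def eta_sum flip: cnst_of_real)

lemma mass_shell_eq: "mass_shell m = {kg m y \<alpha> | y \<alpha>. True}"
  by (simp add: mass_shell_def kg_eq)

lemma kg_mem: "kg m y \<alpha> \<in> shell_ideal m"
  by (rule shell_base) (auto simp: mass_shell_eq)

lemma derivation_scaleR: "derivation s d (r *\<^sub>R p) = r *\<^sub>R derivation s d p"
  by (simp flip: cnst_of_real add: derivation_cnst_mult)

text \<open>A derivation sends a graded commutator to a sum of two graded commutators of linear
  elements, so only its values on the Klein-Gordon relations depend on the derivation at
  hand.\<close>

lemma (in odd_derivation) der_shell:
  assumes kg: "\<And>y \<alpha>. der (kg m y \<alpha>) \<in> shell_ideal m" and "p \<in> shell_ideal m"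
  shows "der p \<in> shell_ideal m"
  using assms(2) unfolding shell_ideal_def
proof (rule derivation_Idl[rotated 2])
  fix g assume g: "g \<in> graded_commutators \<union> mass_shell m"
  show "derivation jet_sign d g \<in> Idl\<^bsub>FA\<^esub> (graded_commutators \<union> mass_shell m)"
    unfolding shell_ideal_def[symmetric] using g
  proof
    assume "g \<in> graded_commutators"
    then obtain x y where g: "g = gen x * gen y - cnst (comm_sign (jet_sign x) (jet_sign y)) * gen y * gen x"
      by (auto simp: graded_commutators_def comm_sign_def)
    let ?s = "jet_sign x" let ?t = "jet_sign y"
    have sign: "comm_sign (- ?s) ?t = comm_sign ?s ?t * ?t" "?s * comm_sign ?s (- ?t) = comm_sign ?s ?t"
      using jet_sign_cases[of x] jet_sign_cases[of y] by (auto simp: comm_sign_def)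
    have "cnst ?s * (cnst (comm_sign ?s (- ?t)) * z) = cnst (comm_sign ?s ?t) * z" for z :: "jet free_alg"
      by (simp only: mult.assoc[symmetric] cnst_mult[symmetric] sign)
    moreover have "der g = d x * gen y + cnst ?s * gen x * d y
        - cnst (comm_sign ?s ?t) * (d y * gen x + cnst ?t * gen y * d x)"
      by (simp add: g derivation_diff derivation_mult cnst.alg_ext_mult distrib_left mult.assoc)
    ultimately have "der g = (d x * gen y - cnst (comm_sign (- ?s) ?t) * gen y * d x)
        + cnst ?s * (gen x * d y - cnst (comm_sign ?s (- ?t)) * d y * gen x)"
      by (simp only: sign(1) cnst_mult distrib_left right_diff_distrib mult.assoc) simp
    moreover have "d x * gen y - cnst (comm_sign (- ?s) ?t) * gen y * d x \<in> shell_ideal m"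
      by (intro shell_commute odd lin.gen refl)
    moreover have "gen x * d y - cnst (comm_sign ?s (- ?t)) * d y * gen x \<in> shell_ideal m"
      by (intro shell_commute odd lin.gen refl)
    ultimately show "der g \<in> shell_ideal m"
      by (auto intro: shell.add_mem shell.left_mem)
  next
    assume "g \<in> mass_shell m"
    then show "der g \<in> shell_ideal m"
      using kg by (auto simp: mass_shell_eq)
  qed
  show "twist jet_sign g \<in> Idl\<^bsub>FA\<^esub> (graded_commutators \<union> mass_shell m)"
    unfolding shell_ideal_def[symmetric] using g
  proof
    assume "g \<in> graded_commutators"
    then obtain x y where g: "g = gen x * gen y - cnst (comm_sign (jet_sign x) (jet_sign y)) * gen y * gen x"
      by (auto simp: graded_commutators_def comm_sign_def)
    have "cnst (- 1) = (- 1 :: jet free_alg)"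
      by (simp add: cnst_minus)
    then have "twist jet_sign g = g \<or> twist jet_sign g = - g"
      using jet_sign_cases[of x] jet_sign_cases[of y]
      by (auto simp: g cnst.word_ext_diff cnst.alg_ext_mult comm_sign_def)
    moreover have "g \<in> shell_ideal m"
      unfolding g by (rule shell_commute_gen)
    ultimately show "twist jet_sign g \<in> shell_ideal m"
      using shell.minus_mem[of g m] by auto
  next
    assume "g \<in> mass_shell m"
    then obtain y \<alpha> where g: "g = kg m y \<alpha>"
      by (auto simp: mass_shell_eq)
    have "jet_sign (y, \<beta>) = jet_sign (y, \<alpha>)" for \<beta>
      by (simp add: jet_sign_def)
    then have "g \<in> lin (jet_sign (y, \<alpha>))"
      unfolding g kg_def by (intro lin.add lin_sum lin_scaleR lin.gen)
    then show "twist jet_sign g \<in> shell_ideal m"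
      using kg_mem by (auto simp: twist_lin g intro: shell.left_mem)
  qed
qed

section \<open>The differential, its homotopy and their Laplacian\<close>

section \<open>The differential and a contracting homotopy\<close>

definition Cg :: "real \<Rightarrow> 4 multiset \<Rightarrow> jet free_alg" where
  "Cg m \<alpha> = dv Vg \<alpha> + m *\<^sub>R gen (Phi, \<alpha>)"

lemma dQ_jet_Ut: "dQ_jet m (Ut, \<alpha>) = cnst (- \<i>) * Cg m \<alpha>"
  by (simp add: Cg_def eta_sum dv_def cnst_of_real)

text \<open>The coefficients make the anticommutator of \<open>d\<^sub>Q\<close> and this derivation act as the identity on
  \<open>\<Phi>\<close>, \<open>u\<close>, the other ghost and the divergence of \<open>v\<close>, and as \<open>0\<close> on the divergence-free field
  \<open>v\<^sub>\<mu> + m\<^sup>-\<^sup>2 d\<^sub>\<mu> d\<^sub>\<nu> v\<^sup>\<nu>\<close>.\<close>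

fun K_jet :: "real \<Rightarrow> jet \<Rightarrow> jet free_alg" where
  "K_jet m (V \<mu>, \<alpha>) = cnst (- \<i> / of_real (m\<^sup>2)) * gen (Ut, add_mset \<mu> \<alpha>)"
| "K_jet m (U, \<alpha>) = cnst (- \<i> / of_real m) * gen (Phi, \<alpha>)"
| "K_jet m (Ut, \<alpha>) = 0"
| "K_jet m (Phi, \<alpha>) = 0"

lemma odd_dQ: "odd_derivation (dQ_jet m)"
proof
  fix x :: jet
  show "dQ_jet m x \<in> lin (- jet_sign x)"
  proof (cases x)
    case (Pair y \<alpha>)
    show ?thesis
      by (cases y) (auto simp: Pair dQ_jet_Ut Cg_def dv_def jet_sign_def simp del: dQ_jet.simps(3)
          intro!: lin.cnst lin.gen lin.add lin_sum lin_scaleR lin.zero)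
  qed
qed

lemma odd_K: "odd_derivation (K_jet m)"
proof
  fix x :: jet
  show "K_jet m x \<in> lin (- jet_sign x)"
  proof (cases x)
    case (Pair y \<alpha>)
    show ?thesis
      by (cases y) (auto simp: Pair jet_sign_def intro!: lin.cnst lin.gen lin.zero)
  qed
qed

abbreviation K_free :: "real \<Rightarrow> jet free_alg \<Rightarrow> jet free_alg" where
  "K_free m \<equiv> derivation jet_sign (K_jet m)"

lemma kg_sum_dv: "(\<Sum>\<mu>\<in>UNIV. sg \<mu> *\<^sub>R dv Vg (add_mset \<mu> (add_mset \<mu> \<alpha>))) + m\<^sup>2 *\<^sub>R dv Vg \<alpha>
    = (\<Sum>\<nu>\<in>UNIV. sg \<nu> *\<^sub>R kg m (V \<nu>) (add_mset \<nu> \<alpha>))"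
proof -
  have "(\<Sum>\<mu>\<in>UNIV. sg \<mu> *\<^sub>R dv Vg (add_mset \<mu> (add_mset \<mu> \<alpha>)))
      = (\<Sum>\<nu>\<in>UNIV. sg \<nu> *\<^sub>R (\<Sum>\<mu>\<in>UNIV. sg \<mu> *\<^sub>R Vg \<nu> (add_mset \<mu> (add_mset \<mu> (add_mset \<nu> \<alpha>)))))"
    unfolding dv_def scaleR_sum_right by (subst sum.swap) (simp add: mult.commute add_mset_commute)
  then show ?thesis
    by (simp add: kg_def dv_def scaleR_add_right sum.distrib scaleR_sum_right mult.commute)
qed

lemma scaleR_cnst_commute: "r *\<^sub>R (cnst c * p) = cnst c * (r *\<^sub>R p)"
  by (rule scaleR_mult_right[symmetric])

lemma derivation_kg: "derivation s d (kg m y \<alpha>)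
    = (\<Sum>\<mu>\<in>UNIV. sg \<mu> *\<^sub>R d (y, add_mset \<mu> (add_mset \<mu> \<alpha>))) + m\<^sup>2 *\<^sub>R d (y, \<alpha>)"
  by (simp add: kg_def derivation_add derivation_sum derivation_scaleR)

lemma cnst_mult_kg:
  "(\<Sum>\<mu>\<in>UNIV. sg \<mu> *\<^sub>R (cnst c * g (add_mset \<mu> (add_mset \<mu> \<alpha>)))) + m\<^sup>2 *\<^sub>R (cnst c * g \<alpha>)
    = cnst c * ((\<Sum>\<mu>\<in>UNIV. sg \<mu> *\<^sub>R g (add_mset \<mu> (add_mset \<mu> \<alpha>))) + m\<^sup>2 *\<^sub>R g \<alpha>)"
  by (simp add: scaleR_cnst_commute sum_distrib_left distrib_left)

lemma dQ_kg: "dQ_free m (kg m y \<alpha>) \<in> shell_ideal m"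
proof -
  note expand = derivation_kg[of jet_sign "dQ_jet m" m y \<alpha>, folded dQ_free_def]
  show ?thesis
  proof (cases y)
    case (V \<mu>)
    have "dQ_free m (kg m y \<alpha>) = cnst \<i> * kg m U (add_mset \<mu> \<alpha>)"
      unfolding V expand[unfolded V] using cnst_mult_kg[of \<i> "\<lambda>\<beta>. gen (U, add_mset \<mu> \<beta>)"]
      by (simp only: kg_def dQ_jet.simps add_mset_commute[of \<mu>])
    then show ?thesis
      using kg_mem by (auto intro: shell.left_mem)
  next
    case Phi
    have "dQ_free m (kg m y \<alpha>) = cnst (\<i> * of_real m) * kg m U \<alpha>"
      unfolding Phi expand[unfolded Phi] using cnst_mult_kg[of "\<i> * of_real m" "\<lambda>\<beta>. gen (U, \<beta>)"] by (simp only: kg_def dQ_jet.simps)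
    then show ?thesis
      using kg_mem by (auto intro: shell.left_mem)
  next
    case U
    show ?thesis
      unfolding U expand[unfolded U] by simp
  next
    case Ut
    have "dQ_free m (kg m y \<alpha>) = cnst (- \<i>) * ((\<Sum>\<mu>\<in>UNIV. sg \<mu> *\<^sub>R Cg m (add_mset \<mu> (add_mset \<mu> \<alpha>))) + m\<^sup>2 *\<^sub>R Cg m \<alpha>)"
      unfolding Ut expand[unfolded Ut] using cnst_mult_kg[of "- \<i>" "Cg m"] by (simp only: dQ_jet_Ut)
    also have "(\<Sum>\<mu>\<in>UNIV. sg \<mu> *\<^sub>R Cg m (add_mset \<mu> (add_mset \<mu> \<alpha>))) + m\<^sup>2 *\<^sub>R Cg m \<alpha>
        = (\<Sum>\<nu>\<in>UNIV. sg \<nu> *\<^sub>R kg m (V \<nu>) (add_mset \<nu> \<alpha>)) + m *\<^sub>R kg m Phi \<alpha>"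
      unfolding kg_sum_dv[symmetric]
      by (simp add: Cg_def kg_def scaleR_add_right sum.distrib scaleR_sum_right mult.commute)
    finally show ?thesis
      using kg_mem by (auto intro!: shell.left_mem shell.add_mem shell.sum_mem shell.scaleR_mem)
  qed
qed

lemma dQ_shell: "p \<in> shell_ideal m \<Longrightarrow> dQ_free m p \<in> shell_ideal m"
  using odd_derivation.der_shell[OF odd_dQ] dQ_kg by (simp add: dQ_free_def)

lemma K_kg: "K_free m (kg m y \<alpha>) \<in> shell_ideal m"
proof -
  note expand = derivation_kg[of jet_sign "K_jet m" m y \<alpha>]
  show ?thesis
  proof (cases y)
    case (V \<mu>)
    have "K_free m (kg m y \<alpha>) = cnst (- \<i> / of_real (m\<^sup>2)) * kg m Ut (add_mset \<mu> \<alpha>)"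
      unfolding V expand[unfolded V] using cnst_mult_kg[of "- \<i> / of_real (m\<^sup>2)" "\<lambda>\<beta>. gen (Ut, add_mset \<mu> \<beta>)"]
      by (simp only: kg_def K_jet.simps add_mset_commute[of \<mu>])
    then show ?thesis
      using kg_mem by (auto intro: shell.left_mem)
  next
    case U
    have "K_free m (kg m y \<alpha>) = cnst (- \<i> / of_real m) * kg m Phi \<alpha>"
      unfolding U expand[unfolded U] using cnst_mult_kg[of "- \<i> / of_real m" "\<lambda>\<beta>. gen (Phi, \<beta>)"] by (simp only: kg_def K_jet.simps)
    then show ?thesis
      using kg_mem by (auto intro: shell.left_mem)
  next
    case Phi
    show ?thesis
      unfolding Phi expand[unfolded Phi] by simp
  next
    case Ut
    show ?thesis
      unfolding Ut expand[unfolded Ut] by simp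
  qed
qed

lemma K_shell: "p \<in> shell_ideal m \<Longrightarrow> K_free m p \<in> shell_ideal m"
  using odd_derivation.der_shell[OF odd_K] K_kg by blast

text \<open>The square is half the anticommutator of \<open>d_Q\<close> with itself, so generators
  suffice. Only the jets of \<open>Ut\<close> are not immediate: there \<open>d_Q C\<close> is
  \<open>\<i>\<close> times the Klein-Gordon relation of \<open>u\<close>, which vanishes only on
  shell.\<close>

lemma dQ_dQ: "dQ_free m (dQ_free m p) \<in> shell_ideal m"
proof -
  have "anticomm (dQ_jet m) (dQ_jet m) p \<in> shell_ideal m"
  proof (rule anticomm_mem[OF shell.FA_ideal_axioms odd_dQ odd_dQ])
    fix x
    have "dQ_free m (dQ_jet m x) \<in> shell_ideal m"
    proof (cases x)
      case (Pair y \<alpha>)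
      show ?thesis
      proof (cases y)
        case Ut
        have "dQ_free m (Cg m \<alpha>) = cnst \<i> * kg m U \<alpha>"
          unfolding Cg_def dv_def kg_def dQ_free_def
          by (simp add: derivation_add derivation_sum derivation_scaleR scaleR_cnst_commute sum_distrib_left distrib_left)
            (simp add: power2_eq_square cnst_mult mult.assoc flip: cnst_of_real)
        then show ?thesis
          using kg_mem[of m U \<alpha>] unfolding Pair Ut dQ_jet_Ut
          by (simp add: dQ_free_def derivation_cnst_mult shell.left_mem)
      qed (simp_all add: Pair dQ_free_def derivation_cnst_mult)
    qed
    then show "anticomm (dQ_jet m) (dQ_jet m) (gen x) \<in> shell_ideal m"
      by (simp add: anticomm_def dQ_free_def shell.add_mem)
  qed
  then have "(1 / 2) *\<^sub>R (dQ_free m (dQ_free m p) + dQ_free m (dQ_free m p)) \<in> shell_ideal m"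
    by (intro shell.scaleR_mem) (simp add: anticomm_def dQ_free_def)
  then show ?thesis
    by (simp flip: scaleR_2)
qed

definition lap :: "real \<Rightarrow> jet free_alg \<Rightarrow> jet free_alg" where
  "lap m = anticomm (dQ_jet m) (K_jet m)"

lemma lap_eq: "lap m p = dQ_free m (K_free m p) + K_free m (dQ_free m p)"
  by (simp add: lap_def anticomm_def dQ_free_def)

lemma lap_shell: "p \<in> shell_ideal m \<Longrightarrow> lap m p \<in> shell_ideal m"
  by (simp add: lap_eq shell.add_mem dQ_shell K_shell)

lemma lap_Phi: "m \<noteq> 0 \<Longrightarrow> lap m (gen (Phi, \<alpha>)) = gen (Phi, \<alpha>)"
  by (simp add: lap_eq dQ_free_def derivation_cnst_mult flip: cnst_mult mult.assoc)

lemma lap_U: "m \<noteq> 0 \<Longrightarrow> lap m (gen (U, \<alpha>)) = gen (U, \<alpha>)"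
  by (simp add: lap_eq dQ_free_def derivation_cnst_mult flip: cnst_mult mult.assoc)

lemma lap_V: "m \<noteq> 0 \<Longrightarrow> lap m (Vg \<mu> \<alpha>) = - (1 / m\<^sup>2) *\<^sub>R dv Vg (add_mset \<mu> \<alpha>)"
proof -
  assume m: "m \<noteq> 0"
  have "lap m (Vg \<mu> \<alpha>) = cnst (- \<i> / of_real (m\<^sup>2)) * (cnst (- \<i>) * Cg m (add_mset \<mu> \<alpha>))
      + cnst \<i> * (cnst (- \<i> / of_real m) * gen (Phi, add_mset \<mu> \<alpha>))"
    by (simp add: lap_eq dQ_free_def derivation_cnst_mult dQ_jet_Ut del: dQ_jet.simps(3))
  also have "\<dots> = - (1 / m\<^sup>2) *\<^sub>R Cg m (add_mset \<mu> \<alpha>) + (1 / m) *\<^sub>R gen (Phi, add_mset \<mu> \<alpha>)"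
    by (simp flip: cnst_of_real cnst_mult mult.assoc)
  finally show ?thesis
    using m by (simp add: Cg_def scaleR_add_right power2_eq_square)
qed

text \<open>Off shell the result is \<open>- 1 / m^2\<close> times the wave operator; it becomes the
  identity by the Klein-Gordon relation. The divergence of \<open>v\<close> behaves in the same
  way.\<close>

lemma lap_Ut: "m \<noteq> 0 \<Longrightarrow> lap m (gen (Ut, \<alpha>)) - gen (Ut, \<alpha>) \<in> shell_ideal m"
proof -
  assume m: "m \<noteq> 0"
  have "K_free m (Cg m \<alpha>) = cnst (- \<i> / of_real (m\<^sup>2)) * (\<Sum>\<nu>\<in>UNIV. sg \<nu> *\<^sub>R gen (Ut, add_mset \<nu> (add_mset \<nu> \<alpha>)))"
    by (simp add: Cg_def dv_def derivation_add derivation_sum derivation_scaleR scaleR_cnst_commute sum_distrib_left)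
  then have "lap m (gen (Ut, \<alpha>)) = cnst (- \<i>) * (cnst (- \<i> / of_real (m\<^sup>2))
      * (\<Sum>\<nu>\<in>UNIV. sg \<nu> *\<^sub>R gen (Ut, add_mset \<nu> (add_mset \<nu> \<alpha>))))"
    by (simp add: lap_eq dQ_free_def derivation_cnst_mult dQ_jet_Ut del: dQ_jet.simps(3))
  also have "\<dots> = - (1 / m\<^sup>2) *\<^sub>R (\<Sum>\<nu>\<in>UNIV. sg \<nu> *\<^sub>R gen (Ut, add_mset \<nu> (add_mset \<nu> \<alpha>)))"
    by (simp flip: cnst_of_real cnst_mult mult.assoc)
  finally have "lap m (gen (Ut, \<alpha>)) - gen (Ut, \<alpha>) = - (1 / m\<^sup>2) *\<^sub>R kg m Ut \<alpha>"
    using m by (simp add: kg_def scaleR_add_right)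
  then show ?thesis
    by (simp only: shell.scaleR_mem kg_mem)
qed

lemma lap_dv:
  assumes "m \<noteq> 0"
  shows "lap m (dv Vg \<alpha>) - dv Vg \<alpha> \<in> shell_ideal m"
proof -
  have "lap m (dv Vg \<alpha>) = - (1 / m\<^sup>2) *\<^sub>R (\<Sum>\<mu>\<in>UNIV. sg \<mu> *\<^sub>R dv Vg (add_mset \<mu> (add_mset \<mu> \<alpha>)))"
    unfolding dv_def[of _ \<alpha>] lap_def anticomm_sum anticomm_scaleR
    unfolding lap_def[symmetric] lap_V[OF assms]
    by (simp add: scaleR_sum_right mult.commute sum_negf)
  then have "lap m (dv Vg \<alpha>) - dv Vg \<alpha> = - (1 / m\<^sup>2) *\<^sub>R (\<Sum>\<nu>\<in>UNIV. sg \<nu> *\<^sub>R kg m (V \<nu>) (add_mset \<nu> \<alpha>))"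
    unfolding kg_sum_dv[symmetric] using assms by (simp add: scaleR_add_right)
  then show ?thesis
    by (simp only: shell.scaleR_mem shell.sum_mem kg_mem)
qed

section \<open>Closed polynomials modulo exact ones\<close>

section \<open>Closed polynomials\<close>

lemma dQ_add: "dQ_free m (p + q) = dQ_free m p + dQ_free m q"
  by (simp add: dQ_free_def derivation_add)

lemma dQ_diff: "dQ_free m (p - q) = dQ_free m p - dQ_free m q"
  by (simp add: dQ_free_def derivation_diff)

lemma dQ_cnst_mult: "dQ_free m (cnst c * p) = cnst c * dQ_free m p"
  by (simp add: dQ_free_def derivation_cnst_mult)

lemma dQ_scaleR: "dQ_free m (r *\<^sub>R p) = r *\<^sub>R dQ_free m p"
  by (simp add: dQ_free_def derivation_scaleR)

lemma dQ_sum: "dQ_free m (\<Sum>i\<in>I. f i) = (\<Sum>i\<in>I. dQ_free m (f i))"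
  by (simp add: dQ_free_def derivation_sum)

lemma dQ_gen: "dQ_free m (gen x) = dQ_jet m x"
  by (simp add: dQ_free_def)

lemma dQ_mult: "dQ_free m (p * q) = dQ_free m p * q + twist jet_sign p * dQ_free m q"
  by (simp add: dQ_free_def derivation_mult)

lemma dQ_trl: "dQ_free m (trl T xs) = trl (\<lambda>y. dQ_free m (T y)) xs"
  by (simp add: trl_def dQ_sum dQ_scaleR)

text \<open>Gauge invariance: \<open>d_Q\<close> shifts \<open>v\<close> by the gradient of
  \<open>\<i> u\<close>, which has no curl. Every summand of the symmetrized jet is sent to the same
  jet of \<open>u\<close>, so their mean cancels against the jet of \<open>Phi\<close>.\<close>

lemma dQ_ev_gen: "dQ_free m (ev_gen m s) = 0"
proof (cases s)
  case (SF \<mu> \<nu> \<rho>s)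
  have "dQ_free m (curl Vg y) = 0" for y
    by (simp add: curl_def dQ_diff dQ_gen add_mset_commute)
  then show ?thesis
    by (simp add: SF dQ_trl trl_zero)
next
  case (SPhi \<mu> \<nu>s)
  have phi: "dQ_free m (phi_free m y) = 0" if "y \<noteq> []" for y
  proof -
    have "dQ_free m (symt Vg y) = (1 / real (length y)) *\<^sub>R (\<Sum>l<length y. cnst \<i> * gen (U, mset y))"
      unfolding symt_def dQ_scaleR dQ_sum
      by (intro arg_cong2[where f = scaleR] sum.cong refl) (simp add: dQ_gen)
    also have "\<dots> = cnst \<i> * gen (U, mset y)"
      using that by (simp only: sum_constant_scaleR scaleR_scaleR card_lessThan) simp
    finally show ?thesis
      by (simp add: phi_free_eq dQ_diff dQ_scaleR dQ_gen cnst_mult mult.assoc scaleR_cnst_commute cnst_of_real)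
  qed
  have "trl (\<lambda>y. dQ_free m (phi_free m y)) (\<mu> # \<nu>s) = trl (\<lambda>y. 0) (\<mu> # \<nu>s)"
  proof (rule trl_cong)
    show "dQ_free m (phi_free m y) = 0" if "length y = length (\<mu> # \<nu>s)" for y
      using that by (intro phi) auto
  qed
  then show ?thesis
    by (simp add: SPhi dQ_trl trl_zero)
qed

lemma phi_free_lin: "phi_free m y \<in> lin 1"
proof -
  have "- (m *\<^sub>R symt Vg y) = (- m) *\<^sub>R symt Vg y"
    by simp
  then show ?thesis
    unfolding phi_free_eq diff_conv_add_uminus symt_def
    by (auto simp only: intro!: lin.add lin.gen lin_scaleR lin_sum) (simp_all add: jet_sign_def)
qed

lemma curl_lin: "curl Vg y \<in> lin 1"
proof -
  have "- Vg \<mu> \<alpha> = cnst (- 1) * Vg \<mu> \<alpha>" for \<mu> \<alpha>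
    by (simp add: cnst_minus)
  then show ?thesis
    unfolding curl_def diff_conv_add_uminus by (auto intro!: lin.add lin.gen lin.cnst simp: jet_sign_def)
qed

lemma ev_gen_lin: "ev_gen m s \<in> lin 1"
  by (cases s) (auto simp: trl_def intro!: lin_sum lin_scaleR curl_lin phi_free_lin)

lemma twist_ev: "twist jet_sign (ev m q) = ev m q"
proof -
  have "twist jet_sign (ev_gen m s) = ev_gen m s" for s
    by (simp add: twist_lin[OF ev_gen_lin])
  then have "twist jet_sign (ev m (word xs)) = ev m (word xs)" for xs
    by (induction xs) (simp_all add: word_Cons cnst.alg_ext_mult del: cnst.word_ext_word)
  then show ?thesis
    by (induction q rule: free_alg_induct)
      (simp_all add: cnst.word_ext_add cnst.word_ext_cnst_mult del: cnst.word_ext_word)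
qed

lemma dQ_ev: "dQ_free m (ev m q) = 0"
proof -
  have "dQ_free m (ev m (word xs)) = 0" for xs
    by (induction xs)
      (simp_all add: word_Cons cnst.alg_ext_mult dQ_mult dQ_ev_gen del: cnst.word_ext_word, simp add: dQ_free_def)
  then show ?thesis
    by (induction q rule: free_alg_induct)
      (simp_all add: cnst.word_ext_add cnst.word_ext_cnst_mult dQ_add dQ_cnst_mult del: cnst.word_ext_word)
qed

text \<open>The polynomials already brought to the desired form; surjectivity onto the cohomology
  means that all closed polynomials belong here.\<close>

definition qc :: "real \<Rightarrow> jet free_alg set" where
  "qc m = {p. \<exists>q r. p - ev m q - dQ_free m r \<in> shell_ideal m}"

lemma qc_add: "p \<in> qc m \<Longrightarrow> p' \<in> qc m \<Longrightarrow> p + p' \<in> qc m"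
proof -
  assume "p \<in> qc m" "p' \<in> qc m"
  then obtain q r q' r' where "p - ev m q - dQ_free m r \<in> shell_ideal m" "p' - ev m q' - dQ_free m r' \<in> shell_ideal m"
    by (auto simp: qc_def)
  from shell.add_mem[OF this] have "p + p' - ev m (q + q') - dQ_free m (r + r') \<in> shell_ideal m"
    by (simp add: cnst.word_ext_add dQ_add algebra_simps)
  then show ?thesis
    unfolding qc_def by blast
qed

lemma qc_cnst: "p \<in> qc m \<Longrightarrow> cnst c * p \<in> qc m"
proof -
  assume "p \<in> qc m"
  then obtain q r where "p - ev m q - dQ_free m r \<in> shell_ideal m"
    by (auto simp: qc_def)
  from shell.left_mem[OF this, of "cnst c"]
  have "cnst c * p - ev m (cnst c * q) - dQ_free m (cnst c * r) \<in> shell_ideal m"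
    by (simp add: cnst.word_ext_cnst_mult dQ_cnst_mult right_diff_distrib)
  then show ?thesis
    unfolding qc_def by blast
qed

lemma qc_scaleR: "p \<in> qc m \<Longrightarrow> r *\<^sub>R p \<in> qc m"
  using qc_cnst[of p m "of_real r"] by (simp add: cnst_of_real)

lemma qc_shell: "p \<in> shell_ideal m \<Longrightarrow> p \<in> qc m"
  unfolding qc_def by (auto intro!: exI[of _ 0] simp: dQ_free_def)

lemma qc_exact: "dQ_free m r \<in> qc m"
  unfolding qc_def by (auto intro!: exI[of _ 0] exI[of _ r])

lemma qc_ev: "ev m q \<in> qc m"
  unfolding qc_def by (auto intro!: exI[of _ 0] exI[of _ q] simp: dQ_free_def)

lemma qc_ev_gen: "ev_gen m s \<in> qc m"
  using qc_ev[of m "gen s"] by simp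

lemma qc_diff: "p \<in> qc m \<Longrightarrow> p' \<in> qc m \<Longrightarrow> p - p' \<in> qc m"
  using qc_add[of p m "- 1 *\<^sub>R p'"] qc_scaleR[of p' m "- 1"] by simp

lemma qc_subspace: "subspace (qc m)"
  by (auto simp: subspace_def intro: qc_add qc_scaleR qc_shell)

lemma qc_sum: "(\<And>i. i \<in> I \<Longrightarrow> f i \<in> qc m) \<Longrightarrow> sum f I \<in> qc m"
  by (rule subspace_sum[OF qc_subspace])

lemma qc_cong: "p - p' \<in> shell_ideal m \<Longrightarrow> p' \<in> qc m \<Longrightarrow> p \<in> qc m"
  using qc_add[OF qc_shell, of "p - p'" m p'] by simp

text \<open>Elements of \<open>qc\<close> are closed on shell, and an exact element times a closed
  one is exact.\<close>

lemma qc_mult: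
  assumes "p \<in> qc m" "p' \<in> qc m"
  shows "p * p' \<in> qc m"
proof -
  obtain q r q' r' where p: "p - (ev m q + dQ_free m r) \<in> shell_ideal m"
    and p': "p' - (ev m q' + dQ_free m r') \<in> shell_ideal m"
    using assms by (auto simp: qc_def diff_diff_eq)
  define e' where "e' = ev m q' + dQ_free m r'"
  have e': "dQ_free m e' \<in> shell_ideal m"
    by (simp add: e'_def dQ_add dQ_ev dQ_dQ)
  have "(ev m q + dQ_free m r) * e' = ev m (q * q') + (dQ_free m (ev m q * r') + (dQ_free m (r * e')
      - twist jet_sign r * dQ_free m e'))"
    by (simp add: dQ_mult twist_ev dQ_ev cnst.alg_ext_mult algebra_simps) (simp add: e'_def algebra_simps)
  also have "\<dots> \<in> qc m"
    by (intro qc_add qc_diff qc_exact qc_ev qc_shell shell.left_mem e')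
  finally show ?thesis
    by (rule qc_cong[rotated]) (rule shell.mult_cong[OF p p'[folded e'_def]])
qed

subsection \<open>The invariant jets are polynomials in the traceless tensors\<close>

text \<open>\<open>psi\<close> is a Proca field up to exact terms, and all traces of its tensor of rank \<open>n\<close> are, modulo
  exact terms, jets of it of lower order; so only the traceless part of each rank is new, and that
  part is a combination of the traceless parts of the curl and of the symmetrization.\<close>

definition psi :: "real \<Rightarrow> 4 \<Rightarrow> 4 multiset \<Rightarrow> jet free_alg" where
  "psi m \<mu> \<alpha> = gen (Phi, add_mset \<mu> \<alpha>) - m *\<^sub>R Vg \<mu> \<alpha>"

lemma Cg_qc: "Cg m \<alpha> \<in> qc m"
proof -
  have "Cg m \<alpha> = dQ_free m (cnst \<i> * gen (Ut, \<alpha>))"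
    by (simp only: dQ_cnst_mult dQ_gen dQ_jet_Ut mult.assoc[symmetric] cnst_mult[symmetric]) simp
  then show ?thesis
    by (simp add: qc_exact)
qed

lemma dv_psi_qc: "dv (psi m) \<alpha> \<in> qc m"
proof -
  have "dv (psi m) \<alpha> = kg m Phi \<alpha> - m *\<^sub>R Cg m \<alpha>"
    by (simp add: psi_def dv_def kg_def Cg_def scaleR_diff_right sum_subtractf scaleR_add_right scaleR_sum_right
        mult.commute power2_eq_square)
  then show ?thesis
    by (simp add: qc_diff qc_shell qc_scaleR kg_mem Cg_qc)
qed

lemma bx_psi: "bx (psi m \<mu>) \<alpha> - (- m\<^sup>2) *\<^sub>R psi m \<mu> \<alpha> \<in> shell_ideal m"
proof -
  have "bx (psi m \<mu>) \<alpha> - (- m\<^sup>2) *\<^sub>R psi m \<mu> \<alpha> = kg m Phi (add_mset \<mu> \<alpha>) - m *\<^sub>R kg m (V \<mu>) \<alpha>"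
    by (simp add: psi_def bx_def kg_def scaleR_diff_right sum_subtractf scaleR_add_right scaleR_sum_right
        mult.commute add_mset_commute[of \<mu>])
  then show ?thesis
    by (simp add: shell.diff_mem shell.scaleR_mem kg_mem)
qed

text \<open>\<open>pull l\<close> moves the \<open>l\<close>-th and then the \<open>0\<close>-th index to the front.\<close>

definition pull :: "nat \<Rightarrow> nat \<Rightarrow> nat" where
  "pull l = Transposition.transpose 0 l \<circ> Transposition.transpose 1 l"

lemma pull_permutes: "0 < l \<Longrightarrow> l < n \<Longrightarrow> pull l permutes {..<n}"
  unfolding pull_def by (intro permutes_compose permutes_swap_id) auto

lemma curl_pull:
  assumes "0 < l" "l < length w"
  shows "curl A (permute_list (pull l) w) = tens A w - tens A (swp l w)"
proof -
  define u where "u = permute_list (pull l) w"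
  have u: "length u = length w" "mset u = mset w" "u ! 0 = w ! l" "u ! 1 = w ! 0"
  proof -
    show "length u = length w" "mset u = mset w"
      using pull_permutes[OF assms] by (simp_all add: u_def mset_permute_list)
    have "pull l 0 = l" "pull l 1 = 0"
      using assms by (simp_all add: pull_def Transposition.transpose_def)
    moreover have "w \<noteq> []"
      using assms by auto
    ultimately show "u ! 0 = w ! l" "u ! 1 = w ! 0"
      using assms permute_list_nth[OF pull_permutes[OF assms], of 0] permute_list_nth[OF pull_permutes[OF assms], of 1]
      unfolding u_def by auto
  qed
  have "2 \<le> length u"
    using u assms by simp
  then obtain a b zs where ab: "u = a # b # zs"
    by (metis Suc_le_length_iff numeral_2_eq_2)
  have w: "w = w ! 0 # tl w"
    using assms by (cases w) auto
  have "mset w = mset u"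
    by (rule sym) (rule u(2))
  then have "mset w = add_mset b (add_mset a (mset zs))"
    unfolding ab by (simp add: add_mset_commute)
  moreover have "a = w ! l" "b = w ! 0"
    using u ab by simp_all
  moreover from w have "mset (tl w) = mset w - {#w ! 0#}"
    by (metis add_mset_remove_trivial mset.simps(2))
  moreover have "hd w = w ! 0"
    using w by (metis list.sel(1))
  ultimately show ?thesis
    unfolding u_def[symmetric] tens_swp[OF assms(2)]
    unfolding ab tens_def curl_def by (simp add: add_mset_commute)
qed

text \<open>Exchanging the first index with another changes the tensor by a curl. Averaging over all
  exchanges leaves the symmetrization and a sum of curls, and the projection respects
  permutations.\<close>

lemma trl_tens_eq:
  assumes "y \<noteq> []"
  shows "trl (tens A) y = trl (symt A) y
    + (1 / real (length y)) *\<^sub>R (\<Sum>l\<in>{1..<length y}. trl (curl A) (permute_list (pull l) y))"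
proof -
  let ?n = "length y"
  have diff: "trl (tens A) y - trl (tens A) (swp l y)
      = (if l = 0 then 0 else trl (curl A) (permute_list (pull l) y))" if "l < ?n" for l
  proof (cases "l = 0")
    case True
    have "swp 0 y = y"
      by (simp add: swp_def)
    then show ?thesis
      using True by simp
  next
    case False
    have "trl (curl A) (permute_list (pull l) y) = trl (\<lambda>w. curl A (permute_list (pull l) w)) y"
      using False that by (intro trl_permute[symmetric] pull_permutes) auto
    also have "\<dots> = trl (\<lambda>w. tens A w - tens A (swp l w)) y"
      using False that by (intro trl_cong) (simp add: curl_pull)
    finally show ?thesis
      using False that by (simp add: trl_diff trl_swp)
  qed
  have "(1 / real ?n) *\<^sub>R (\<Sum>l<?n. trl (tens A) y - trl (tens A) (swp l y))
      = (1 / real ?n) *\<^sub>R (\<Sum>l\<in>{1..<?n}. trl (curl A) (permute_list (pull l) y))"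
    by (intro arg_cong2[where f = scaleR] refl sum.mono_neutral_cong_right)
      (auto simp: diff Suc_le_eq split: if_splits)
  moreover have "(1 / real ?n) *\<^sub>R (\<Sum>l<?n. trl (tens A) y - trl (tens A) (swp l y))
      = trl (tens A) y - trl (symt A) y"
    using assms unfolding trl_symt by (simp add: sum_subtractf scaleR_diff_right sum_constant_scaleR)
  ultimately show ?thesis
    by (simp add: algebra_simps)
qed

lemma curl_psi: "2 \<le> length y \<Longrightarrow> curl (psi m) y = - m *\<^sub>R curl Vg y"
  by (simp add: curl_def psi_def scaleR_diff_right add_mset_commute)

lemma symt_psi: "y \<noteq> [] \<Longrightarrow> symt (psi m) y = phi_free m y"
proof -
  assume "y \<noteq> []"
  then have "(1 / real (length y)) *\<^sub>R (\<Sum>l<length y. gen (Phi, mset y)) = (gen (Phi, mset y) :: jet free_alg)"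
    by (simp only: sum_constant_scaleR scaleR_scaleR card_lessThan) simp
  moreover have "(\<Sum>l<length y. gen (Phi, add_mset (y ! l) (mset y - {#y ! l#})))
      = (\<Sum>l<length y. (gen (Phi, mset y) :: jet free_alg))"
    by (intro sum.cong) auto
  ultimately show ?thesis
    by (simp add: symt_def psi_def phi_free_eq sum_subtractf scaleR_diff_right flip: scaleR_sum_right)
qed

text \<open>The gradient in \<open>psi\<close> drops out of the curl, which becomes
  \<open>- m\<close> times that of \<open>v\<close>, and the symmetrization of \<open>psi\<close> is
  \<open>phi_free\<close>. Both projections are therefore evaluations of symbols.\<close>

lemma trl_tens_psi_qc:
  assumes "y \<noteq> []"
  shows "trl (tens (psi m)) y \<in> qc m"
proof -
  have "trl (symt (psi m)) y \<in> qc m"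
  proof -
    obtain \<mu> \<nu>s where y: "y = \<mu> # \<nu>s"
      using assms by (cases y) auto
    have "trl (symt (psi m)) y = trl (phi_free m) y"
    proof (rule trl_cong)
      show "symt (psi m) w = phi_free m w" if "length w = length y" for w
        using that assms by (intro symt_psi) auto
    qed
    then show ?thesis
      using qc_ev_gen[of m "SPhi \<mu> \<nu>s"] y by simp
  qed
  moreover have "trl (curl (psi m)) z \<in> qc m" if len: "2 \<le> length z" for z
  proof -
    obtain \<mu> \<nu> \<rho>s where z: "z = \<mu> # \<nu> # \<rho>s"
      using len by (cases z; cases "tl z") auto
    have "trl (curl (psi m)) z = trl (\<lambda>y. - m *\<^sub>R curl Vg y) z"
      by (rule trl_cong) (use len in \<open>simp only: curl_psi\<close>)
    also have "\<dots> = - m *\<^sub>R ev_gen m (SF \<mu> \<nu> \<rho>s)"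
      unfolding trl_scaleR by (simp add: z)
    finally show ?thesis
      by (simp only: qc_scaleR qc_ev_gen)
  qed
  ultimately show ?thesis
    unfolding trl_tens_eq[OF assms] by (intro qc_add qc_scaleR qc_sum) auto
qed

lemma psi_qc: "psi m \<mu> \<alpha> \<in> qc m"
proof (induction "size \<alpha>" arbitrary: \<mu> \<alpha> rule: less_induct)
  case less
  obtain \<rho>s where \<rho>s: "mset \<rho>s = \<alpha>"
    using ex_mset by blast
  let ?y = "\<mu> # \<rho>s"
  have "tens (psi m) ?y - trl (tens (psi m)) ?y \<in> qc m"
  proof (rule trl_diff_mem[OF qc_subspace])
    fix i j and z :: "4 list"
    assume ij: "i < length ?y" "j < length ?y" "i \<noteq> j" and z: "length z = length ?y"
    \<comment> \<open>On shell this is \<open>- m^2\<close> times a jet whose order is two below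
      that of \<alpha>, so the induction hypothesis applies. Divergences are exact on shell and
      involve no induction.\<close>
    have bx: "bx (psi m \<nu>) \<beta> \<in> qc m" if "size \<beta> + 3 = length z" for \<nu> \<beta>
    proof -
      have "size \<beta> < size \<alpha>"
        using that z \<rho>s by auto
      then show ?thesis
        by (intro qc_cong[OF bx_psi] qc_scaleR less)
    qed
    show "trc i j (tens (psi m)) z \<in> qc m"
      using trc_tens[of i z j "psi m"] ij z dv_psi_qc bx by auto
  qed
  then have "tens (psi m) ?y \<in> qc m"
    using qc_add[OF _ trl_tens_psi_qc[of ?y]] by fastforce
  then show ?case
    by (simp add: tens_def \<rho>s)
qed

subsection \<open>Weights with respect to the Laplacian\<close>

definition wt :: "real \<Rightarrow> nat \<Rightarrow> jet free_alg set" where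
  "wt m k = {p. lap m p - real k *\<^sub>R p \<in> shell_ideal m}"

lemma lap_add: "lap m (p + q) = lap m p + lap m q"
  by (simp add: lap_def anticomm_add)

lemma lap_diff: "lap m (p - q) = lap m p - lap m q"
  by (simp add: lap_def anticomm_diff)

lemma lap_scaleR: "lap m (r *\<^sub>R p) = r *\<^sub>R lap m p"
  by (simp add: lap_def anticomm_scaleR)

lemma lap_cnst_mult: "lap m (cnst c * p) = cnst c * lap m p"
  by (simp add: lap_def anticomm_cnst_mult)

lemma lap_sum: "lap m (\<Sum>i\<in>I. f i) = (\<Sum>i\<in>I. lap m (f i))"
  by (simp add: lap_def anticomm_sum)

lemma lap_mult: "lap m (p * q) = lap m p * q + p * lap m q"
  unfolding lap_def by (rule anticomm_mult[OF odd_dQ odd_K])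

lemma wt_add: "p \<in> wt m k \<Longrightarrow> q \<in> wt m k \<Longrightarrow> p + q \<in> wt m k"
  using shell.add_mem[of "lap m p - real k *\<^sub>R p" m "lap m q - real k *\<^sub>R q"]
  by (simp add: wt_def lap_add scaleR_add_right algebra_simps)

lemma wt_cnst: "p \<in> wt m k \<Longrightarrow> cnst c * p \<in> wt m k"
  using shell.left_mem[of "lap m p - real k *\<^sub>R p" m "cnst c"]
  by (simp add: wt_def lap_cnst_mult right_diff_distrib scaleR_cnst_commute)

lemma wt_scaleR: "p \<in> wt m k \<Longrightarrow> r *\<^sub>R p \<in> wt m k"
  using wt_cnst[of p m k "of_real r"] by (simp add: cnst_of_real)

lemma wt_0 [simp]: "0 \<in> wt m k"
  by (simp add: wt_def lap_def anticomm_def)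

lemma wt_1: "1 \<in> wt m 0"
  by (simp add: wt_def lap_def anticomm_1)

lemma wt_mult:
  assumes "p \<in> wt m k" "q \<in> wt m l"
  shows "p * q \<in> wt m (k + l)"
proof -
  have "lap m (p * q) - real (k + l) *\<^sub>R (p * q) = (lap m p - real k *\<^sub>R p) * q + p * (lap m q - real l *\<^sub>R q)"
    by (simp add: lap_mult algebra_simps scaleR_mult_left scaleR_mult_right)
  then show ?thesis
    using assms by (simp add: wt_def shell.add_mem shell.left_mem shell.right_mem)
qed

lemma gen_split:
  assumes "m \<noteq> 0"
  shows "\<exists>a b. gen x = a + b \<and> a \<in> qc m \<inter> wt m 0 \<and> b \<in> wt m 1"
proof (cases x)
  case (Pair y \<alpha>)
  have trivial: ?thesis if "gen x \<in> wt m 1"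
    using that by (intro exI[of _ 0] exI[of _ "gen x"]) (auto intro: qc_shell)
  show ?thesis
  proof (cases y)
    case (V \<mu>)
    define b where "b = - (1 / m\<^sup>2) *\<^sub>R dv Vg (add_mset \<mu> \<alpha>)"
    have lap: "lap m (Vg \<mu> \<alpha>) = b"
      unfolding b_def by (rule lap_V[OF assms])
    have "lap m b - b = - (1 / m\<^sup>2) *\<^sub>R (lap m (dv Vg (add_mset \<mu> \<alpha>)) - dv Vg (add_mset \<mu> \<alpha>))"
      unfolding b_def lap_scaleR by (simp add: scaleR_diff_right)
    then have lap_b: "lap m b - b \<in> shell_ideal m"
      by (simp only: shell.scaleR_mem lap_dv[OF assms])
    \<comment> \<open>The weight-zero part of \<open>v\<close>, its divergence-free modification, is
      here rewritten through \<open>psi\<close> and the exact \<open>Cg\<close>: the jets of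
      \<open>Phi\<close> in the two terms cancel.\<close>
    have "Vg \<mu> \<alpha> - b = - (1 / m) *\<^sub>R psi m \<mu> \<alpha> + (1 / m\<^sup>2) *\<^sub>R Cg m (add_mset \<mu> \<alpha>)"
      using assms by (simp add: b_def psi_def Cg_def scaleR_add_right scaleR_diff_right power2_eq_square)
    also have "\<dots> \<in> qc m"
      by (intro qc_add qc_scaleR psi_qc Cg_qc)
    finally have "Vg \<mu> \<alpha> - b \<in> qc m" .
    moreover have "Vg \<mu> \<alpha> - b \<in> wt m 0"
      using shell.minus_mem[OF lap_b] by (simp add: wt_def lap_diff lap)
    moreover have "b \<in> wt m 1"
      using lap_b by (simp add: wt_def)
    ultimately show ?thesis
      by (intro exI[of _ "Vg \<mu> \<alpha> - b"] exI[of _ b]) (simp add: Pair V)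
  next
    case Phi
    then show ?thesis
      using lap_Phi[OF assms, of \<alpha>] by (intro trivial) (simp add: wt_def Pair)
  next
    case U
    then show ?thesis
      using lap_U[OF assms, of \<alpha>] by (intro trivial) (simp add: wt_def Pair)
  next
    case Ut
    then show ?thesis
      using lap_Ut[OF assms, of \<alpha>] by (intro trivial) (simp add: wt_def Pair)
  qed
qed

text \<open>Only the component of weight zero has to lie in \<open>qc\<close>; positive weights are
  eliminated by means of the Laplacian.\<close>

definition graded :: "real \<Rightarrow> nat \<Rightarrow> (nat \<Rightarrow> jet free_alg) \<Rightarrow> bool" where
  "graded m N f \<longleftrightarrow> f 0 \<in> qc m \<and> (\<forall>k. f k \<in> wt m k) \<and> (\<forall>k>N. f k = 0)"

lemma graded_mono: "graded m N f \<Longrightarrow> N \<le> N' \<Longrightarrow> graded m N' f"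
  by (auto simp: graded_def)

lemma graded_sum:
  assumes "graded m N f" "N \<le> N'"
  shows "(\<Sum>k\<le>N'. f k) = (\<Sum>k\<le>N. f k)"
  using assms by (intro sum.mono_neutral_right) (auto simp: graded_def)

lemma weight_decomposition:
  assumes "m \<noteq> 0"
  shows "\<exists>N f. graded m N f \<and> p = (\<Sum>k\<le>N. f k)"
proof -
  have word: "\<exists>N f. graded m N f \<and> word xs = (\<Sum>k\<le>N. f k)" for xs
  proof (induction xs)
    case Nil
    have "(1 :: jet free_alg) \<in> qc m"
      using qc_ev[of m 1] by simp
    then show ?case
      by (intro exI[of _ 0] exI[of _ "\<lambda>k. if k = 0 then 1 else 0"]) (simp add: graded_def wt_1)
  next
    case (Cons x xs)
    then obtain N f where f: "graded m N f" "word xs = (\<Sum>k\<le>N. f k)"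
      by blast
    obtain a b where ab: "gen x = a + b" "a \<in> qc m" "a \<in> wt m 0" "b \<in> wt m 1"
      using gen_split[OF assms] by blast
    \<comment> \<open>Multiplication by \<open>a\<close> preserves the weight and multiplication by
      \<open>b\<close> raises it by one.\<close>
    define f' where "f' k = a * f k + (case k of 0 \<Rightarrow> 0 | Suc j \<Rightarrow> b * f j)" for k
    have "f' 0 \<in> qc m"
      using f ab by (simp add: f'_def graded_def qc_mult)
    moreover have "f' k \<in> wt m k" for k
    proof -
      have "f j \<in> wt m j" for j
        using f by (simp add: graded_def)
      then show ?thesis
        using wt_mult[OF ab(3), of "f k" k] wt_mult[OF ab(4)] by (auto simp: f'_def split: nat.split intro: wt_add)
    qed
    moreover have "f' k = 0" if "k > Suc N" for k
      using f that by (auto simp: f'_def graded_def split: nat.split)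
    ultimately have "graded m (Suc N) f'"
      by (simp add: graded_def)
    moreover have "word (x # xs) = (\<Sum>k\<le>Suc N. f' k)"
    proof -
      have "(\<Sum>k\<le>Suc N. f' k) = a * (\<Sum>k\<le>Suc N. f k) + b * (\<Sum>k\<le>N. f k)"
        unfolding f'_def sum.distrib
        by (simp add: sum_distrib_left sum.atMost_Suc_shift[of "\<lambda>k. case k of 0 \<Rightarrow> 0 | Suc j \<Rightarrow> b * f j"] del: sum.atMost_Suc)
      then show ?thesis
        using graded_sum[OF f(1), of "Suc N"] by (simp add: word_Cons f(2) ab(1) distrib_right del: sum.atMost_Suc)
    qed
    ultimately show ?case
      by blast
  qed
  show ?thesis
  proof (induction p rule: free_alg_induct)
    case (word c xs)
    obtain N f where f: "graded m N f" "word xs = (\<Sum>k\<le>N. f k)"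
      using \<open>\<exists>N f. graded m N f \<and> word xs = (\<Sum>k\<le>N. f k)\<close> by blast
    then have "graded m N (\<lambda>k. cnst c * f k)" "cnst c * word xs = (\<Sum>k\<le>N. cnst c * f k)"
      by (auto simp: graded_def qc_cnst wt_cnst sum_distrib_left)
    then show ?case
      by (intro exI[of _ N] exI[of _ "\<lambda>k. cnst c * f k"] conjI)
  next
    case (add p q)
    then obtain M f N g where fg: "graded m M f" "p = (\<Sum>k\<le>M. f k)" "graded m N g" "q = (\<Sum>k\<le>N. g k)"
      by blast
    have "graded m (max M N) f" "graded m (max M N) g"
      using fg graded_mono[of m _ _ "max M N"] by auto
    then have "graded m (max M N) (\<lambda>k. f k + g k)"
      by (auto simp: graded_def qc_add wt_add)
    moreover have "p + q = (\<Sum>k\<le>max M N. f k + g k)"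
      using fg graded_sum[of m _ _ "max M N"] by (simp add: sum.distrib)
    ultimately show ?case
      by (intro exI[of _ "max M N"] exI[of _ "\<lambda>k. f k + g k"] conjI)
  qed
qed

text \<open>The operator \<open>lap - (N + 1)\<close> kills the component of top weight, while \<^const>\<open>lap\<close> maps
  closed polynomials to exact ones.\<close>

lemma closed_qc:
  assumes "m \<noteq> 0" "dQ_free m p \<in> shell_ideal m"
  shows "p \<in> qc m"
proof -
  have "p \<in> qc m" if "dQ_free m p \<in> shell_ideal m" "graded m N f" "p - (\<Sum>k\<le>N. f k) \<in> shell_ideal m" for p N f
    using that
  proof (induction N arbitrary: p f)
    case 0
    then show ?case
      using qc_cong[of p "f 0" m] by (simp add: graded_def)
  next
    case (Suc N)
    define p' where "p' = lap m p - real (Suc N) *\<^sub>R p"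
    define f' where "f' k = (real k - real (Suc N)) *\<^sub>R f k" for k
    have "dQ_free m (lap m p) = dQ_free m (dQ_free m (K_free m p)) + dQ_free m (K_free m (dQ_free m p))"
      by (simp add: lap_eq dQ_add)
    also have "\<dots> \<in> shell_ideal m"
      by (rule shell.add_mem[OF dQ_dQ dQ_shell[OF K_shell[OF Suc.prems(1)]]])
    finally have "dQ_free m p' \<in> shell_ideal m"
      using Suc.prems(1) unfolding p'_def dQ_diff dQ_scaleR by (intro shell.diff_mem shell.scaleR_mem)
    moreover have "graded m N f'"
    proof -
      have "f' k = 0" if "k > N" for k
        using Suc.prems(2) that by (cases "k = Suc N") (auto simp: graded_def f'_def)
      moreover have "f' 0 \<in> qc m" "f' k \<in> wt m k" for k
        using Suc.prems(2) unfolding f'_def graded_def by (blast intro: qc_scaleR wt_scaleR)+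
      ultimately show ?thesis
        by (simp add: graded_def)
    qed
    moreover have "p' - (\<Sum>k\<le>N. f' k) \<in> shell_ideal m"
    proof -
      let ?s = "\<Sum>k\<le>Suc N. f k"
      have "(\<Sum>k\<le>N. f' k) = (\<Sum>k\<le>Suc N. f' k)"
        by (simp add: f'_def)
      then have "p' - (\<Sum>k\<le>N. f' k) = lap m (p - ?s) - real (Suc N) *\<^sub>R (p - ?s)
          + (\<Sum>k\<le>Suc N. lap m (f k) - real k *\<^sub>R f k)"
        by (simp only: p'_def f'_def lap_diff lap_sum scaleR_diff_left sum_subtractf scaleR_diff_right scaleR_sum_right)
          (simp add: algebra_simps)
      also have "\<dots> \<in> shell_ideal m"
      proof (intro shell.add_mem[OF shell.diff_mem] shell.sum_mem)
        show "lap m (p - ?s) \<in> shell_ideal m" "real (Suc N) *\<^sub>R (p - ?s) \<in> shell_ideal m"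
          by (intro lap_shell shell.scaleR_mem Suc.prems(3))+
        show "lap m (f k) - real k *\<^sub>R f k \<in> shell_ideal m" for k
          using Suc.prems(2) by (simp add: graded_def wt_def)
      qed
      finally show ?thesis .
    qed
    ultimately have "p' \<in> qc m"
      by (rule Suc.IH)
    moreover have "lap m p \<in> qc m"
      unfolding lap_eq by (intro qc_add qc_exact qc_shell K_shell Suc.prems(1))
    \<comment> \<open>This combination is \<open>p\<close> itself: the eigenvalue
      \<open>Suc N\<close> of the removed component is positive, so it can be inverted.\<close>
    ultimately have "(1 / real (Suc N)) *\<^sub>R (lap m p - p') \<in> qc m"
      by (intro qc_scaleR qc_diff)
    then show ?case
      by (simp add: p'_def)
  qed
  moreover obtain N f where "graded m N f" "p = (\<Sum>k\<le>N. f k)"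
    using weight_decomposition[OF assms(1), of p] by blast
  ultimately show ?thesis
    using assms(2) by simp
qed

section \<open>Coset calculus, traceless parts of classes, and relations between the tensors\<close>

section \<open>Quotients of free algebras\<close>

context FA_ideal
begin

lemma mem_coset: "q \<in> J +>\<^bsub>FA\<^esub> p \<longleftrightarrow> q - p \<in> J"
proof -
  have "q \<in> J +>\<^bsub>FA\<^esub> p \<longleftrightarrow> (\<exists>h\<in>J. q = h + p)"
    by (simp add: a_r_coset_def')
  then show ?thesis
    by (metis add_diff_cancel_right' diff_add_cancel)
qed

lemma coset_eq_iff: "J +>\<^bsub>FA\<^esub> p = J +>\<^bsub>FA\<^esub> q \<longleftrightarrow> p - q \<in> J"
proof
  assume "J +>\<^bsub>FA\<^esub> p = J +>\<^bsub>FA\<^esub> q"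
  then show "p - q \<in> J"
    using mem_coset[of p p] mem_coset[of p q] by simp
next
  assume pq: "p - q \<in> J"
  show "J +>\<^bsub>FA\<^esub> p = J +>\<^bsub>FA\<^esub> q"
  proof (rule Set.set_eqI)
    show "r \<in> J +>\<^bsub>FA\<^esub> p \<longleftrightarrow> r \<in> J +>\<^bsub>FA\<^esub> q" for r
      unfolding mem_coset using diff_trans[OF _ pq] diff_trans[OF _ diff_swap[OF pq]] by blast
  qed
qed

lemma quot_carrier: "carrier (FA Quot J) = range (\<lambda>p. J +>\<^bsub>FA\<^esub> p)"
  by (auto simp: FactRing_def A_RCOSETS_def' a_r_coset_def')

lemma quot_add: "(J +>\<^bsub>FA\<^esub> p) \<oplus>\<^bsub>FA Quot J\<^esub> (J +>\<^bsub>FA\<^esub> q) = J +>\<^bsub>FA\<^esub> (p + q)"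
  using abelian_subgroup.a_rcos_sum[OF abelian_subgroupI3[OF ideal.axioms(1)[OF ideal]
      ring.is_abelian_group[OF ring_FA]], of p q]
  by (simp add: FactRing_def)

lemma quot_mult: "(J +>\<^bsub>FA\<^esub> p) \<otimes>\<^bsub>FA Quot J\<^esub> (J +>\<^bsub>FA\<^esub> q) = J +>\<^bsub>FA\<^esub> (p * q)"
  using ideal.rcoset_mult_add[OF ideal, of p q] by (simp add: FactRing_def)

lemma quot_zero: "\<zero>\<^bsub>FA Quot J\<^esub> = J +>\<^bsub>FA\<^esub> 0"
  by (auto simp: FactRing_def mem_coset)

lemma quot_one: "\<one>\<^bsub>FA Quot J\<^esub> = J +>\<^bsub>FA\<^esub> 1"
  by (simp add: FactRing_def)

end

lemma ring_P: "ring (P m)"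
  unfolding P_def by (rule ideal.quotient_is_ring[OF shell.ideal])

lemma cls_eq_iff: "cls m p = cls m q \<longleftrightarrow> p - q \<in> shell_ideal m"
  unfolding cls_def by (rule shell.coset_eq_iff)

lemma mem_cls: "q \<in> cls m p \<longleftrightarrow> q - p \<in> shell_ideal m"
  unfolding cls_def by (rule shell.mem_coset)

lemma carrier_P: "carrier (P m) = range (cls m)"
  unfolding P_def cls_def by (rule shell.quot_carrier)

lemma cls_carrier [simp]: "cls m p \<in> carrier (P m)"
  by (simp add: carrier_P)

lemma cls_add: "cls m p \<oplus>\<^bsub>P m\<^esub> cls m q = cls m (p + q)"
  unfolding P_def cls_def by (rule shell.quot_add)

lemma cls_mult: "cls m p \<otimes>\<^bsub>P m\<^esub> cls m q = cls m (p * q)"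
  unfolding P_def cls_def by (rule shell.quot_mult)

lemma P_zero: "\<zero>\<^bsub>P m\<^esub> = cls m 0"
  unfolding P_def cls_def by (rule shell.quot_zero)

lemma P_one: "\<one>\<^bsub>P m\<^esub> = cls m 1"
  unfolding P_def cls_def by (rule shell.quot_one)

lemma cls_minus: "\<ominus>\<^bsub>P m\<^esub> cls m p = cls m (- p)"
proof -
  interpret ring "P m"
    by (rule ring_P)
  show ?thesis
    by (rule minus_equality) (simp_all add: cls_add P_zero)
qed

lemma cls_diff: "cls m p \<ominus>\<^bsub>P m\<^esub> cls m q = cls m (p - q)"
  by (simp add: a_minus_def cls_minus cls_add)

lemma scal_mult: "scal m c \<otimes>\<^bsub>P m\<^esub> cls m p = cls m (cnst c * p)"
  by (simp add: scal_def cls_mult)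

lemma cls_finsum: "finite A \<Longrightarrow> (\<Oplus>\<^bsub>P m\<^esub>i\<in>A. cls m (f i)) = cls m (\<Sum>i\<in>A. f i)"
proof (induction A rule: finite_induct)
  case empty
  interpret ring "P m"
    by (rule ring_P)
  show ?case
    by (simp add: P_zero)
next
  case (insert x A)
  interpret ring "P m"
    by (rule ring_P)
  show ?case
    using insert by (simp add: cls_add)
qed

subsection \<open>Traceless parts in the quotient\<close>

lemma nths_list_update:
  "i \<notin> A \<Longrightarrow> nths (xs[i := a]) A = nths xs A"
proof (induction xs arbitrary: i A)
  case (Cons x xs)
  then show ?case
    by (cases i) (simp_all add: nths_Cons)
qed simp

lemma nths_eq_nthD:
  assumes "length xs = length ys" "nths xs A = nths ys A" "k < length xs" "k \<in> A"
  shows "xs ! k = ys ! k"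
  using assms
proof (induction xs ys arbitrary: A k rule: list_induct2)
  case (Cons x xs y ys)
  have "nths xs {j. Suc j \<in> A} = nths ys {j. Suc j \<in> A}" "0 \<in> A \<Longrightarrow> x = y"
    using Cons.prems(1) by (auto simp: nths_Cons split: if_splits)
  then show ?case
    using Cons.IH[of "{j. Suc j \<in> A}" "k - 1"] Cons.prems by (cases k) auto
qed simp

text \<open>Reconciles two ways of recording the indices outside a pair of positions: deleting the
  two entries with \<open>nths\<close>, or overwriting them with \<open>erase\<close>.\<close>

lemma erase_eqI:
  assumes "length xs = length ys" "nths xs (- {i, j}) = nths ys (- {i, j})"
  shows "erase i j xs = erase i j ys"
proof (rule nth_equalityI)
  fix k assume "k < length (erase i j xs)"
  then show "erase i j xs ! k = erase i j ys ! k"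
    using nths_eq_nthD[OF assms, of k] assms(1) by (cases "k = j"; cases "k = i") simp_all
qed (simp add: assms)

lemma sum_offdiagonal:
  fixes f :: "nat \<Rightarrow> nat \<Rightarrow> 'w::comm_monoid_add"
  shows "(\<Sum>i<n. \<Sum>j\<in>{..<n} - {i}. f i j) = (\<Sum>j<n. \<Sum>i<j. f i j + f j i)"
proof (induction n)
  case (Suc n)
  have "(\<Sum>i<Suc n. \<Sum>j\<in>{..<Suc n} - {i}. f i j)
      = (\<Sum>i<n. f i n + (\<Sum>j\<in>{..<n} - {i}. f i j)) + (\<Sum>j<n. f n j)"
  proof -
    have "{..<Suc n} - {i} = insert n ({..<n} - {i})" if "i < n" for i
      using that by auto
    moreover have "{..<Suc n} - {n} = {..<n}"
      by auto
    ultimately show ?thesis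
      by simp
  qed
  then show ?case
    using Suc by (simp add: sum.distrib ac_simps)
qed simp

lemma finsum_eta:
  "(\<Oplus>\<^bsub>P m\<^esub>\<mu>\<in>UNIV. \<Oplus>\<^bsub>P m\<^esub>\<nu>\<in>UNIV. scal m (eta \<mu> \<nu>) \<otimes>\<^bsub>P m\<^esub> cls m (f \<mu> \<nu>)) = cls m (\<Sum>\<mu>\<in>UNIV. sg \<mu> *\<^sub>R f \<mu> \<mu>)"
  by (simp add: scal_mult cls_finsum eta_sum)

lemma finsum_eta_sum:
  "(\<Oplus>\<^bsub>P m\<^esub>j\<in>{..<n}. \<Oplus>\<^bsub>P m\<^esub>i\<in>{..<j}. scal m (eta (xs ! i) (xs ! j)) \<otimes>\<^bsub>P m\<^esub> cls m (f i j))
    = cls m (\<Sum>j<n. \<Sum>i<j. reta (xs ! i) (xs ! j) *\<^sub>R f i j)"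
  by (simp add: scal_mult cls_finsum eta_eq_reta cnst_of_real)

lemma shell_subspace: "subspace (shell_ideal m)"
  by (auto simp: subspace_def shell.add_mem shell.scaleR_mem)

lemma trl_shell: "(\<And>y. length y = length xs \<Longrightarrow> T y \<in> shell_ideal m) \<Longrightarrow> trl T xs \<in> shell_ideal m"
  unfolding trl_def by (intro shell.sum_mem shell.scaleR_mem) (auto simp: idx_def)

lemma is_traceless_part_trl: "is_traceless_part m n (\<lambda>xs. cls m (T xs)) (\<lambda>xs. cls m (trl T xs))"
  unfolding is_traceless_part_def
proof (intro conjI)
  show "traceless m n (\<lambda>xs. cls m (trl T xs))"
    unfolding traceless_def
  proof (intro allI impI)
    fix xs :: "4 list" and i j
    assume "length xs = n \<and> i < j \<and> j < n"
    then show "(\<Oplus>\<^bsub>P m\<^esub>\<mu>\<in>UNIV. \<Oplus>\<^bsub>P m\<^esub>\<nu>\<in>UNIV. scal m (eta \<mu> \<nu>) \<otimes>\<^bsub>P m\<^esub> cls m (trl T (xs[i := \<mu>, j := \<nu>]))) = \<zero>\<^bsub>P m\<^esub>"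
      unfolding finsum_eta P_zero using trc_trl[of i xs j T] by (simp add: trc_def)
  qed
  obtain S where S: "\<And>xs. length xs = n \<Longrightarrow> T xs - trl T xs
      = (\<Sum>i<n. \<Sum>j\<in>{..<n} - {i}. reta (xs ! i) (xs ! j) *\<^sub>R S i j (erase i j xs))"
    using trl_diff_eta[of n T] by blast
  define g where "g i j xs = S i j (erase i j xs) + S j i (erase j i xs)" for i j xs
  \<comment> \<open>The coefficient must be a function of the remaining indices alone. Any list with
    these remaining indices may be chosen, since \<open>g\<close> sees it only after
    erasure.\<close>
  define s where "s i j ys = cls m (g i j (SOME xs. length xs = n \<and> nths xs (- {i, j}) = ys))" for i j ys
  have s: "s i j (nths xs (- {i, j})) = cls m (g i j xs)" if "length xs = n" for i j xs
  proof -
    define ys where "ys = (SOME ys. length ys = n \<and> nths ys (- {i, j}) = nths xs (- {i, j}))"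
    have ys: "length ys = n \<and> nths ys (- {i, j}) = nths xs (- {i, j})"
      unfolding ys_def by (rule someI[of _ xs]) (simp add: that)
    then have "erase i j ys = erase i j xs" "erase j i ys = erase j i xs"
      using that by (auto intro!: erase_eqI simp: insert_commute[of j])
    then show ?thesis
      by (simp only: s_def g_def flip: ys_def)
  qed
  show "is_eta_sum m n (\<lambda>xs. cls m (T xs) \<ominus>\<^bsub>P m\<^esub> cls m (trl T xs))"
    unfolding is_eta_sum_def
  proof (intro exI[of _ s] conjI allI impI)
    show "s i j ys \<in> carrier (P m)" for i j ys
      by (simp add: s_def)
    fix xs :: "4 list" assume xs: "length xs = n"
    have "T xs - trl T xs = (\<Sum>j<n. \<Sum>i<j. reta (xs ! i) (xs ! j) *\<^sub>R g i j xs)"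
      unfolding S[OF xs] sum_offdiagonal
      by (intro sum.cong refl) (simp add: g_def scaleR_add_right reta_sym)
    then show "cls m (T xs) \<ominus>\<^bsub>P m\<^esub> cls m (trl T xs)
        = (\<Oplus>\<^bsub>P m\<^esub>j\<in>{..<n}. \<Oplus>\<^bsub>P m\<^esub>i\<in>{..<j}.
            scal m (eta (xs ! i) (xs ! j)) \<otimes>\<^bsub>P m\<^esub> s i j (nths xs (- {i, j})))"
      unfolding s[OF xs] finsum_eta_sum by (simp only: cls_diff)
  qed
qed simp

text \<open>On representatives, the projection fixes \<open>t0\<close> modulo the ideal because
  \<open>t0\<close> is traceless, and it kills \<open>T - t0\<close> because that is a sum of
  multiples of the metric.\<close>

lemma is_traceless_part_unique:
  assumes t0: "is_traceless_part m n (\<lambda>xs. cls m (T xs)) t0" and xs: "length xs = n"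
  shows "t0 xs = cls m (trl T xs)"
proof -
  have "\<exists>p. length y = n \<longrightarrow> t0 y = cls m p" for y
    using t0 by (auto simp: is_traceless_part_def carrier_P)
  then obtain R where R: "\<And>y. length y = n \<Longrightarrow> t0 y = cls m (R y)"
    by metis
  have trl_R: "R xs - trl R xs \<in> shell_ideal m"
  proof (rule trl_diff_mem[OF shell_subspace])
    have trc: "trc i j R z \<in> shell_ideal m" if "i < j" "j < n" "length z = n" for i j z
    proof -
      have "(\<Oplus>\<^bsub>P m\<^esub>\<mu>\<in>UNIV. \<Oplus>\<^bsub>P m\<^esub>\<nu>\<in>UNIV. scal m (eta \<mu> \<nu>) \<otimes>\<^bsub>P m\<^esub> cls m (R (z[i := \<mu>, j := \<nu>]))) = \<zero>\<^bsub>P m\<^esub>"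
        using t0 that unfolding is_traceless_part_def traceless_def by (simp add: R)
      then show ?thesis
        unfolding finsum_eta P_zero cls_eq_iff by (simp add: trc_def)
    qed
    fix i j and z :: "4 list"
    assume ij: "i < length xs" "j < length xs" "i \<noteq> j" "length z = length xs"
    have "trc i j R z = trc j i R z"
      using ij by (simp add: trc_def list_update_swap)
    then show "trc i j R z \<in> shell_ideal m"
      using trc[of i j z] trc[of j i z] ij xs by (cases "i < j") auto
  qed
  obtain s where s: "\<And>i j ys. s i j ys \<in> carrier (P m)"
    "\<And>xs. length xs = n \<Longrightarrow> cls m (T xs) \<ominus>\<^bsub>P m\<^esub> t0 xs = (\<Oplus>\<^bsub>P m\<^esub>j\<in>{..<n}. \<Oplus>\<^bsub>P m\<^esub>i\<in>{..<j}.
                     scal m (eta (xs ! i) (xs ! j)) \<otimes>\<^bsub>P m\<^esub> s i j (nths xs (- {i, j})))"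
    using t0 unfolding is_traceless_part_def is_eta_sum_def by blast
  have "\<exists>p. s i j ys = cls m p" for i j ys
    using s(1)[of i j ys] by (auto simp: carrier_P)
  then obtain S where S: "\<And>i j ys. s i j ys = cls m (S i j ys)"
    by metis
  define E where "E y = (\<Sum>j<n. \<Sum>i<j. reta (y ! i) (y ! j) *\<^sub>R S i j (nths y (- {i, j})))" for y
  have "T y - R y - E y \<in> shell_ideal m" if "length y = n" for y
    using s(2)[OF that] unfolding S R[OF that] finsum_eta_sum cls_diff cls_eq_iff by (simp add: E_def)
  then have "trl (\<lambda>y. T y - R y - E y) xs \<in> shell_ideal m"
    using xs by (intro trl_shell) simp
  moreover have "trl E xs = 0"
  proof -
    have "trl (\<lambda>y. reta (y ! i) (y ! j) *\<^sub>R S i j (nths y (- {i, j}))) xs = 0" if "i < j" "j < n" for i j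
      using that xs by (intro trl_kill) (auto simp: nths_list_update)
    then show ?thesis
      unfolding E_def[abs_def] trl_sum by (intro sum.neutral ballI) simp
  qed
  ultimately have "trl T xs - trl R xs \<in> shell_ideal m"
    by (simp add: trl_diff)
  from shell.diff_mem[OF trl_R this] have "R xs - trl T xs \<in> shell_ideal m"
    by simp
  then show ?thesis
    by (simp add: R xs cls_eq_iff)
qed

lemma traceless_part_cls: "traceless_part m (\<lambda>xs. cls m (T xs)) xs = cls m (trl T xs)"
  unfolding traceless_part_def
proof (rule the_equality)
  show "\<exists>t0. is_traceless_part m (length xs) (\<lambda>xs. cls m (T xs)) t0 \<and> cls m (trl T xs) = t0 xs"
    using is_traceless_part_trl[of m "length xs" T] by blast
qed (auto simp: is_traceless_part_unique)

lemma symb_val_eq: "symb_val m s = cls m (ev_gen m s)"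
  by (cases s) (simp_all add: F0_def phi0_def traceless_part_cls F_free_eq[unfolded One_nat_def])

lemma symb_eval_eq: "symb_eval m q = cls m (ev m q)"
proof -
  have "foldr (\<lambda>x y. symb_val m x \<otimes>\<^bsub>P m\<^esub> y) xs \<one>\<^bsub>P m\<^esub> = cls m (ev m (word xs))" for xs
    by (induction xs) (simp_all add: P_one symb_val_eq cls_mult)
  then show ?thesis
    unfolding symb_eval_def
    by (simp add: scal_mult cls_finsum) (simp add: word_ext_def)
qed

subsection \<open>Relations between the traceless tensors\<close>

lemma swp_1: "swp 1 (a # b # zs) = b # a # zs"
proof (rule nth_equalityI)
  fix i assume "i < length (swp 1 (a # b # zs))"
  then show "swp 1 (a # b # zs) ! i = (b # a # zs) ! i"
    unfolding swp_def
    by (subst permute_list_nth[OF transpose_permutes]) (auto simp: Transposition.transpose_def nth_Cons')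
qed simp

definition cyc :: "nat \<Rightarrow> nat" where
  "cyc = Transposition.transpose 0 1 \<circ> Transposition.transpose 1 2"

lemma cyc_permutes: "3 \<le> n \<Longrightarrow> cyc permutes {..<n}"
  unfolding cyc_def by (intro permutes_compose permutes_swap_id) auto

lemma permute_cyc: "permute_list cyc (a # b # c # zs) = b # c # a # zs"
proof (rule nth_equalityI)
  fix i assume "i < length (permute_list cyc (a # b # c # zs))"
  then show "permute_list cyc (a # b # c # zs) ! i = (b # c # a # zs) ! i"
    by (subst permute_list_nth[OF cyc_permutes]) (auto simp: cyc_def Transposition.transpose_def nth_Cons')
qed simp

lemma trl_curl_antisym: "trl (curl A) (\<nu> # \<mu> # \<rho>s) = - trl (curl A) (\<mu> # \<nu> # \<rho>s)"
proof -
  let ?xs = "\<mu> # \<nu> # \<rho>s"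
  have "trl (curl A) (\<nu> # \<mu> # \<rho>s) = trl (\<lambda>y. curl A (swp 1 y)) ?xs"
    using trl_swp[of 1 ?xs "curl A"] by (simp add: swp_1[simplified])
  also have "\<dots> = trl (\<lambda>y. - 1 *\<^sub>R curl A y) ?xs"
  proof (rule trl_cong)
    fix y :: "4 list" assume "length y = length ?xs"
    then obtain a b zs where "y = a # b # zs"
      by (cases y; cases "tl y") auto
    then show "curl A (swp 1 y) = - 1 *\<^sub>R curl A y"
      by (simp add: swp_1[simplified] curl_def)
  qed
  also have "\<dots> = - 1 *\<^sub>R trl (curl A) ?xs"
    by (rule trl_scaleR)
  finally show ?thesis
    by simp
qed

lemma trl_curl_bianchi:
  "trl (curl A) (\<mu> # \<nu> # \<rho> # \<sigma>s) + trl (curl A) (\<nu> # \<rho> # \<mu> # \<sigma>s) + trl (curl A) (\<rho> # \<mu> # \<nu> # \<sigma>s) = 0"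
proof -
  let ?xs = "\<mu> # \<nu> # \<rho> # \<sigma>s"
  let ?c = "permute_list cyc"
  have 1: "trl (curl A) (\<nu> # \<rho> # \<mu> # \<sigma>s) = trl (\<lambda>y. curl A (?c y)) ?xs"
    using trl_permute[OF cyc_permutes, of ?xs "curl A"] by (simp add: permute_cyc)
  have "trl (curl A) (\<rho> # \<mu> # \<nu> # \<sigma>s) = trl (\<lambda>y. curl A (?c y)) (?c ?xs)"
    using trl_permute[OF cyc_permutes, of "?c ?xs" "curl A"] by (simp add: permute_cyc)
  also have "\<dots> = trl (\<lambda>y. curl A (?c (?c y))) ?xs"
    using trl_permute[OF cyc_permutes, of ?xs "\<lambda>y. curl A (?c y)"] by simp
  finally have "trl (curl A) ?xs + trl (curl A) (\<nu> # \<rho> # \<mu> # \<sigma>s) + trl (curl A) (\<rho> # \<mu> # \<nu> # \<sigma>s)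
      = trl (\<lambda>y. curl A y + curl A (?c y) + curl A (?c (?c y))) ?xs"
    by (simp add: 1 trl_add)
  also have "\<dots> = trl (\<lambda>y. 0) ?xs"
  proof (rule trl_cong)
    fix y :: "4 list" assume "length y = length ?xs"
    then obtain a b c zs where "y = a # b # c # zs"
      by (cases y; cases "tl y"; cases "tl (tl y)") auto
    then show "curl A y + curl A (?c y) + curl A (?c (?c y)) = 0"
      by (simp add: permute_cyc curl_def add_mset_commute)
  qed
  finally show ?thesis
    by (simp add: trl_zero)
qed

lemma trl_curl_cong:
  assumes "mset \<rho>s = mset \<rho>s'"
  shows "trl (curl A) (\<mu> # \<nu> # \<rho>s) = trl (curl A) (\<mu> # \<nu> # \<rho>s')"
proof -
  obtain f where f: "f permutes {..<length \<rho>s'}" "permute_list f \<rho>s' = \<rho>s"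
    using mset_eq_permutation[OF assms] by blast
  define \<sigma> where "\<sigma> k = (if k < 2 then k else f (k - 2) + 2)" for k
  have f_less: "f k < length \<rho>s'" if "k < length \<rho>s'" for k
    using permutes_in_image[OF f(1), of k] that by simp
  have \<sigma>: "\<sigma> permutes {..<length (\<mu> # \<nu> # \<rho>s')}"
  proof (rule inj_imp_permutes)
    show "inj_on \<sigma> {..<length (\<mu> # \<nu> # \<rho>s')}"
    proof (rule inj_onI)
      fix a b assume "\<sigma> a = \<sigma> b"
      moreover have "a - 2 = b - 2" if "f (a - 2) = f (b - 2)"
        using that permutes_inj[OF f(1)] by (rule injD[rotated])
      ultimately show "a = b"
        by (auto simp: \<sigma>_def split: if_splits)
    qed
    show "\<sigma> k \<in> {..<length (\<mu> # \<nu> # \<rho>s')}" if "k \<in> {..<length (\<mu> # \<nu> # \<rho>s')}" for k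
      using that f_less[of "k - 2"] by (auto simp: \<sigma>_def)
    show "\<sigma> k = k" if "k \<notin> {..<length (\<mu> # \<nu> # \<rho>s')}" for k
      using that permutes_not_in[OF f(1), of "k - 2"] by (auto simp: \<sigma>_def)
  qed simp
  have perm: "permute_list \<sigma> (a # b # zs) = a # b # permute_list f zs" if "length zs = length \<rho>s'" for a b zs
  proof (rule nth_equalityI)
    fix k assume "k < length (permute_list \<sigma> (a # b # zs))"
    then show "permute_list \<sigma> (a # b # zs) ! k = (a # b # permute_list f zs) ! k"
      using \<sigma> f(1) that by (auto simp: permute_list_nth \<sigma>_def nth_Cons' numeral_2_eq_2)
  qed simp
  have "trl (curl A) (\<mu> # \<nu> # \<rho>s) = trl (\<lambda>y. curl A (permute_list \<sigma> y)) (\<mu> # \<nu> # \<rho>s')"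
    using trl_permute[OF \<sigma>, of "curl A"] by (simp add: perm f(2))
  also have "\<dots> = trl (curl A) (\<mu> # \<nu> # \<rho>s')"
  proof (rule trl_cong)
    fix y :: "4 list" assume y: "length y = length (\<mu> # \<nu> # \<rho>s')"
    then obtain a b zs where "y = a # b # zs" "length zs = length \<rho>s'"
      by (cases y; cases "tl y") auto
    then show "curl A (permute_list \<sigma> y) = curl A y"
      using f(1) by (simp add: perm curl_def mset_permute_list)
  qed
  finally show ?thesis .
qed

lemma trl_phi_cong:
  assumes "mset xs = mset ys"
  shows "trl (phi_free m) xs = trl (phi_free m) ys"
proof -
  obtain f where f: "f permutes {..<length ys}" "permute_list f ys = xs"
    using mset_eq_permutation[OF assms] by blast
  have "phi_free m (permute_list f y) = phi_free m y" if "length y = length ys" for y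
  proof -
    have "mset (permute_list f y) = mset y"
      using f(1) that by (simp add: mset_permute_list)
    then show ?thesis
      using sum_ml_nth[of Vg "permute_list f y"] sum_ml_nth[of Vg y] by (simp add: phi_free_eq symt_def)
  qed
  then have "trl (\<lambda>y. phi_free m (permute_list f y)) ys = trl (phi_free m) ys"
    by (intro trl_cong)
  then show ?thesis
    using trl_permute[OF f(1), of "phi_free m"] f(2) by simp
qed

text \<open>Makes the evaluation well defined on the quotient. Symmetry, trace and Bianchi relations
  already hold in the free algebra, by equivariance and tracelessness of the projection; the
  commutators are treated modulo the ideal, as the tensors are even.\<close>

lemma ev_symb_ideal: "q \<in> symb_ideal \<Longrightarrow> ev m q \<in> shell_ideal m"
  unfolding symb_ideal_def
proof (rule shell.free_hom_Idl)
  fix g assume "g \<in> symb_commutators \<union> symb_symmetries \<union> symb_bianchi"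
  then consider (comm) x y where "g = gen x * gen y - gen y * gen x"
    | (anti) \<mu> \<nu> \<rho>s where "g = gen (SF \<mu> \<nu> \<rho>s) + gen (SF \<nu> \<mu> \<rho>s)"
    | (SF) \<mu> \<nu> \<rho>s \<rho>s' where "g = gen (SF \<mu> \<nu> \<rho>s) - gen (SF \<mu> \<nu> \<rho>s')" "mset \<rho>s = mset \<rho>s'"
    | (SPhi) \<mu> \<nu>s \<mu>' \<nu>s' where "g = gen (SPhi \<mu> \<nu>s) - gen (SPhi \<mu>' \<nu>s')" "mset (\<mu> # \<nu>s) = mset (\<mu>' # \<nu>s')"
    | (tr1) n where "n \<ge> 2" "g \<in> traces (\<lambda>xs. gen (SF (xs ! 0) (xs ! 1) (drop 2 xs))) n"
    | (tr2) n where "n \<ge> 1" "g \<in> traces (\<lambda>xs. gen (SPhi (hd xs) (tl xs))) n"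
    | (bianchi) \<mu> \<nu> \<rho> \<sigma>s where
        "g = gen (SF \<mu> \<nu> (\<rho> # \<sigma>s)) + gen (SF \<nu> \<rho> (\<mu> # \<sigma>s)) + gen (SF \<rho> \<mu> (\<nu> # \<sigma>s))"
    unfolding symb_commutators_def symb_symmetries_def symb_bianchi_def
    by (elim UnE UN_E CollectE exE conjE) simp_all
  then show "ev m g \<in> shell_ideal m"
  proof cases
    case comm
    then show ?thesis
      using shell_commute[OF ev_gen_lin[of m x] ev_gen_lin[of m y], of m]
      by (simp add: cnst.word_ext_diff cnst.alg_ext_mult comm_sign_def)
  next
    case anti
    then show ?thesis
      using trl_curl_antisym[of Vg \<nu> \<mu> \<rho>s] by (simp add: cnst.word_ext_add)
  next
    case SF
    then show ?thesis
      using trl_curl_cong[OF SF(2), of Vg \<mu> \<nu>] by (simp add: cnst.word_ext_diff)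
  next
    case SPhi
    then show ?thesis
      using trl_phi_cong[OF SPhi(2), of m] by (simp add: cnst.word_ext_diff)
  next
    case tr1
    then obtain xs i j where xs: "length xs = n" "i < j" "j < n"
      and g: "g = (\<Sum>\<mu>\<in>UNIV. \<Sum>\<nu>\<in>UNIV. cnst (eta \<mu> \<nu>) * gen (SF (xs[i := \<mu>, j := \<nu>] ! 0)
          (xs[i := \<mu>, j := \<nu>] ! 1) (drop 2 (xs[i := \<mu>, j := \<nu>]))))"
      unfolding traces_def by blast
    have split: "y ! 0 # y ! 1 # drop 2 y = y" if "length y = n" for y :: "4 list"
      using that \<open>n \<ge> 2\<close> by (cases y; cases "tl y") auto
    have "ev m g = (\<Sum>\<mu>\<in>UNIV. \<Sum>\<nu>\<in>UNIV. cnst (eta \<mu> \<nu>) * trl (curl Vg) (xs[i := \<mu>, j := \<nu>]))"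
      unfolding g cnst.word_ext_sum cnst.word_ext_cnst_mult cnst.alg_ext_gen ev_gen.simps
      using xs by (intro sum.cong refl) (simp only: split length_list_update)
    also have "\<dots> = trc i j (trl (curl Vg)) xs"
      unfolding eta_sum trc_def ..
    finally show ?thesis
      using trc_trl[of i xs j "curl Vg"] xs by simp
  next
    case tr2
    then obtain xs i j where xs: "length xs = n" "i < j" "j < n"
      and g: "g = (\<Sum>\<mu>\<in>UNIV. \<Sum>\<nu>\<in>UNIV. cnst (eta \<mu> \<nu>) * gen (SPhi (hd (xs[i := \<mu>, j := \<nu>]))
          (tl (xs[i := \<mu>, j := \<nu>]))))"
      unfolding traces_def by blast
    have split: "hd y # tl y = y" if "length y = n" for y :: "4 list"
      using that \<open>n \<ge> 1\<close> by (cases y) auto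
    have "ev m g = (\<Sum>\<mu>\<in>UNIV. \<Sum>\<nu>\<in>UNIV. cnst (eta \<mu> \<nu>) * trl (phi_free m) (xs[i := \<mu>, j := \<nu>]))"
      unfolding g cnst.word_ext_sum cnst.word_ext_cnst_mult cnst.alg_ext_gen ev_gen.simps
      using xs by (intro sum.cong refl) (simp only: split length_list_update)
    also have "\<dots> = trc i j (trl (phi_free m)) xs"
      unfolding eta_sum trc_def ..
    finally show ?thesis
      using trc_trl[of i xs j "phi_free m"] xs by simp
  next
    case bianchi
    then show ?thesis
      using trl_curl_bianchi[of Vg \<mu> \<nu> \<rho> \<sigma>s] by (simp add: cnst.word_ext_add)
  qed
qed

section \<open>Cohomology classes and the comparison of the quotients\<close>

section \<open>The cohomology of the differential\<close>

lemma d_Q_cls: "d_Q m (cls m p) = cls m (dQ_free m p)"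
proof -
  have "cls m (dQ_free m q) = cls m (dQ_free m p)" if "q \<in> cls m p" for q
    using that dQ_shell[of "q - p" m] by (simp add: mem_cls cls_eq_iff dQ_diff)
  moreover have "p \<in> cls m p"
    by (simp add: mem_cls)
  ultimately show ?thesis
    unfolding d_Q_def by blast
qed

lemma Z_Q_cls: "cls m p \<in> Z_Q m \<longleftrightarrow> dQ_free m p \<in> shell_ideal m"
  by (simp add: Z_Q_def d_Q_cls P_zero cls_eq_iff)

lemma Z_Q_eq: "Z_Q m = {cls m p | p. dQ_free m p \<in> shell_ideal m}"
proof -
  have "A \<in> Z_Q m \<Longrightarrow> \<exists>p. A = cls m p" for A
    by (auto simp: Z_Q_def carrier_P)
  then show ?thesis
    using Z_Q_cls by fastforce
qed

lemma B_Q_eq: "B_Q m = range (\<lambda>r. cls m (dQ_free m r))"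
  by (simp add: B_Q_def carrier_P image_image d_Q_cls)

lemma B_Q_cls: "cls m p \<in> B_Q m \<longleftrightarrow> (\<exists>r. p - dQ_free m r \<in> shell_ideal m)"
  by (auto simp: B_Q_eq cls_eq_iff)

definition coh :: "real \<Rightarrow> jet free_alg \<Rightarrow> jet free_alg set set" where
  "coh m p = B_Q m +>\<^bsub>P m\<^esub> cls m p"

lemma coh_eq: "coh m p = range (\<lambda>r. cls m (p + dQ_free m r))"
proof -
  have "coh m p = (\<lambda>h. h \<oplus>\<^bsub>P m\<^esub> cls m p) ` B_Q m"
    by (auto simp: coh_def a_r_coset_def')
  then show ?thesis
    by (simp add: B_Q_eq image_image cls_add add.commute)
qed

lemma cls_mem_coh: "cls m q \<in> coh m p \<longleftrightarrow> (\<exists>r. q - p - dQ_free m r \<in> shell_ideal m)"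
  by (auto simp: coh_eq cls_eq_iff diff_diff_eq)

lemma coh_eq_iff: "coh m p = coh m q \<longleftrightarrow> (\<exists>r. p - q - dQ_free m r \<in> shell_ideal m)"
proof
  have "p - p - dQ_free m 0 \<in> shell_ideal m"
    by (simp add: dQ_free_def)
  then have "cls m p \<in> coh m p"
    unfolding cls_mem_coh by blast
  moreover assume "coh m p = coh m q"
  ultimately have "cls m p \<in> coh m q"
    by simp
  then show "\<exists>r. p - q - dQ_free m r \<in> shell_ideal m"
    by (simp only: cls_mem_coh)
next
  assume "\<exists>r. p - q - dQ_free m r \<in> shell_ideal m"
  then obtain r where r: "p - q - dQ_free m r \<in> shell_ideal m" ..
  have "cls m (p + dQ_free m s) = cls m (q + dQ_free m (s + r))" for s
    using r by (simp add: cls_eq_iff dQ_add algebra_simps)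
  moreover have "cls m (q + dQ_free m s) = cls m (p + dQ_free m (s - r))" for s
    using shell.minus_mem[OF r] by (simp add: cls_eq_iff dQ_diff algebra_simps)
  ultimately show "coh m p = coh m q"
    unfolding coh_eq by blast
qed

lemma H_Q_carrier: "carrier (H_Q m) = {coh m p | p. dQ_free m p \<in> shell_ideal m}"
proof -
  have "carrier (H_Q m) = (\<lambda>z. B_Q m +>\<^bsub>P m\<^esub> z) ` Z_Q m"
    by (auto simp: H_Q_def FactRing_def A_RCOSETS_def' a_r_coset_def')
  then show ?thesis
    by (auto simp: Z_Q_eq coh_def)
qed

lemma H_Q_add: "coh m p \<oplus>\<^bsub>H_Q m\<^esub> coh m q = coh m (p + q)"
proof -
  have "coh m p \<oplus>\<^bsub>H_Q m\<^esub> coh m q = (\<Union>a\<in>coh m p. \<Union>b\<in>coh m q. {a \<oplus>\<^bsub>P m\<^esub> b})"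
    by (simp add: H_Q_def FactRing_def set_add_def')
  also have "\<dots> = (\<Union>r s. {cls m (p + q + dQ_free m (r + s))})"
    by (simp add: coh_eq cls_add dQ_add ac_simps)
  also have "\<dots> = coh m (p + q)"
  proof -
    have "\<exists>r s. t = r + s" for t :: "jet free_alg"
      by (rule exI[of _ t], rule exI[of _ 0]) simp
    then show ?thesis
      unfolding coh_eq by (auto simp: image_iff) metis
  qed
  finally show ?thesis .
qed

lemma H_scal_eq: "H_scal m c = coh m (cnst c)"
  by (simp add: H_scal_def coh_def scal_def)

lemma H_Q_scal:
  assumes "dQ_free m p \<in> shell_ideal m"
  shows "H_scal m c \<otimes>\<^bsub>H_Q m\<^esub> coh m p = coh m (cnst c * p)"
proof -
  have "H_scal m c \<otimes>\<^bsub>H_Q m\<^esub> coh m p = (\<Union>a\<in>coh m (cnst c). \<Union>b\<in>coh m p. B_Q m +>\<^bsub>P m\<^esub> (a \<otimes>\<^bsub>P m\<^esub> b))"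
    by (simp add: H_scal_eq H_Q_def FactRing_def rcoset_mult_def a_r_coset_def')
  also have "\<dots> = (\<Union>r s. coh m ((cnst c + dQ_free m r) * (p + dQ_free m s)))"
    by (simp add: coh_eq[of m "cnst c"] coh_eq[of m p] cls_mult flip: coh_def)
  moreover have "coh m ((cnst c + dQ_free m r) * (p + dQ_free m s)) = coh m (cnst c * p)" for r s
  proof -
    define q where "q = p + dQ_free m s"
    then have "dQ_free m q \<in> shell_ideal m"
      using assms by (simp add: dQ_add shell.add_mem dQ_dQ)
    moreover have p: "p = q - dQ_free m s"
      by (simp add: q_def)
    \<comment> \<open>Changing the representative of the scalar by an exact term changes the product
      by an exact term, up to a multiple of \<open>d_Q q\<close>, which vanishes on shell.\<close>
    have "(cnst c + dQ_free m r) * q - cnst c * p - dQ_free m (r * q + cnst c * s)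
        = - (twist jet_sign r * dQ_free m q)"
      by (subst p) (simp add: dQ_add dQ_mult[of m r] dQ_cnst_mult algebra_simps)
    ultimately have "(cnst c + dQ_free m r) * q - cnst c * p - dQ_free m (r * q + cnst c * s) \<in> shell_ideal m"
      by (simp only: shell.minus_mem shell.left_mem)
    then have "\<exists>t. (cnst c + dQ_free m r) * q - cnst c * p - dQ_free m t \<in> shell_ideal m"
      by blast
    then show ?thesis
      unfolding coh_eq_iff q_def .
  qed
  ultimately show ?thesis
    by simp
qed

lemma coh_ev_surj:
  assumes "m \<noteq> 0"
  shows "carrier (H_Q m) = range (\<lambda>q. coh m (ev m q))"
proof -
  have "\<exists>q. coh m p = coh m (ev m q)" if "dQ_free m p \<in> shell_ideal m" for p
    using closed_qc[OF assms that] unfolding qc_def coh_eq_iff by blast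
  then show ?thesis
    unfolding H_Q_carrier by (auto simp: dQ_ev image_iff)
qed

text \<open>The left inverse \<open>h\<close> annihilates both the ideal and the exact term, which
  leaves the equality of the classes of \<open>p\<close> and \<open>q\<close> among the
  symbols.\<close>

lemma coh_ev_inj:
  assumes "m \<noteq> 0" "coh m (ev m p) = coh m (ev m q)"
  shows "p - q \<in> symb_ideal"
proof -
  obtain r where r: "ev m p - ev m q - dQ_free m r \<in> shell_ideal m"
    using assms(2) by (auto simp: coh_eq_iff)
  obtain h where h: "\<And>p. p \<in> shell_ideal m \<Longrightarrow> sc.alg_ext h p = 0"
    "\<And>p. sc.alg_ext h (dQ_free m p) = 0" "\<And>q. sc.alg_ext h (ev m q) = abs_salg q"
    using to_symb_exists[OF assms(1)] by blast
  from h(1)[OF r] show ?thesis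
    by (simp add: sc.word_ext_diff h(2,3) flip: abs_salg_eq_iff)
qed

subsection \<open>Polynomials in the traceless tensors\<close>

lemma F0_eq: "F0 m \<mu> \<nu> \<rho>s = cls m (ev m (gen (SF \<mu> \<nu> \<rho>s)))"
  using symb_val_eq[of m "SF \<mu> \<nu> \<rho>s"] by simp

lemma phi0_eq: "phi0 m (\<mu> # \<nu>s) = cls m (ev m (gen (SPhi \<mu> \<nu>s)))"
  using symb_val_eq[of m "SPhi \<mu> \<nu>s"] by simp

lemma P0_eq: "P0 m = range (\<lambda>q. cls m (ev m q))"
proof (intro equalityI subsetI)
  fix x assume "x \<in> P0 m"
  then show "x \<in> range (\<lambda>q. cls m (ev m q))"
    unfolding P0_def
  proof (induction rule: generate_ring.induct)
    case one
    show ?case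
      by (rule range_eqI[of _ _ 1]) (simp add: P_one)
  next
    case (incl h)
    then consider c where "h = scal m c" | \<mu> \<nu> \<rho>s where "h = F0 m \<mu> \<nu> \<rho>s"
      | xs where "h = phi0 m xs" "xs \<noteq> []"
      by auto
    then show ?case
    proof cases
      case (1 c)
      then show ?thesis
        by (intro range_eqI[of _ _ "cnst c"]) (simp add: scal_def)
    next
      case (2 \<mu> \<nu> \<rho>s)
      then show ?thesis
        by (intro range_eqI[of _ _ "gen (SF \<mu> \<nu> \<rho>s)"]) (simp add: F0_eq)
    next
      case (3 xs)
      then obtain \<mu> \<nu>s where "xs = \<mu> # \<nu>s"
        by (cases xs) auto
      then show ?thesis
        using 3 by (intro range_eqI[of _ _ "gen (SPhi \<mu> \<nu>s)"]) (simp add: phi0_eq)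
    qed
  next
    case (a_inv h)
    then obtain q where "h = cls m (ev m q)"
      by blast
    then show ?case
      by (intro range_eqI[of _ _ "- q"]) (simp add: cls_minus cnst.word_ext_minus)
  next
    case (eng_add h1 h2)
    then obtain q q' where "h1 = cls m (ev m q)" "h2 = cls m (ev m q')"
      by blast
    then show ?case
      by (intro range_eqI[of _ _ "q + q'"]) (simp add: cls_add cnst.word_ext_add)
  next
    case (eng_mult h1 h2)
    then obtain q q' where "h1 = cls m (ev m q)" "h2 = cls m (ev m q')"
      by blast
    then show ?case
      by (intro range_eqI[of _ _ "q * q'"]) (simp add: cls_mult cnst.alg_ext_mult)
  qed
next
  fix x assume "x \<in> range (\<lambda>q. cls m (ev m q))"
  then obtain q where x: "x = cls m (ev m q)"
    by blast
  have val: "symb_val m s \<in> P0 m" for s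
    unfolding P0_def by (rule generate_ring.incl, cases s) auto
  have word: "cls m (ev m (word xs)) \<in> P0 m" for xs
  proof (induction xs)
    case Nil
    show ?case
      unfolding P0_def using generate_ring.one[of "P m"] by (simp add: P_one)
  next
    case (Cons s xs)
    have "cls m (ev m (word (s # xs))) = symb_val m s \<otimes>\<^bsub>P m\<^esub> cls m (ev m (word xs))"
      by (simp add: symb_val_eq cls_mult)
    then show ?case
      using Cons val[of s] unfolding P0_def by (simp only: generate_ring.eng_mult)
  qed
  have "cls m (ev m q) \<in> P0 m"
  proof (induction q rule: free_alg_induct)
    case (word c xs)
    have "cls m (ev m (cnst c * word xs)) = scal m c \<otimes>\<^bsub>P m\<^esub> cls m (ev m (word xs))"
      by (simp only: cnst.word_ext_cnst_mult scal_mult)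
    moreover have "scal m c \<in> P0 m"
      unfolding P0_def by (rule generate_ring.incl) simp
    ultimately show ?case
      using \<open>\<And>xs. cls m (ev m (word xs)) \<in> P0 m\<close> unfolding P0_def by (simp only: generate_ring.eng_mult)
  next
    case (add p q)
    then show ?case
      unfolding P0_def cnst.word_ext_add cls_add[symmetric] by (rule generate_ring.eng_add)
  qed
  then show "x \<in> P0 m"
    by (simp add: x)
qed

lemma ring_P0: "ring (P0_alg m)"
  unfolding P0_def
  by (rule ring.generate_ring_is_ring[OF ring_P])
    (use P0_eq[of m] in \<open>auto simp: P0_def scal_def F0_eq neq_Nil_conv phi0_eq\<close>)

lemma bianchi_eq: "bianchi m = {\<zero>\<^bsub>P m\<^esub>}"
proof -
  interpret P0: ring "P0_alg m"
    by (rule ring_P0)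
  let ?G = "{F0 m \<mu> \<nu> (\<rho> # \<sigma>s) \<oplus>\<^bsub>P m\<^esub> F0 m \<nu> \<rho> (\<mu> # \<sigma>s) \<oplus>\<^bsub>P m\<^esub> F0 m \<rho> \<mu> (\<nu> # \<sigma>s) | \<mu> \<nu> \<rho> \<sigma>s. True}"
  have "F0 m \<mu> \<nu> (\<rho> # \<sigma>s) \<oplus>\<^bsub>P m\<^esub> F0 m \<nu> \<rho> (\<mu> # \<sigma>s) \<oplus>\<^bsub>P m\<^esub> F0 m \<rho> \<mu> (\<nu> # \<sigma>s) = \<zero>\<^bsub>P m\<^esub>" for \<mu> \<nu> \<rho> \<sigma>s
    using trl_curl_bianchi[of Vg \<mu> \<nu> \<rho> \<sigma>s] by (simp add: F0_eq cls_add P_zero)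
  then have "?G = {\<zero>\<^bsub>P0_alg m\<^esub>}"
    by auto
  then have "bianchi m = Idl\<^bsub>P0_alg m\<^esub> {\<zero>\<^bsub>P0_alg m\<^esub>}"
    unfolding bianchi_def by (simp only:)
  also have "\<dots> = {\<zero>\<^bsub>P0_alg m\<^esub>}"
    by (rule P0.genideal_zero)
  finally show ?thesis
    by simp
qed

lemma bianchi_coset: "bianchi m +>\<^bsub>P m\<^esub> cls m p = {cls m p}"
  unfolding bianchi_eq a_r_coset_def' by (simp add: P_zero cls_add)

lemma P0_quot_carrier: "carrier (P0_alg m Quot bianchi m) = range (\<lambda>q. {cls m (ev m q)})"
proof -
  have "carrier (P0_alg m Quot bianchi m) = (\<lambda>x. bianchi m +>\<^bsub>P m\<^esub> x) ` P0 m"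
    by (auto simp: FactRing_def A_RCOSETS_def' a_r_coset_def')
  then show ?thesis
    by (simp add: P0_eq image_image bianchi_coset)
qed

lemma P0_quot_add: "{cls m p} \<oplus>\<^bsub>P0_alg m Quot bianchi m\<^esub> {cls m q} = {cls m (p + q)}"
  by (simp add: FactRing_def set_add_def' cls_add)

lemma P0_quot_scal: "(bianchi m +>\<^bsub>P m\<^esub> scal m c) \<otimes>\<^bsub>P0_alg m Quot bianchi m\<^esub> {cls m p} = {cls m (cnst c * p)}"
proof -
  have "(bianchi m +>\<^bsub>P m\<^esub> scal m c) \<otimes>\<^bsub>P0_alg m Quot bianchi m\<^esub> {cls m p} = bianchi m +>\<^bsub>P m\<^esub> cls m (cnst c * p)"
    by (simp add: FactRing_def rcoset_mult_def scal_def bianchi_coset cls_mult) (simp add: a_r_coset_def' bianchi_eq P_zero cls_add)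
  then show ?thesis
    by (simp only: bianchi_coset)
qed

text \<open>All the spaces compared are images of the free algebra of symbols, so an isomorphism
  amounts to a compatible map together with an inclusion of kernels.\<close>

lemma linear_isoI:
  fixes a :: "'s free_alg \<Rightarrow> 'a"
  assumes A: "carrier A = range a" "\<And>p q. a p \<oplus>\<^bsub>A\<^esub> a q = a (p + q)" "\<And>c p. \<iota> c \<otimes>\<^bsub>A\<^esub> a p = a (cnst c * p)"
    and B: "carrier B = range b" "\<And>p q. b p \<oplus>\<^bsub>B\<^esub> b q = b (p + q)" "\<And>c p. \<kappa> c \<otimes>\<^bsub>B\<^esub> b p = b (cnst c * p)"
    and f: "\<And>p. f (a p) = b p" and inj: "\<And>p q. b p = b q \<Longrightarrow> a p = a q"
  shows "linear_iso A \<iota> B \<kappa> f"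
proof -
  have "inj_on f (range a)"
    by (rule inj_onI) (auto simp: f intro: inj)
  moreover have "f ` range a = range b"
    by (simp add: image_image f)
  ultimately have "bij_betw f (carrier A) (carrier B)"
    unfolding bij_betw_def A(1) B(1) by blast
  moreover have "f \<in> hom (add_monoid A) (add_monoid B)"
  proof (rule homI)
    fix x y assume "x \<in> carrier (add_monoid A)" "y \<in> carrier (add_monoid A)"
    then obtain p q where "x = a p" "y = a q"
      unfolding A(1) partial_object.simps by blast
    then show "f (x \<otimes>\<^bsub>add_monoid A\<^esub> y) = f x \<otimes>\<^bsub>add_monoid B\<^esub> f y"
      by (simp add: A(2) B(2) f)
  qed (use A(1) B(1) f in force)
  moreover have "f (\<iota> c \<otimes>\<^bsub>A\<^esub> x) = \<kappa> c \<otimes>\<^bsub>B\<^esub> f x" if "x \<in> carrier A" for c x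
    using that A(3) B(3) f unfolding A(1) by auto
  ultimately show ?thesis
    unfolding linear_iso_def iso_def by simp
qed

theorem theorem5p5:
  fixes m :: real
  assumes "m > 0"
  shows "(\<forall>p\<in>Z_Q m. \<exists>q\<in>P0 m. p \<ominus>\<^bsub>P m\<^esub> q \<in> B_Q m)
    \<and> linear_iso (P0_alg m Quot bianchi m) (\<lambda>c. bianchi m +>\<^bsub>P m\<^esub> scal m c)
        (H_Q m) (H_scal m) (\<lambda>K. \<Union>q\<in>K. B_Q m +>\<^bsub>P m\<^esub> q)
    \<and> linear_iso (FA Quot symb_ideal) (\<lambda>c. symb_ideal +>\<^bsub>FA\<^esub> cnst c)
        (H_Q m) (H_scal m) (\<lambda>K. \<Union>p\<in>K. B_Q m +>\<^bsub>P m\<^esub> symb_eval m p)"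
proof (intro conjI ballI)
  have m: "m \<noteq> 0"
    using assms by simp
  have H_add: "coh m (ev m p) \<oplus>\<^bsub>H_Q m\<^esub> coh m (ev m q) = coh m (ev m (p + q))" for p q
    by (simp add: H_Q_add cnst.word_ext_add)
  have H_scal: "H_scal m c \<otimes>\<^bsub>H_Q m\<^esub> coh m (ev m p) = coh m (ev m (cnst c * p))" for c p
    by (simp add: H_Q_scal dQ_ev cnst.word_ext_cnst_mult)
  show "\<exists>q\<in>P0 m. x \<ominus>\<^bsub>P m\<^esub> q \<in> B_Q m" if "x \<in> Z_Q m" for x
  proof -
    obtain p where p: "x = cls m p" "dQ_free m p \<in> shell_ideal m"
      using \<open>x \<in> Z_Q m\<close> by (auto simp: Z_Q_eq)
    obtain q r where "p - ev m q - dQ_free m r \<in> shell_ideal m"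
      using closed_qc[OF m p(2)] unfolding qc_def by blast
    then have "cls m (p - ev m q) \<in> B_Q m"
      unfolding B_Q_cls by blast
    then show ?thesis
      by (intro bexI[of _ "cls m (ev m q)"]) (simp_all add: p cls_diff P0_eq)
  qed
  show "linear_iso (P0_alg m Quot bianchi m) (\<lambda>c. bianchi m +>\<^bsub>P m\<^esub> scal m c)
      (H_Q m) (H_scal m) (\<lambda>K. \<Union>q\<in>K. B_Q m +>\<^bsub>P m\<^esub> q)"
  proof (rule linear_isoI[where a = "\<lambda>q. {cls m (ev m q)}" and b = "\<lambda>q. coh m (ev m q)"])
    \<comment> \<open>Injectivity on \<open>P0\<close> is derived from injectivity on formal
      symbols, since the evaluation sends their relations into the mass shell ideal.\<close>
    show "{cls m (ev m p)} = {cls m (ev m q)}" if "coh m (ev m p) = coh m (ev m q)" for p q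
      using ev_symb_ideal[OF coh_ev_inj[OF m that], of m] by (simp add: cls_eq_iff cnst.word_ext_diff)
  qed (simp_all add: P0_quot_carrier P0_quot_add P0_quot_scal H_add H_scal coh_ev_surj[OF m]
      cnst.word_ext_add cnst.word_ext_cnst_mult flip: coh_def)
  show "linear_iso (FA Quot symb_ideal) (\<lambda>c. symb_ideal +>\<^bsub>FA\<^esub> cnst c)
      (H_Q m) (H_scal m) (\<lambda>K. \<Union>p\<in>K. B_Q m +>\<^bsub>P m\<^esub> symb_eval m p)"
  proof (rule linear_isoI[where a = "\<lambda>q. symb_ideal +>\<^bsub>FA\<^esub> q" and b = "\<lambda>q. coh m (ev m q)"])
    show "(\<Union>q\<in>symb_ideal +>\<^bsub>FA\<^esub> p. B_Q m +>\<^bsub>P m\<^esub> symb_eval m q) = coh m (ev m p)" for p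
    proof -
      have "B_Q m +>\<^bsub>P m\<^esub> symb_eval m q = coh m (ev m p)" if "q \<in> symb_ideal +>\<^bsub>FA\<^esub> p" for q
      proof -
        have "ev m (q - p) \<in> shell_ideal m"
          using that by (intro ev_symb_ideal) (simp add: symb_ideal.mem_coset)
        then have "cls m (ev m q) = cls m (ev m p)"
          by (simp add: cls_eq_iff cnst.word_ext_diff)
        then show ?thesis
          by (simp add: symb_eval_eq coh_def)
      qed
      moreover have "p \<in> symb_ideal +>\<^bsub>FA\<^esub> p"
        by (simp add: symb_ideal.mem_coset)
      ultimately show ?thesis
        by blast
    qed
    show "symb_ideal +>\<^bsub>FA\<^esub> p = symb_ideal +>\<^bsub>FA\<^esub> q" if "coh m (ev m p) = coh m (ev m q)" for p q
      using coh_ev_inj[OF m that] by (simp only: symb_ideal.coset_eq_iff)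
  qed (simp_all add: symb_ideal.quot_carrier symb_ideal.quot_add symb_ideal.quot_mult H_add H_scal
      coh_ev_surj[OF m])
qed

end
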